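(* Let $\lambda_1,\dots,\lambda_n$ be real numbers with $1\le\lambda_i\le\lambda_{i+1}<\lambda_i+2$ for $1\le i\le n-1$. For $1\le i\le n$ let $M_{i,z}$ be the operator of multiplication by $z$ on the reproducing kernel Hilbert space $H_{K_i}$ of holomorphic functions on $\mathbb D$ with kernel $K_i(z,w)=\frac{1}{(1-z\bar w)^{\lambda_i}}$. Let $\psi_{i,i+1}\in C(\bar{\mathbb D})\cap\mathrm{Hol}(\mathbb D)$ be non-zero functions for $1\le i\le n-1$, and let $\phi_{i,j}\in H^\infty(\mathbb D)$ for $1\le i<j\le n$ with $j-i\ge2$. Let $T$ be the upper-triangular operator on $H_{K_1}\oplus\cdots\oplus H_{K_n}$ whose $(i,i)$ entry is $M_{i,z}^*$, whose $(i,i+1)$ entry is $M_{\psi_{i,i+1}}^*$, and whose $(i,j)$ entry is $M_{\phi_{i,j}}^*$ for $j-i\ge2$. Then $T$ is weakly homogeneous if and only if each $\psi_{i,i+1}$, $1\le i\le n-1$, is non-vanishing (on $\bar{\mathbb D}$).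
   Context: $\mathbb D$ is the open unit disk. In the $(i,j)$ entry with $i<j$, $M_\phi^*:H_{K_j}\to H_{K_i}$ denotes the adjoint of the bounded multiplication operator $M_\phi:H_{K_i}\to H_{K_j}$, $f\mapsto\phi f$. A bounded operator $T$ on a Hilbert space is weakly homogeneous if $\sigma(T)\subseteq\bar{\mathbb D}$ and $\phi(T)$ is similar to $T$ for every $\phi$ in Möb, the group of biholomorphic automorphisms (Möbius transformations) of $\mathbb D$. Two operators $A,B$ are similar if $XA=BX$ for some bounded invertible $X$. *)

theory Defs
  imports "HOL-Complex_Analysis.Complex_Analysis" "HOL-Library.Function_Algebras"
begin

section \<open>Complex Hilbert spaces\<close>

class complex_vector = ab_group_add +
  fixes scaleC :: "complex \<Rightarrow> 'a \<Rightarrow> 'a" (infixr "*\<^sub>C" 75)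
  assumes scaleC_add_right: "c *\<^sub>C (x + y) = c *\<^sub>C x + c *\<^sub>C y"
    and scaleC_add_left: "(c + d) *\<^sub>C x = c *\<^sub>C x + d *\<^sub>C x"
    and scaleC_scaleC: "c *\<^sub>C d *\<^sub>C x = (c * d) *\<^sub>C x"
    and scaleC_one: "1 *\<^sub>C x = x"

instantiation complex :: complex_vector
begin
definition scaleC_complex :: "complex \<Rightarrow> complex \<Rightarrow> complex" where
  "scaleC_complex c x = c * x"
instance by standard (simp_all add: scaleC_complex_def algebra_simps)
end

instantiation "fun" :: (type, complex_vector) complex_vector
begin
definition scaleC_fun :: "complex \<Rightarrow> ('a \<Rightarrow> 'b) \<Rightarrow> 'a \<Rightarrow> 'b" where
  "scaleC_fun c f = (\<lambda>x. c *\<^sub>C f x)"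
instance
  by standard
    (simp_all add: scaleC_fun_def fun_eq_iff scaleC_add_right scaleC_add_left scaleC_scaleC scaleC_one)
end

text \<open>
  A Hilbert space is a complex subspace of an ambient vector space together with an inner product,
  which is linear in its first argument and matters only on the subspace.  Operators are functions
  on the ambient type and likewise matter only on the subspace.
\<close>

record 'a ip_space =
  carr :: "'a set"
  ip :: "'a \<Rightarrow> 'a \<Rightarrow> complex"

definition ip_norm :: "'a::complex_vector ip_space \<Rightarrow> 'a \<Rightarrow> real" where
  "ip_norm V x = sqrt (Re (ip V x x))"

definition csubspace :: "'a::complex_vector set \<Rightarrow> bool" where
  "csubspace S \<longleftrightarrow> 0 \<in> S \<and> (\<forall>x\<in>S. \<forall>y\<in>S. x + y \<in> S) \<and> (\<forall>c. \<forall>x\<in>S. c *\<^sub>C x \<in> S)"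

definition inner_product_space :: "'a::complex_vector ip_space \<Rightarrow> bool" where
  "inner_product_space V \<longleftrightarrow>
     csubspace (carr V) \<and>
     (\<forall>x\<in>carr V. \<forall>y\<in>carr V. \<forall>z\<in>carr V. ip V (x + y) z = ip V x z + ip V y z) \<and>
     (\<forall>c. \<forall>x\<in>carr V. \<forall>y\<in>carr V. ip V (c *\<^sub>C x) y = c * ip V x y) \<and>
     (\<forall>x\<in>carr V. \<forall>y\<in>carr V. ip V y x = cnj (ip V x y)) \<and>
     (\<forall>x\<in>carr V. x \<noteq> 0 \<longrightarrow> Re (ip V x x) > 0)"

definition hilbert_space :: "'a::complex_vector ip_space \<Rightarrow> bool" where
  "hilbert_space V \<longleftrightarrow>
     inner_product_space V \<and>
     (\<forall>X :: nat \<Rightarrow> 'a.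
        (\<forall>k. X k \<in> carr V) \<and> (\<forall>e>0. \<exists>N. \<forall>k\<ge>N. \<forall>m\<ge>N. ip_norm V (X k - X m) < e)
        \<longrightarrow> (\<exists>x\<in>carr V. (\<lambda>k. ip_norm V (X k - x)) \<longlonglongrightarrow> 0))"

definition direct_sum :: "nat set \<Rightarrow> (nat \<Rightarrow> 'a::complex_vector ip_space) \<Rightarrow> (nat \<Rightarrow> 'a) ip_space" where
  "direct_sum I V =
     \<lparr>carr = {x. (\<forall>i\<in>I. x i \<in> carr (V i)) \<and> (\<forall>i. i \<notin> I \<longrightarrow> x i = 0)},
      ip = (\<lambda>x y. \<Sum>i\<in>I. ip (V i) (x i) (y i))\<rparr>"


section \<open>Bounded operators\<close>

definition bounded_op ::
    "'a::complex_vector ip_space \<Rightarrow> 'b::complex_vector ip_space \<Rightarrow> ('a \<Rightarrow> 'b) \<Rightarrow> bool" where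
  "bounded_op V W A \<longleftrightarrow>
     (\<forall>x\<in>carr V. A x \<in> carr W) \<and>
     (\<forall>x\<in>carr V. \<forall>y\<in>carr V. A (x + y) = A x + A y) \<and>
     (\<forall>c. \<forall>x\<in>carr V. A (c *\<^sub>C x) = c *\<^sub>C A x) \<and>
     (\<exists>C. \<forall>x\<in>carr V. ip_norm W (A x) \<le> C * ip_norm V x)"

definition adjoint_op ::
    "'a::complex_vector ip_space \<Rightarrow> 'b::complex_vector ip_space \<Rightarrow> ('a \<Rightarrow> 'b) \<Rightarrow> 'b \<Rightarrow> 'a" where
  "adjoint_op V W A y = (THE x. x \<in> carr V \<and> (\<forall>u\<in>carr V. ip W (A u) y = ip V u x))"

definition invertible_op :: "'a::complex_vector ip_space \<Rightarrow> ('a \<Rightarrow> 'a) \<Rightarrow> bool" where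
  "invertible_op V X \<longleftrightarrow>
     bounded_op V V X \<and>
     (\<exists>Y. bounded_op V V Y \<and> (\<forall>x\<in>carr V. Y (X x) = x) \<and> (\<forall>x\<in>carr V. X (Y x) = x))"

definition op_spectrum :: "'a::complex_vector ip_space \<Rightarrow> ('a \<Rightarrow> 'a) \<Rightarrow> complex set" where
  "op_spectrum V T = {\<mu>. \<not> invertible_op V (\<lambda>x. T x - \<mu> *\<^sub>C x)}"

definition similar_op :: "'a::complex_vector ip_space \<Rightarrow> ('a \<Rightarrow> 'a) \<Rightarrow> ('a \<Rightarrow> 'a) \<Rightarrow> bool" where
  "similar_op V A B \<longleftrightarrow> (\<exists>X. invertible_op V X \<and> (\<forall>x\<in>carr V. X (A x) = B (X x)))"


section \<open>Weak homogeneity\<close>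

definition disc_automorphism :: "(complex \<Rightarrow> complex) \<Rightarrow> bool" where
  "disc_automorphism \<phi> \<longleftrightarrow>
     \<phi> holomorphic_on ball 0 1 \<and> \<phi> \<in> ball 0 1 \<rightarrow> ball 0 1 \<and>
     (\<exists>\<psi>. \<psi> holomorphic_on ball 0 1 \<and> \<psi> \<in> ball 0 1 \<rightarrow> ball 0 1 \<and>
          (\<forall>z\<in>ball 0 1. \<psi> (\<phi> z) = z \<and> \<phi> (\<psi> z) = z))"

definition moebius_params :: "(complex \<Rightarrow> complex) \<Rightarrow> real \<times> complex \<Rightarrow> bool" where
  "moebius_params \<phi> p \<longleftrightarrow>
     cmod (snd p) < 1 \<and> (\<forall>z\<in>ball 0 1. \<phi> z = Moebius_function (fst p) (snd p) z)"

lemma disc_automorphism_moebius_params: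
  assumes "disc_automorphism \<phi>"
  shows "\<exists>p. moebius_params \<phi> p"
proof -
  obtain \<psi> where h: "\<phi> holomorphic_on ball 0 1" "\<phi> \<in> ball 0 1 \<rightarrow> ball 0 1"
    "\<psi> holomorphic_on ball 0 1" "\<psi> \<in> ball 0 1 \<rightarrow> ball 0 1"
    and inv: "\<And>z. z\<in>ball 0 1 \<Longrightarrow> \<psi> (\<phi> z) = z" "\<And>z. z\<in>ball 0 1 \<Longrightarrow> \<phi> (\<psi> z) = z"
    using assms by (auto simp: disc_automorphism_def)
  define a where "a = \<psi> 0"
  define m where "m = Moebius_function 0 a"
  define m' where "m' = Moebius_function 0 (- a)"
  have a: "cmod a < 1" using h(4) by (auto simp: a_def Pi_iff)
  have mh: "m holomorphic_on ball 0 1" "m' holomorphic_on ball 0 1"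
    unfolding m_def m'_def by (intro Moebius_function_holomorphic; simp add: a)+
  have mm: "m \<in> ball 0 1 \<rightarrow> ball 0 1" "m' \<in> ball 0 1 \<rightarrow> ball 0 1"
    by (auto simp: m_def m'_def a Moebius_function_norm_lt_1)
  have mi: "m (m' z) = z" "m' (m z) = z" if "z \<in> ball 0 1" for z
    using that a by (auto simp: m_def m'_def intro!: Moebius_function_compose)
  define f where "f = (\<lambda>z. \<phi> (m' z))"
  define g where "g = (\<lambda>z. m (\<psi> z))"
  have f0: "f 0 = 0"
    using inv(2)[of 0] by (simp add: f_def m'_def Moebius_function_of_zero a_def)
  have g0: "g 0 = 0"
    by (simp add: g_def m_def a_def Moebius_function_eq_zero)
  have fh: "f holomorphic_on ball 0 1" "g holomorphic_on ball 0 1"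
    unfolding f_def g_def
    using holomorphic_on_compose_gen[OF mh(2) h(1)] holomorphic_on_compose_gen[OF h(3) mh(1)] mm h
    by (auto simp: o_def image_subset_iff Pi_iff)
  have fm: "cmod (f z) < 1" "cmod (g z) < 1" if "cmod z < 1" for z
    using that mm h by (auto simp: f_def g_def Pi_iff)
  have gf: "g (f z) = z" if "cmod z < 1" for z
    using that mm h inv mi by (auto simp: f_def g_def Pi_iff)
  have "cmod (f (1/2)) = cmod (1/2 :: complex)"
  proof (rule antisym)
    show "cmod (f (1/2)) \<le> cmod (1/2 :: complex)"
      by (rule Schwarz_Lemma(1)[OF fh(1) f0 fm(1)]) simp_all
    have "cmod (g (f (1/2))) \<le> cmod (f (1/2))"
      by (rule Schwarz_Lemma(1)[OF fh(2) g0 fm(2)]) (simp_all add: fm)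
    then show "cmod (1/2 :: complex) \<le> cmod (f (1/2))" by (simp add: gf)
  qed
  then have "\<exists>z. cmod z < 1 \<and> z \<noteq> 0 \<and> cmod (f z) = cmod z"
    by (intro exI[of _ "1/2"]) simp
  then have "\<exists>c. (\<forall>z. cmod z < 1 \<longrightarrow> f z = c * z) \<and> cmod c = 1"
    using Schwarz_Lemma(3)[OF fh(1) f0 fm(1), of 0] by simp
  then obtain c where c: "\<And>z. cmod z < 1 \<Longrightarrow> f z = c * z" "cmod c = 1"
    by blast
  then have ce: "c = exp (\<i> * of_real (Arg c))"
    using Arg_eq[of c] by fastforce
  have "\<phi> z = Moebius_function (Arg c) a z" if "z \<in> ball 0 1" for z
  proof -
    have "\<phi> z = f (m z)" using that mi by (simp add: f_def)
    also have "\<dots> = c * m z" using that mm c(1) by (auto simp: Pi_iff)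
    finally show ?thesis using ce by (simp add: m_def Moebius_function_def)
  qed
  then show ?thesis using a by (intro exI[of _ "(Arg c, a)"]) (simp add: moebius_params_def)
qed

text \<open>
  The functional calculus for \<open>\<phi>(z) = e^(i t) (z - a) / (1 - cnj a z)\<close>, that is
  \<open>\<phi>(T) = e^(i t) (T - a I) (I - cnj a T)^(-1)\<close>.  If the spectrum of \<open>T\<close> lies in the closed disc
  then \<open>I - cnj a T\<close> is invertible.  The function \<open>\<phi>\<close> determines \<open>a\<close> and \<open>e^(i t)\<close>, so the value does not
  depend on the choice of the parameters.
\<close>

definition moebius_op ::
    "'a::complex_vector ip_space \<Rightarrow> (complex \<Rightarrow> complex) \<Rightarrow> ('a \<Rightarrow> 'a) \<Rightarrow> 'a \<Rightarrow> 'a" where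
  "moebius_op V \<phi> T x =
     (let (t, a) = (SOME p. moebius_params \<phi> p);
          y = inv_into (carr V) (\<lambda>v. v - cnj a *\<^sub>C T v) x
      in exp (\<i> * of_real t) *\<^sub>C (T y - a *\<^sub>C y))"

definition weakly_homogeneous :: "'a::complex_vector ip_space \<Rightarrow> ('a \<Rightarrow> 'a) \<Rightarrow> bool" where
  "weakly_homogeneous V T \<longleftrightarrow>
     bounded_op V V T \<and> op_spectrum V T \<subseteq> cball 0 1 \<and>
     (\<forall>\<phi>. disc_automorphism \<phi> \<longrightarrow> similar_op V (moebius_op V \<phi> T) T)"


section \<open>Reproducing kernel Hilbert spaces on the disc\<close>

text \<open>Functions on \<open>D\<close> are represented by functions that vanish outside \<open>D\<close>.\<close>

definition rkhs ::
    "complex set \<Rightarrow> (complex \<Rightarrow> complex \<Rightarrow> complex) \<Rightarrow> (complex \<Rightarrow> complex) ip_space \<Rightarrow> bool" where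
  "rkhs D K V \<longleftrightarrow>
     hilbert_space V \<and>
     (\<forall>f\<in>carr V. \<forall>z. z \<notin> D \<longrightarrow> f z = 0) \<and>
     (\<forall>w\<in>D. (\<lambda>z. if z \<in> D then K z w else 0) \<in> carr V \<and>
             (\<forall>f\<in>carr V. ip V f (\<lambda>z. if z \<in> D then K z w else 0) = f w))"

text \<open>On the disc \<open>1 - z * cnj w\<close> has positive real part, so the principal power is the usual one.\<close>

definition disc_kernel :: "real \<Rightarrow> complex \<Rightarrow> complex \<Rightarrow> complex" where
  "disc_kernel l z w = 1 / (1 - z * cnj w) powr (of_real l)"

definition mult_op :: "(complex \<Rightarrow> complex) \<Rightarrow> (complex \<Rightarrow> complex) \<Rightarrow> complex \<Rightarrow> complex" where
  "mult_op g f = (\<lambda>z. g z * f z)"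


section \<open>The upper-triangular operator\<close>

definition triangular_op ::
    "nat \<Rightarrow> (nat \<Rightarrow> (complex \<Rightarrow> complex) ip_space) \<Rightarrow> (nat \<Rightarrow> complex \<Rightarrow> complex) \<Rightarrow>
     (nat \<Rightarrow> nat \<Rightarrow> complex \<Rightarrow> complex) \<Rightarrow>
     (nat \<Rightarrow> complex \<Rightarrow> complex) \<Rightarrow> nat \<Rightarrow> complex \<Rightarrow> complex" where
  "triangular_op n H \<psi> \<phi> x =
     (\<lambda>i. if i \<in> {1..n} then
            \<Sum>j=i..n.
              adjoint_op (H i) (H j)
                (mult_op (if j = i then (\<lambda>z. z) else if j = i + 1 then \<psi> i else \<phi> i j)) (x j)
          else 0)"

end

theory Submission
  imports Defs
begin

text \<open>
  \<^bold>\<open>The model.\<close> The operator \<open>T\<close> is the adjoint of multiplication by a lower triangular \<open>n \<times> n\<close> matrix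
  \<open>\<Phi>\<close> of bounded analytic functions, with \<open>z\<close> on the diagonal and \<open>\<psi>\<^sub>i\<close> at the place \<open>(i + 1, i)\<close>.
  Such a matrix acts boundedly because \<open>H\<^sub>i\<close> is multiplied into \<open>H\<^sub>j\<close> for \<open>i \<le> j\<close>
  (\<open>mult_op_bound\<close>): in terms of Taylor coefficients the norm of \<open>H\<^sub>i\<close> is a weighted \<open>\<ell>\<^sup>2\<close>-norm with
  weights that decrease in the degree and in \<open>i\<close>, and the estimate on the Hardy space holds for
  every initial segment of coefficients.  Composition with a disc automorphism is bounded too
  (\<open>comp_op_bounded\<close>), since a weighted version of it is unitary.

  \<^bold>\<open>Reduction to matrices.\<close> On the adjoint side \<open>\<phi>(T)\<close> becomes the matrix \<open>u(\<Phi>)\<close>, where \<open>u\<close> is the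
  automorphism \<open>s \<mapsto> cnj (\<phi> (cnj s))\<close>, and composition with \<open>u\<^sup>-\<^sup>1\<close> turns it into a lower triangular
  matrix \<open>G\<close> with diagonal \<open>z\<close> and subdiagonal \<open>(u' \<psi>\<^sub>i) \<circ> u\<^sup>-\<^sup>1\<close>.  So \<open>\<phi>(T)\<close> is similar to \<open>T\<close> exactly
  when some invertible operator intertwines \<open>\<Phi>\<close> and \<open>G\<close> (\<open>similar_iff_intertwining\<close>, \<open>similar_model\<close>).

  \<^bold>\<open>Sufficiency.\<close> If every \<open>\<psi>\<^sub>i\<close> is free of zeros on the closed disc, it is a unit among the bounded
  analytic functions, and so is the subdiagonal of \<open>G\<close>.  With \<open>N = \<Phi> - z\<close>, the vectors
  \<open>e\<^sub>1, N e\<^sub>1, N\<^sup>2 e\<^sub>1, \<dots>\<close> are the columns of an invertible lower triangular matrix which conjugates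
  \<open>\<Phi>\<close> to \<open>z + J\<close> with a single nilpotent Jordan block \<open>J\<close> (\<open>cyclic_basis\<close>).  The same holds for \<open>G\<close>.

  \<^bold>\<open>Necessity.\<close> Let \<open>Z\<close> be an invertible intertwiner.  A bounded operator from \<open>H\<^sub>j\<close> to \<open>H\<^sub>i\<close> whose
  commutator with \<open>z\<close> is multiplication by \<open>\<eta>\<close> acts like \<open>f \<mapsto> \<eta> f'\<close>, up to a multiplication operator.
  As differentiation raises the exponent of the kernel by two, \<open>\<lambda>\<^sub>i < \<lambda>\<^sub>j + 2\<close> forces \<open>\<eta> = 0\<close>
  (\<open>commutator_multiplication_eq_zero\<close>).  Applied diagonal by diagonal this shows that \<open>Z\<close> is lower
  triangular with multiplication operators \<open>x\<^sub>i\<close> on the diagonal, and, one diagonal below, that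
  \<open>G\<^sub>i\<^sub>+\<^sub>1\<^sub>,\<^sub>i x\<^sub>i = x\<^sub>i\<^sub>+\<^sub>1 \<psi>\<^sub>i\<close>.  The same applies to \<open>Z\<^sup>-\<^sup>1\<close>, so \<open>x\<^sub>i\<close> and \<open>1 / x\<^sub>i\<close> are bounded, and
  \<open>\<bar>\<psi>\<^sub>i \<circ> u\<bar> \<le> C \<bar>\<psi>\<^sub>i\<bar>\<close> on the disc for every automorphism \<open>u\<close>.  Automorphisms act transitively on the
  disc and on the circle, so one zero of \<open>\<psi>\<^sub>i\<close> would make it vanish identically
  (\<open>nonvanishing_if_quasi_invariant\<close>).
\<close>

section \<open>Hilbert spaces given by a carrier and an inner product\<close>

lemma scaleC_zero_left [simp]: "0 *\<^sub>C (x::'a::complex_vector) = 0"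
  using scaleC_add_left[of 0 0 x] by simp

lemma scaleC_zero_right [simp]: "c *\<^sub>C (0::'a::complex_vector) = 0"
  using scaleC_add_right[of c 0 0] by simp

lemma scaleC_minus_one: "(-1) *\<^sub>C (x::'a::complex_vector) = - x"
  using scaleC_add_left[of 1 "-1" x] by (simp add: scaleC_one add_eq_0_iff)

lemma scaleC_minus_left: "(- c) *\<^sub>C (x::'a::complex_vector) = - (c *\<^sub>C x)"
  using scaleC_add_left[of c "- c" x] by (simp add: add_eq_0_iff)

lemma scaleC_minus_right: "c *\<^sub>C (- x::'a::complex_vector) = - (c *\<^sub>C x)"
  using scaleC_add_right[of c x "- x"] by (simp add: add_eq_0_iff)

lemma scaleC_diff_right: "c *\<^sub>C (x - y::'a::complex_vector) = c *\<^sub>C x - c *\<^sub>C y"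
  using scaleC_add_right[of c x "- y"] by (simp add: scaleC_minus_right)

lemma scaleC_fun_apply [simp]: "(c *\<^sub>C f) x = c *\<^sub>C f x"
  by (simp add: scaleC_fun_def)

lemma scaleC_complex_eq [simp]: "c *\<^sub>C (z::complex) = c * z"
  by (simp add: scaleC_complex_def)

lemma sum_fun_apply: "(\<Sum>k\<in>A. f k) x = (\<Sum>k\<in>A. f k x)"
  by (induction A rule: infinite_finite_induct) auto

locale ip_sp =
  fixes V :: "'a::complex_vector ip_space"
  assumes ips: "inner_product_space V"
begin

lemma zero_mem [simp, intro]: "0 \<in> carr V"
  and add_mem [simp, intro]: "x \<in> carr V \<Longrightarrow> y \<in> carr V \<Longrightarrow> x + y \<in> carr V"
  and scale_mem [simp, intro]: "x \<in> carr V \<Longrightarrow> c *\<^sub>C x \<in> carr V"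
  using ips by (auto simp: inner_product_space_def csubspace_def)

lemma minus_mem [simp, intro]: "x \<in> carr V \<Longrightarrow> - x \<in> carr V"
  using scale_mem[of x "-1"] by (simp add: scaleC_minus_one)

lemma diff_mem [simp, intro]: "x \<in> carr V \<Longrightarrow> y \<in> carr V \<Longrightarrow> x - y \<in> carr V"
  using add_mem[of x "- y"] by simp

lemma sum_mem [intro]: "(\<And>k. k \<in> A \<Longrightarrow> f k \<in> carr V) \<Longrightarrow> (\<Sum>k\<in>A. f k) \<in> carr V"
  by (induction A rule: infinite_finite_induct) auto

lemma ip_cnj: "x \<in> carr V \<Longrightarrow> y \<in> carr V \<Longrightarrow> cnj (ip V x y) = ip V y x"
  using ips[unfolded inner_product_space_def, THEN conjunct2, THEN conjunct2, THEN conjunct2, THEN conjunct1] by metis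

lemma ip_add_left: "x \<in> carr V \<Longrightarrow> y \<in> carr V \<Longrightarrow> z \<in> carr V \<Longrightarrow> ip V (x + y) z = ip V x z + ip V y z"
  using ips[unfolded inner_product_space_def, THEN conjunct2, THEN conjunct1] by blast

lemma ip_scale_left: "x \<in> carr V \<Longrightarrow> y \<in> carr V \<Longrightarrow> ip V (c *\<^sub>C x) y = c * ip V x y"
  using ips[unfolded inner_product_space_def, THEN conjunct2, THEN conjunct2, THEN conjunct1] by blast

lemma ip_pos: "x \<in> carr V \<Longrightarrow> x \<noteq> 0 \<Longrightarrow> 0 < Re (ip V x x)"
  using ips[unfolded inner_product_space_def, THEN conjunct2, THEN conjunct2, THEN conjunct2, THEN conjunct2] by blast

lemma ip_add_right:
  "x \<in> carr V \<Longrightarrow> y \<in> carr V \<Longrightarrow> z \<in> carr V \<Longrightarrow> ip V z (x + y) = ip V z x + ip V z y"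
  using ip_cnj[of "x + y" z] ip_cnj[of x z] ip_cnj[of y z] by (metis add_mem complex_cnj_add ip_add_left)

lemma ip_scale_right: "x \<in> carr V \<Longrightarrow> y \<in> carr V \<Longrightarrow> ip V y (c *\<^sub>C x) = cnj c * ip V y x"
  by (metis complex_cnj_mult ip_cnj ip_scale_left scale_mem)

lemma ip_zero_left [simp]: "x \<in> carr V \<Longrightarrow> ip V 0 x = 0"
  using ip_scale_left[of 0 x 0] by simp

lemma ip_zero_right [simp]: "x \<in> carr V \<Longrightarrow> ip V x 0 = 0"
  using ip_scale_right[of 0 x 0] by simp

lemma ip_minus_left: "x \<in> carr V \<Longrightarrow> y \<in> carr V \<Longrightarrow> ip V (- x) y = - ip V x y"
  using ip_scale_left[of x y "-1"] by (simp add: scaleC_minus_one)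

lemma ip_minus_right: "x \<in> carr V \<Longrightarrow> y \<in> carr V \<Longrightarrow> ip V x (- y) = - ip V x y"
  using ip_scale_right[of y x "-1"] by (simp add: scaleC_minus_one)

lemma ip_diff_left:
  "x \<in> carr V \<Longrightarrow> y \<in> carr V \<Longrightarrow> z \<in> carr V \<Longrightarrow> ip V (x - y) z = ip V x z - ip V y z"
  using ip_add_left[of x "- y" z] by (simp add: ip_minus_left)

lemma ip_diff_right:
  "x \<in> carr V \<Longrightarrow> y \<in> carr V \<Longrightarrow> z \<in> carr V \<Longrightarrow> ip V z (x - y) = ip V z x - ip V z y"
  using ip_add_right[of x "- y" z] by (simp add: ip_minus_right)

lemma ip_sum_left:
  "y \<in> carr V \<Longrightarrow> (\<And>k. k \<in> A \<Longrightarrow> f k \<in> carr V) \<Longrightarrow> ip V (\<Sum>k\<in>A. f k) y = (\<Sum>k\<in>A. ip V (f k) y)"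
  by (induction A rule: infinite_finite_induct) (auto simp: ip_add_left sum_mem)

lemma ip_sum_right:
  "y \<in> carr V \<Longrightarrow> (\<And>k. k \<in> A \<Longrightarrow> f k \<in> carr V) \<Longrightarrow> ip V y (\<Sum>k\<in>A. f k) = (\<Sum>k\<in>A. ip V y (f k))"
  by (induction A rule: infinite_finite_induct) (auto simp: ip_add_right sum_mem)

lemma Im_ip_self: "x \<in> carr V \<Longrightarrow> Im (ip V x x) = 0"
  using ip_cnj[of x x] by (metis cnj.simps(2) neg_equal_zero)

lemma Re_ip_self_nonneg: "x \<in> carr V \<Longrightarrow> 0 \<le> Re (ip V x x)"
  by (cases "x = 0") (auto simp: less_imp_le ip_pos)

lemma norm_sq: "x \<in> carr V \<Longrightarrow> (ip_norm V x)\<^sup>2 = Re (ip V x x)"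
  by (simp add: ip_norm_def Re_ip_self_nonneg)

lemma ip_self: "x \<in> carr V \<Longrightarrow> ip V x x = complex_of_real ((ip_norm V x)\<^sup>2)"
  by (simp add: complex_eq_iff Im_ip_self norm_sq)

lemma norm_nonneg [simp]: "x \<in> carr V \<Longrightarrow> 0 \<le> ip_norm V x"
  by (simp add: ip_norm_def Re_ip_self_nonneg)

lemma norm_eq_0_iff: "x \<in> carr V \<Longrightarrow> ip_norm V x = 0 \<longleftrightarrow> x = 0"
  using ip_pos[of x] by (force simp: ip_norm_def)

lemma norm_zero [simp]: "ip_norm V 0 = 0"
  by (simp add: norm_eq_0_iff)

lemma norm_scale: "x \<in> carr V \<Longrightarrow> ip_norm V (c *\<^sub>C x) = cmod c * ip_norm V x"
proof -
  assume x: "x \<in> carr V"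
  have "ip V (c *\<^sub>C x) (c *\<^sub>C x) = complex_of_real ((cmod c)\<^sup>2 * Re (ip V x x))"
    using x ip_self[OF x] complex_norm_square[of c]
    by (simp add: ip_scale_left ip_scale_right norm_sq mult_ac)
  then show ?thesis
    by (simp add: ip_norm_def real_sqrt_mult)
qed

lemma norm_minus [simp]: "x \<in> carr V \<Longrightarrow> ip_norm V (- x) = ip_norm V x"
  using norm_scale[of x "-1"] by (simp add: scaleC_minus_one)

lemma norm_diff_commute: "x \<in> carr V \<Longrightarrow> y \<in> carr V \<Longrightarrow> ip_norm V (x - y) = ip_norm V (y - x)"
  using norm_minus[of "x - y"] by simp

lemma norm_sq_add:
  "x \<in> carr V \<Longrightarrow> y \<in> carr V \<Longrightarrow> (ip_norm V (x + y))\<^sup>2 = (ip_norm V x)\<^sup>2 + (ip_norm V y)\<^sup>2 + 2 * Re (ip V x y)"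
  using arg_cong[OF ip_cnj[of x y], of Re] by (simp add: norm_sq ip_add_left ip_add_right)

lemma norm_sq_diff:
  "x \<in> carr V \<Longrightarrow> y \<in> carr V \<Longrightarrow> (ip_norm V (x - y))\<^sup>2 = (ip_norm V x)\<^sup>2 + (ip_norm V y)\<^sup>2 - 2 * Re (ip V x y)"
  using norm_sq_add[of x "- y"] by (simp add: ip_minus_right)

lemma Cauchy_Schwarz:
  assumes x: "x \<in> carr V" and y: "y \<in> carr V"
  shows "cmod (ip V x y) \<le> ip_norm V x * ip_norm V y"
proof (cases "y = 0")
  case True
  then show ?thesis using x by simp
next
  case False
  define N where "N = (ip_norm V y)\<^sup>2"
  have N: "N > 0" using False y norm_eq_0_iff[of y] by (simp add: N_def)
  define c where "c = ip V x y / of_real N"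
  have "0 \<le> (ip_norm V (x - c *\<^sub>C y))\<^sup>2" by simp
  also have "\<dots> = (ip_norm V x)\<^sup>2 + (cmod c)\<^sup>2 * N - 2 * Re (cnj c * ip V x y)"
    using x y by (simp add: norm_sq_diff norm_scale power_mult_distrib N_def ip_scale_right)
  also have "cnj c * ip V x y = of_real ((cmod (ip V x y))\<^sup>2 / N)"
    by (simp add: c_def complex_norm_square mult.commute flip: of_real_power)
  also have "(cmod c)\<^sup>2 * N = (cmod (ip V x y))\<^sup>2 / N"
    using N by (simp add: c_def norm_divide power_divide power2_eq_square)
  finally have "(cmod (ip V x y))\<^sup>2 \<le> (ip_norm V x)\<^sup>2 * N"
    using N by (simp add: field_simps)
  then have "(cmod (ip V x y))\<^sup>2 \<le> (ip_norm V x * ip_norm V y)\<^sup>2"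
    by (simp add: N_def power_mult_distrib)
  then show ?thesis
    using x y by (meson mult_nonneg_nonneg norm_nonneg power2_le_imp_le)
qed

lemma norm_triangle:
  assumes x: "x \<in> carr V" and y: "y \<in> carr V"
  shows "ip_norm V (x + y) \<le> ip_norm V x + ip_norm V y"
proof (rule power2_le_imp_le)
  have "Re (ip V x y) \<le> ip_norm V x * ip_norm V y"
    using Cauchy_Schwarz[OF x y] complex_Re_le_cmod order_trans by blast
  then show "(ip_norm V (x + y))\<^sup>2 \<le> (ip_norm V x + ip_norm V y)\<^sup>2"
    using x y by (simp add: norm_sq_add power2_sum)
  show "0 \<le> ip_norm V x + ip_norm V y" using x y by simp
qed

lemma norm_triangle_sub:
  assumes "x \<in> carr V" "y \<in> carr V"
  shows "ip_norm V x \<le> ip_norm V y + ip_norm V (x - y)"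
  using norm_triangle[of y "x - y"] assms by simp

lemma norm_tendsto:
  assumes "\<And>k. X k \<in> carr V" "x \<in> carr V" "(\<lambda>k. ip_norm V (X k - x)) \<longlonglongrightarrow> 0"
  shows "(\<lambda>k. ip_norm V (X k)) \<longlonglongrightarrow> ip_norm V x"
proof (rule Lim_null[THEN iffD2], rule Lim_null_comparison[OF _ assms(3)], intro always_eventually allI)
  fix k
  have "ip_norm V (X k) \<le> ip_norm V x + ip_norm V (X k - x)" "ip_norm V x \<le> ip_norm V (X k) + ip_norm V (x - X k)"
    using assms norm_triangle_sub by blast+
  then show "norm (ip_norm V (X k) - ip_norm V x) \<le> ip_norm V (X k - x)"
    using norm_diff_commute[of "X k" x] assms by simp
qed

lemma ip_tendsto:
  assumes "\<And>k. X k \<in> carr V" "x \<in> carr V" "y \<in> carr V" "(\<lambda>k. ip_norm V (X k - x)) \<longlonglongrightarrow> 0"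
  shows "(\<lambda>k. ip V (X k) y) \<longlonglongrightarrow> ip V x y"
proof (rule Lim_null[THEN iffD2], rule Lim_null_comparison)
  show "\<forall>\<^sub>F k in sequentially. norm (ip V (X k) y - ip V x y) \<le> ip_norm V (X k - x) * ip_norm V y"
    using Cauchy_Schwarz assms by (auto simp flip: ip_diff_left)
  show "(\<lambda>k. ip_norm V (X k - x) * ip_norm V y) \<longlonglongrightarrow> 0"
    using tendsto_mult_left_zero[OF assms(4)] .
qed

end

locale hilbert_sp = ip_sp +
  assumes complete:
    "\<And>X. (\<And>k. X k \<in> carr V) \<Longrightarrow> (\<And>e. e > 0 \<Longrightarrow> \<exists>N. \<forall>k\<ge>N. \<forall>m\<ge>N. ip_norm V (X k - X m) < e)
        \<Longrightarrow> \<exists>x\<in>carr V. (\<lambda>k. ip_norm V (X k - x)) \<longlonglongrightarrow> 0"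

lemma hilbert_sp_iff: "hilbert_sp V \<longleftrightarrow> hilbert_space V"
  unfolding hilbert_sp_def hilbert_sp_axioms_def ip_sp_def hilbert_space_def
  by (rule conj_cong[OF refl]) blast

context hilbert_sp
begin

text \<open>
  The representing vector is the minimiser \<open>y\<close> of \<open>J x = \<parallel>x\<parallel>\<^sup>2 - 2 Re (L x)\<close>: the parallelogram law
  makes a minimising sequence Cauchy, and the first variation of \<open>J\<close> at \<open>y\<close> is
  \<open>2 Re (\<langle>v, y\<rangle> - L v)\<close>.
\<close>

theorem Riesz:
  assumes L_add: "\<And>x y. x \<in> carr V \<Longrightarrow> y \<in> carr V \<Longrightarrow> L (x + y) = L x + L y"
    and L_scale: "\<And>c x. x \<in> carr V \<Longrightarrow> L (c *\<^sub>C x) = c * L x"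
    and L_bound: "\<And>x. x \<in> carr V \<Longrightarrow> cmod (L x) \<le> C * ip_norm V x"
  obtains y where "y \<in> carr V" "\<And>x. x \<in> carr V \<Longrightarrow> L x = ip V x y"
proof -
  define J where "J x = (ip_norm V x)\<^sup>2 - 2 * Re (L x)" for x
  have J_ge: "- C\<^sup>2 \<le> J x" if "x \<in> carr V" for x
  proof -
    have "Re (L x) \<le> C * ip_norm V x"
      using L_bound[OF that] complex_Re_le_cmod order_trans by blast
    moreover have "0 \<le> (ip_norm V x - C)\<^sup>2" by simp
    ultimately show ?thesis by (simp add: J_def power2_diff mult_ac)
  qed
  define d where "d = Inf (J ` carr V)"
  have bdd: "bdd_below (J ` carr V)" using J_ge by (force simp: bdd_below_def)
  have d_le: "d \<le> J x" if "x \<in> carr V" for x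
    unfolding d_def using bdd that by (simp add: cInf_lower)
  have "\<exists>x\<in>carr V. J x < d + 1 / real (Suc k)" for k
  proof -
    have "Inf (J ` carr V) < d + 1 / real (Suc k)" by (simp add: d_def)
    then show ?thesis using bdd cInf_less_iff[of "J ` carr V"] zero_mem by blast
  qed
  then obtain X where X: "\<And>k. X k \<in> carr V" "\<And>k. J (X k) < d + 1 / real (Suc k)" by metis
  have par: "(ip_norm V (x - y))\<^sup>2 \<le> 2 * (J x - d) + 2 * (J y - d)" if "x \<in> carr V" "y \<in> carr V" for x y
  proof -
    have 1: "d \<le> J ((1/2) *\<^sub>C (x + y))" using that by (intro d_le) auto
    have "J ((1/2) *\<^sub>C (x + y)) = (ip_norm V (x + y))\<^sup>2 / 4 - Re (L x) - Re (L y)"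
      using that by (simp add: J_def norm_scale L_scale L_add power_mult_distrib power_divide field_simps)
    with 1 have "4 * d \<le> (ip_norm V (x + y))\<^sup>2 - 4 * Re (L x) - 4 * Re (L y)" by simp
    then show ?thesis using that by (simp add: J_def norm_sq_add norm_sq_diff)
  qed
  have cauchy: "\<exists>N. \<forall>k\<ge>N. \<forall>m\<ge>N. ip_norm V (X k - X m) < e" if "e > 0" for e
  proof -
    obtain N where N: "4 / e\<^sup>2 < real (Suc N)" using reals_Archimedean2
      by (metis less_Suc_eq of_nat_less_iff order_less_trans)
    have small: "J (X k) - d < e\<^sup>2 / 4" if "k \<ge> N" for k
    proof -
      have "J (X k) - d < 1 / real (Suc k)" using X(2)[of k] by simp
      also have "\<dots> \<le> 1 / real (Suc N)" using that by (simp add: frac_le)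
      also have "\<dots> < e\<^sup>2 / 4" using N \<open>e > 0\<close> by (simp add: field_simps)
      finally show ?thesis .
    qed
    have "ip_norm V (X k - X m) < e" if "k \<ge> N" "m \<ge> N" for k m
    proof -
      have "(ip_norm V (X k - X m))\<^sup>2 \<le> 2 * (J (X k) - d) + 2 * (J (X m) - d)"
        by (rule par[OF X(1) X(1)])
      also have "\<dots> < 2 * (e\<^sup>2 / 4) + 2 * (e\<^sup>2 / 4)"
        using small[OF that(1)] small[OF that(2)] by (intro add_strict_mono mult_strict_left_mono) auto
      finally have "(ip_norm V (X k - X m))\<^sup>2 < e\<^sup>2" by simp
      then show ?thesis using \<open>e > 0\<close> by (simp add: power2_less_imp_less)
    qed
    then show ?thesis by blast
  qed
  obtain y where y: "y \<in> carr V" "(\<lambda>k. ip_norm V (X k - y)) \<longlonglongrightarrow> 0"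
    using complete[OF X(1) cauchy] by blast
  have L_diff: "L (x - z) = L x - L z" if "x \<in> carr V" "z \<in> carr V" for x z
    using L_add[of x "- z"] L_scale[of z "-1"] that by (simp add: scaleC_minus_one)
  have "(\<lambda>k. L (X k)) \<longlonglongrightarrow> L y"
  proof (rule Lim_null[THEN iffD2], rule Lim_null_comparison)
    show "\<forall>\<^sub>F k in sequentially. norm (L (X k) - L y) \<le> C * ip_norm V (X k - y)"
      using L_bound X y by (auto simp flip: L_diff)
    show "(\<lambda>k. C * ip_norm V (X k - y)) \<longlonglongrightarrow> 0"
      using tendsto_mult_right_zero[OF y(2)] .
  qed
  then have "(\<lambda>k. J (X k)) \<longlonglongrightarrow> J y"
    unfolding J_def by (intro tendsto_intros norm_tendsto X y)
  moreover have "(\<lambda>k. d + 1 / real (Suc k)) \<longlonglongrightarrow> d + 0"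
    by (intro tendsto_intros LIMSEQ_Suc lim_1_over_n)
  ultimately have Jy: "J y \<le> d"
    using X(2) by (intro LIMSEQ_le[of "\<lambda>k. J (X k)"]) (auto intro: less_imp_le)
  have "L v = ip V v y" if v: "v \<in> carr V" for v
  proof -
    define s where "s = ip V v y - L v"
    have var: "2 * e * (cmod s)\<^sup>2 \<le> e\<^sup>2 * ((cmod s)\<^sup>2 * (ip_norm V v)\<^sup>2)" if "e > 0" for e :: real
    proof -
      \<comment> \<open>the direction of steepest descent of \<open>J\<close> in the complex line through \<open>v\<close>\<close>
      define t where "t = - (of_real e * cnj s)"
      have "J y \<le> J (y + t *\<^sub>C v)" using Jy d_le[of "y + t *\<^sub>C v"] v y by simp
      also have "\<dots> = J y + (cmod t)\<^sup>2 * (ip_norm V v)\<^sup>2 + 2 * Re (ip V y (t *\<^sub>C v)) - 2 * Re (t * L v)"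
        using v y by (simp add: J_def norm_sq_add norm_scale power_mult_distrib L_add L_scale)
      also have "Re (ip V y (t *\<^sub>C v)) = Re (t * ip V v y)"
        using v y arg_cong[OF ip_cnj[of "t *\<^sub>C v" y], of Re] by (simp add: ip_scale_left)
      also have "J y + (cmod t)\<^sup>2 * (ip_norm V v)\<^sup>2 + 2 * Re (t * ip V v y) - 2 * Re (t * L v)
          = J y + (cmod t)\<^sup>2 * (ip_norm V v)\<^sup>2 + 2 * Re (t * s)"
        by (simp add: s_def algebra_simps)
      also have "Re (t * s) = - e * (cmod s)\<^sup>2"
        by (simp only: cmod_power2) (simp add: t_def power2_eq_square algebra_simps)
      also have "(cmod t)\<^sup>2 = e\<^sup>2 * (cmod s)\<^sup>2"
        by (simp add: t_def norm_mult power_mult_distrib)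
      finally show ?thesis by (simp add: algebra_simps)
    qed
    have "s = 0"
    proof (rule ccontr)
      assume "s \<noteq> 0"
      then have s: "(cmod s)\<^sup>2 > 0" by simp
      have "2 \<le> e * (ip_norm V v)\<^sup>2" if "e > 0" for e :: real
      proof (rule mult_left_le_imp_le)
        show "(e * (cmod s)\<^sup>2) * 2 \<le> (e * (cmod s)\<^sup>2) * (e * (ip_norm V v)\<^sup>2)"
          using var[OF that] by (simp add: power2_eq_square mult_ac)
        show "0 < e * (cmod s)\<^sup>2" using s that by simp
      qed
      \<comment> \<open>the right hand side stays below \<open>1\<close> for this \<open>e\<close>\<close>
      from this[of "1 / (1 + (ip_norm V v)\<^sup>2)"] show False
        by (simp add: field_simps add_pos_nonneg) (smt (verit) zero_le_power2)
    qed
    then show ?thesis by (simp add: s_def)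
  qed
  with y show ?thesis using that by blast
qed

end


section \<open>Bounded operators and adjoints\<close>

text \<open>
  Adjointness as a relation: identities between adjoints then follow from the uniqueness of
  adjoints, without evaluating the description operator in \<^const>\<open>adjoint_op\<close>.
\<close>

definition is_adjoint ::
    "'a::complex_vector ip_space \<Rightarrow> 'b::complex_vector ip_space \<Rightarrow> ('a \<Rightarrow> 'b) \<Rightarrow> ('b \<Rightarrow> 'a) \<Rightarrow> bool" where
  "is_adjoint V W A B \<longleftrightarrow> (\<forall>x\<in>carr V. \<forall>y\<in>carr W. ip W (A x) y = ip V x (B y))"

lemma bounded_opD:
  assumes "bounded_op V W A"
  shows "x \<in> carr V \<Longrightarrow> A x \<in> carr W"
    and "x \<in> carr V \<Longrightarrow> y \<in> carr V \<Longrightarrow> A (x + y) = A x + A y"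
    and "x \<in> carr V \<Longrightarrow> A (c *\<^sub>C x) = c *\<^sub>C A x"
  using assms by (auto simp: bounded_op_def)

lemma bounded_op_diff:
  assumes "ip_sp V" "bounded_op V W A" "x \<in> carr V" "y \<in> carr V"
  shows "A (x - y) = A x - A y"
proof -
  interpret V: ip_sp V by fact
  show ?thesis
    using bounded_opD(2)[OF assms(2), of x "- y"] bounded_opD(3)[OF assms(2), of y "-1"] assms(3,4)
    by (simp add: scaleC_minus_one)
qed

lemma bounded_op_zero:
  assumes "ip_sp V" "bounded_op V W A"
  shows "A 0 = 0"
  using bounded_op_diff[OF assms, of 0 0] assms(1) ip_sp.zero_mem by fastforce

lemma bounded_op_sum:
  assumes "ip_sp V" "bounded_op V W A" "\<And>k. k \<in> I \<Longrightarrow> f k \<in> carr V"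
  shows "A (\<Sum>k\<in>I. f k) = (\<Sum>k\<in>I. A (f k))"
proof -
  interpret V: ip_sp V by fact
  show ?thesis using assms(3)
    by (induction I rule: infinite_finite_induct)
       (auto simp: bounded_op_zero[OF assms(1,2)] bounded_opD(2)[OF assms(2)] V.sum_mem)
qed

lemma bounded_op_bound:
  assumes "ip_sp V" "bounded_op V W A"
  obtains C where "C > 0" "\<And>x. x \<in> carr V \<Longrightarrow> ip_norm W (A x) \<le> C * ip_norm V x"
proof -
  interpret V: ip_sp V by fact
  obtain C where C: "\<And>x. x \<in> carr V \<Longrightarrow> ip_norm W (A x) \<le> C * ip_norm V x"
    using assms(2) unfolding bounded_op_def by blast
  have "ip_norm W (A x) \<le> (\<bar>C\<bar> + 1) * ip_norm V x" if "x \<in> carr V" for x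
  proof -
    have "C * ip_norm V x \<le> (\<bar>C\<bar> + 1) * ip_norm V x"
      using that by (intro mult_right_mono) auto
    then show ?thesis using C[OF that] by simp
  qed
  then show ?thesis using that[of "\<bar>C\<bar> + 1"] by simp
qed

lemma bounded_op_cong:
  assumes "ip_sp V" "\<And>x. x \<in> carr V \<Longrightarrow> A x = B x"
  shows "bounded_op V W A \<longleftrightarrow> bounded_op V W B"
proof -
  interpret V: ip_sp V by fact
  show ?thesis using assms(2) by (simp add: bounded_op_def)
qed

lemma bounded_op_tendsto:
  assumes V: "ip_sp V" and W: "ip_sp W" and A: "bounded_op V W A"
    and X: "\<And>k. X k \<in> carr V" and x: "x \<in> carr V" and lim: "(\<lambda>k. ip_norm V (X k - x)) \<longlonglongrightarrow> 0"
  shows "(\<lambda>k. ip_norm W (A (X k) - A x)) \<longlonglongrightarrow> 0"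
proof -
  interpret V: ip_sp V by fact
  interpret W: ip_sp W by fact
  obtain C where C: "C > 0" "\<And>x. x \<in> carr V \<Longrightarrow> ip_norm W (A x) \<le> C * ip_norm V x"
    using bounded_op_bound[OF V A] by blast
  show ?thesis
  proof (rule Lim_null_comparison)
    show "\<forall>\<^sub>F k in sequentially. norm (ip_norm W (A (X k) - A x)) \<le> C * ip_norm V (X k - x)"
      using C(2) X x bounded_opD(1)[OF A] by (auto simp flip: bounded_op_diff[OF V A])
    show "(\<lambda>k. C * ip_norm V (X k - x)) \<longlonglongrightarrow> 0"
      using tendsto_mult_right_zero[OF lim] .
  qed
qed

lemma bounded_op_compose:
  assumes "ip_sp V" "ip_sp W" "bounded_op V W A" "bounded_op W U B"
  shows "bounded_op V U (\<lambda>x. B (A x))"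
proof -
  interpret V: ip_sp V by fact
  obtain C where C: "C > 0" "\<And>x. x \<in> carr V \<Longrightarrow> ip_norm W (A x) \<le> C * ip_norm V x"
    using bounded_op_bound[OF assms(1,3)] by blast
  obtain D where D: "D > 0" "\<And>x. x \<in> carr W \<Longrightarrow> ip_norm U (B x) \<le> D * ip_norm W x"
    using bounded_op_bound[OF assms(2,4)] by blast
  have "ip_norm U (B (A x)) \<le> (D * C) * ip_norm V x" if "x \<in> carr V" for x
    using D(2)[OF bounded_opD(1)[OF assms(3) that]] mult_left_mono[OF C(2)[OF that], of D] D(1)
    unfolding mult.assoc by linarith
  then show ?thesis
    unfolding bounded_op_def
    using bounded_opD[OF assms(3)] bounded_opD[OF assms(4)] by auto
qed

lemma bounded_op_add:
  assumes "ip_sp V" "ip_sp W" "bounded_op V W A" "bounded_op V W B"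
  shows "bounded_op V W (\<lambda>x. A x + B x)"
proof -
  interpret V: ip_sp V by fact
  interpret W: ip_sp W by fact
  obtain C where C: "C > 0" "\<And>x. x \<in> carr V \<Longrightarrow> ip_norm W (A x) \<le> C * ip_norm V x"
    using bounded_op_bound[OF assms(1,3)] by blast
  obtain D where D: "D > 0" "\<And>x. x \<in> carr V \<Longrightarrow> ip_norm W (B x) \<le> D * ip_norm V x"
    using bounded_op_bound[OF assms(1,4)] by blast
  have "ip_norm W (A x + B x) \<le> (C + D) * ip_norm V x" if "x \<in> carr V" for x
    using W.norm_triangle[OF bounded_opD(1)[OF assms(3) that] bounded_opD(1)[OF assms(4) that]]
      C(2)[OF that] D(2)[OF that] by (simp add: algebra_simps)
  then show ?thesis
    unfolding bounded_op_def
    using bounded_opD[OF assms(3)] bounded_opD[OF assms(4)] by (auto simp: scaleC_add_right)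
qed

lemma bounded_op_scale:
  assumes "ip_sp V" "ip_sp W" "bounded_op V W A"
  shows "bounded_op V W (\<lambda>x. c *\<^sub>C A x)"
proof -
  interpret V: ip_sp V by fact
  interpret W: ip_sp W by fact
  obtain C where C: "C > 0" "\<And>x. x \<in> carr V \<Longrightarrow> ip_norm W (A x) \<le> C * ip_norm V x"
    using bounded_op_bound[OF assms(1,3)] by blast
  have "ip_norm W (c *\<^sub>C A x) \<le> (cmod c * C) * ip_norm V x" if "x \<in> carr V" for x
    using mult_left_mono[OF C(2)[OF that], of "cmod c"] bounded_opD(1)[OF assms(3) that]
    by (simp add: W.norm_scale mult.assoc)
  then have "\<exists>D. \<forall>x\<in>carr V. ip_norm W (c *\<^sub>C A x) \<le> D * ip_norm V x" by blast
  then show ?thesis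
    unfolding bounded_op_def
    using bounded_opD[OF assms(3)] by (simp add: scaleC_add_right scaleC_scaleC mult.commute W.scale_mem)
qed

lemma bounded_op_ident: "bounded_op V V (\<lambda>x. x)"
  unfolding bounded_op_def by (auto intro!: exI[of _ 1])

lemma bounded_op_zero_op:
  assumes "ip_sp V" "ip_sp W"
  shows "bounded_op V W (\<lambda>x. 0)"
  using assms by (auto simp: bounded_op_def ip_sp.zero_mem ip_sp.norm_zero intro!: exI[of _ 0])

lemma bounded_op_sub_scale:
  assumes "ip_sp V" "bounded_op V V A"
  shows "bounded_op V V (\<lambda>x. A x - c *\<^sub>C x)"
  using bounded_op_add[OF assms(1,1,2) bounded_op_scale[OF assms(1,1) bounded_op_ident, of "-c"]]
  by (simp add: scaleC_minus_left)

lemma bounded_op_id_sub_scale: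
  assumes "ip_sp V" "bounded_op V V A"
  shows "bounded_op V V (\<lambda>x. x - c *\<^sub>C A x)"
  using bounded_op_add[OF assms(1,1) bounded_op_ident bounded_op_scale[OF assms(1,1,2), of "-c"]]
  by (simp add: scaleC_minus_left)

lemma adjoint_unique:
  assumes "ip_sp V" "x \<in> carr V" "y \<in> carr V" "\<And>u. u \<in> carr V \<Longrightarrow> ip V u x = ip V u y"
  shows "x = y"
proof -
  interpret V: ip_sp V by fact
  have "ip V (x - y) (x - y) = 0" using assms by (simp add: V.ip_diff_right)
  then have "ip_norm V (x - y) = 0" by (simp add: ip_norm_def)
  then show ?thesis using V.norm_eq_0_iff[of "x - y"] assms by simp
qed

lemma adjoint_op_properties:
  assumes V: "hilbert_sp V" and W: "ip_sp W" and A: "bounded_op V W A"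
  shows "is_adjoint V W A (adjoint_op V W A)" "bounded_op W V (adjoint_op V W A)"
proof -
  interpret V: hilbert_sp V by fact
  interpret W: ip_sp W by fact
  note VV = V.ip_sp_axioms
  define B where "B = adjoint_op V W A"
  obtain C where C: "C > 0" "\<And>x. x \<in> carr V \<Longrightarrow> ip_norm W (A x) \<le> C * ip_norm V x"
    using bounded_op_bound[OF VV A] by blast
  note A' = bounded_opD[OF A]
  have ex: "\<exists>!x. x \<in> carr V \<and> (\<forall>u\<in>carr V. ip W (A u) y = ip V u x)" if y: "y \<in> carr W" for y
  proof -
    have b: "cmod (ip W (A u) y) \<le> (C * ip_norm W y) * ip_norm V u" if "u \<in> carr V" for u
      using W.Cauchy_Schwarz[OF A'(1)[OF that] y] mult_right_mono[OF C(2)[OF that], of "ip_norm W y"] y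
      by (simp add: mult_ac)
    obtain x where "x \<in> carr V" "\<And>u. u \<in> carr V \<Longrightarrow> ip W (A u) y = ip V u x"
      by (rule V.Riesz[of "\<lambda>u. ip W (A u) y" "C * ip_norm W y"])
         (use A' y b in \<open>auto simp: W.ip_add_left W.ip_scale_left\<close>)
    then show ?thesis using adjoint_unique[OF VV] by (metis (no_types, lifting))
  qed
  have B: "B y \<in> carr V \<and> (\<forall>u\<in>carr V. ip W (A u) y = ip V u (B y))" if "y \<in> carr W" for y
    unfolding B_def adjoint_op_def using theI'[OF ex[OF that]] .
  then show "is_adjoint V W A (adjoint_op V W A)"
    unfolding is_adjoint_def B_def by auto
  have uniq: "x = B y" if "y \<in> carr W" "x \<in> carr V" "\<And>u. u \<in> carr V \<Longrightarrow> ip W (A u) y = ip V u x" for x y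
    using ex[OF that(1)] B[OF that(1)] that by auto
  have "ip_norm V (B y) \<le> C * ip_norm W y" if y: "y \<in> carr W" for y
  proof (cases "ip_norm V (B y) = 0")
    case True
    then show ?thesis using C y by simp
  next
    case False
    then have pos: "ip_norm V (B y) > 0" using V.norm_nonneg B[OF y] by (metis less_eq_real_def)
    have "(ip_norm V (B y))\<^sup>2 = Re (ip W (A (B y)) y)"
      using B[OF y] V.norm_sq[of "B y"] by metis
    also have "\<dots> \<le> ip_norm W (A (B y)) * ip_norm W y"
      using order_trans[OF complex_Re_le_cmod W.Cauchy_Schwarz[OF A'(1) y]] B[OF y] by blast
    also have "\<dots> \<le> (C * ip_norm V (B y)) * ip_norm W y"
      using B[OF y] y C(2) by (intro mult_right_mono) auto
    finally show ?thesis using pos by (simp add: power2_eq_square mult_ac)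
  qed
  moreover have "B (x + y) = B x + B y" if "x \<in> carr W" "y \<in> carr W" for x y
    using B[OF that(1)] B[OF that(2)] A'(1) that
    by (intro uniq[symmetric]) (auto simp: W.ip_add_right V.ip_add_right)
  moreover have "B (c *\<^sub>C y) = c *\<^sub>C B y" if "y \<in> carr W" for c y
    using B[OF that] A'(1) that
    by (intro uniq[symmetric]) (auto simp: W.ip_scale_right V.ip_scale_right)
  ultimately show "bounded_op W V (adjoint_op V W A)"
    unfolding bounded_op_def B_def[symmetric] using B by blast
qed

lemma is_adjoint_sym:
  assumes "ip_sp V" "ip_sp W" "bounded_op V W A" "bounded_op W V B" "is_adjoint V W A B"
  shows "is_adjoint W V B A"
    unfolding is_adjoint_def
proof (intro ballI)
  fix y x assume y: "y \<in> carr W" and x: "x \<in> carr V"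
  have "ip V (B y) x = cnj (ip V x (B y))"
    using ip_sp.ip_cnj[OF assms(1) x bounded_opD(1)[OF assms(4) y]] by simp
  also have "\<dots> = cnj (ip W (A x) y)" using assms(5) x y by (simp add: is_adjoint_def)
  also have "\<dots> = ip W y (A x)"
    using ip_sp.ip_cnj[OF assms(2) bounded_opD(1)[OF assms(3) x] y] .
  finally show "ip V (B y) x = ip W y (A x)" .
qed

lemma is_adjoint_compose:
  assumes "bounded_op V W A" "bounded_op U W D" "is_adjoint V W A B" "is_adjoint W U C D"
  shows "is_adjoint V U (\<lambda>x. C (A x)) (\<lambda>y. B (D y))"
  using assms(3,4) bounded_opD(1)[OF assms(1)] bounded_opD(1)[OF assms(2)] unfolding is_adjoint_def
  by simp

lemma is_adjoint_sub_scale: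
  assumes "ip_sp V" "bounded_op V V A" "bounded_op V V B" "is_adjoint V V A B"
  shows "is_adjoint V V (\<lambda>x. A x - c *\<^sub>C x) (\<lambda>x. B x - cnj c *\<^sub>C x)"
proof -
  interpret V: ip_sp V by fact
  show ?thesis using assms bounded_opD(1)[OF assms(2)] bounded_opD(1)[OF assms(3)]
    by (simp add: is_adjoint_def V.ip_diff_left V.ip_diff_right V.ip_scale_left V.ip_scale_right)
qed

lemma is_adjoint_id_sub_scale:
  assumes "ip_sp V" "bounded_op V V A" "bounded_op V V B" "is_adjoint V V A B"
  shows "is_adjoint V V (\<lambda>x. x - c *\<^sub>C A x) (\<lambda>x. x - cnj c *\<^sub>C B x)"
proof -
  interpret V: ip_sp V by fact
  show ?thesis using assms bounded_opD(1)[OF assms(2)] bounded_opD(1)[OF assms(3)]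
    by (simp add: is_adjoint_def V.ip_diff_left V.ip_diff_right V.ip_scale_left V.ip_scale_right)
qed

lemma is_adjoint_scale:
  assumes "ip_sp V" "bounded_op V V A" "bounded_op V V B" "is_adjoint V V A B"
  shows "is_adjoint V V (\<lambda>x. c *\<^sub>C A x) (\<lambda>x. cnj c *\<^sub>C B x)"
proof -
  interpret V: ip_sp V by fact
  show ?thesis using assms bounded_opD(1)[OF assms(2)] bounded_opD(1)[OF assms(3)]
    by (simp add: is_adjoint_def V.ip_scale_left V.ip_scale_right)
qed

lemma is_adjoint_eqI:
  assumes "ip_sp V" "ip_sp W"
    and "bounded_op W V B" "bounded_op W V B'"
    and "is_adjoint V W A B" "is_adjoint V W A' B'"
    and "\<And>x. x \<in> carr V \<Longrightarrow> A x = A' x" "y \<in> carr W"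
  shows "B y = B' y"
  using assms by (intro adjoint_unique[OF assms(1)]) (auto simp: is_adjoint_def dest: bounded_opD(1))

lemma invertible_op_adjoint:
  assumes V: "hilbert_sp V" and A: "invertible_op V A" and B: "bounded_op V V B" and AB: "is_adjoint V V A B"
  shows "invertible_op V B"
proof -
  interpret V: hilbert_sp V by fact
  note VV = V.ip_sp_axioms
  obtain A' where A': "bounded_op V V A'" "\<forall>x\<in>carr V. A' (A x) = x" "\<forall>x\<in>carr V. A (A' x) = x"
    and bA: "bounded_op V V A"
    using A by (auto simp: invertible_op_def)
  define B' where "B' = adjoint_op V V A'"
  have B': "is_adjoint V V A' B'" "bounded_op V V B'"
    using adjoint_op_properties[OF V VV A'(1)] by (auto simp: B'_def)
  have one: "is_adjoint V V (\<lambda>x. x) (\<lambda>x. x)" by (simp add: is_adjoint_def)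
  have "B (B' x) = x" if "x \<in> carr V" for x
    by (rule is_adjoint_eqI[OF VV VV bounded_op_compose[OF VV VV B'(2) B] bounded_op_ident
        is_adjoint_compose[OF bA B'(2) AB B'(1)] one _ that]) (use A' in auto)
  moreover have "B' (B x) = x" if "x \<in> carr V" for x
    by (rule is_adjoint_eqI[OF VV VV bounded_op_compose[OF VV VV B B'(2)] bounded_op_ident
        is_adjoint_compose[OF A'(1) B B'(1) AB] one _ that]) (use A' in auto)
  ultimately show ?thesis unfolding invertible_op_def using B B'(2) by blast
qed

lemma invertible_op_compose:
  assumes "ip_sp V" "invertible_op V A" "invertible_op V B"
  shows "invertible_op V (\<lambda>x. A (B x))"
proof -
  obtain A' where A': "bounded_op V V A'" "\<forall>x\<in>carr V. A' (A x) = x" "\<forall>x\<in>carr V. A (A' x) = x" "bounded_op V V A"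
    using assms(2) by (auto simp: invertible_op_def)
  obtain B' where B': "bounded_op V V B'" "\<forall>x\<in>carr V. B' (B x) = x" "\<forall>x\<in>carr V. B (B' x) = x" "bounded_op V V B"
    using assms(3) by (auto simp: invertible_op_def)
  have "bounded_op V V (\<lambda>x. A (B x))" "bounded_op V V (\<lambda>x. B' (A' x))"
    using bounded_op_compose[OF assms(1,1)] A' B' by blast+
  moreover have "\<forall>x\<in>carr V. B' (A' (A (B x))) = x" "\<forall>x\<in>carr V. A (B (B' (A' x))) = x"
    using A' B' bounded_opD(1) by metis+
  ultimately show ?thesis unfolding invertible_op_def by blast
qed


section \<open>Finite direct sums and block operators\<close>

lemma carr_direct_sum: "carr (direct_sum I V) = {x. (\<forall>i\<in>I. x i \<in> carr (V i)) \<and> (\<forall>i. i \<notin> I \<longrightarrow> x i = 0)}"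
  and ip_direct_sum: "ip (direct_sum I V) x y = (\<Sum>i\<in>I. ip (V i) (x i) (y i))"
  by (simp_all add: direct_sum_def)

lemma direct_sum_ip_sp:
  assumes V: "\<And>i. i \<in> I \<Longrightarrow> ip_sp (V i)" and I: "finite I"
  shows "ip_sp (direct_sum I V)"
proof -
  have pos: "0 < Re (ip (direct_sum I V) x x)" if x: "x \<in> carr (direct_sum I V)" "x \<noteq> 0" for x
  proof -
    obtain i where i: "x i \<noteq> 0" using x(2) by (auto simp: fun_eq_iff)
    then have iI: "i \<in> I" using x(1) by (auto simp: carr_direct_sum)
    have "0 < Re (ip (V i) (x i) (x i))"
      using ip_sp.ip_pos[OF V[OF iI]] i iI x(1) by (auto simp: carr_direct_sum)
    then show ?thesis unfolding ip_direct_sum Re_sum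
      using x(1) by (intro sum_pos2[OF I iI]) (auto simp: carr_direct_sum ip_sp.Re_ip_self_nonneg[OF V])
  qed
  show ?thesis
    unfolding ip_sp_def inner_product_space_def csubspace_def
    using pos
    by (auto simp: carr_direct_sum ip_direct_sum ip_sp.ip_cnj[OF V] ip_sp.zero_mem[OF V] ip_sp.add_mem[OF V] ip_sp.scale_mem[OF V]
        ip_sp.ip_add_left[OF V] ip_sp.ip_scale_left[OF V] sum.distrib sum_distrib_left)
qed

locale ip_family =
  fixes I :: "nat set" and V :: "nat \<Rightarrow> 'a::complex_vector ip_space"
  assumes V: "\<And>i. i \<in> I \<Longrightarrow> ip_sp (V i)" and I: "finite I"
begin

sublocale K: ip_sp "direct_sum I V" using direct_sum_ip_sp[OF V I] .

lemma norm_sq_direct_sum: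
  assumes x: "x \<in> carr (direct_sum I V)"
  shows "(ip_norm (direct_sum I V) x)\<^sup>2 = (\<Sum>i\<in>I. (ip_norm (V i) (x i))\<^sup>2)"
  using x K.norm_sq[OF x]
  by (auto simp: carr_direct_sum ip_direct_sum ip_sp.norm_sq[OF V] intro!: sum.cong)

lemma norm_component_le:
  assumes x: "x \<in> carr (direct_sum I V)" and i: "i \<in> I"
  shows "ip_norm (V i) (x i) \<le> ip_norm (direct_sum I V) x"
proof (rule power2_le_imp_le)
  show "(ip_norm (V i) (x i))\<^sup>2 \<le> (ip_norm (direct_sum I V) x)\<^sup>2"
    unfolding norm_sq_direct_sum[OF x]
    by (rule member_le_sum[of i I "\<lambda>i. (ip_norm (V i) (x i))\<^sup>2"]) (use I i in auto)
  show "0 \<le> ip_norm (direct_sum I V) x"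
    using K.norm_nonneg[OF x] .
qed

lemma norm_direct_sum_le:
  assumes x: "x \<in> carr (direct_sum I V)"
  shows "ip_norm (direct_sum I V) x \<le> (\<Sum>i\<in>I. ip_norm (V i) (x i))"
proof (rule power2_le_imp_le)
  have nn: "0 \<le> ip_norm (V i) (x i)" if "i \<in> I" for i
    using ip_sp.norm_nonneg[OF V[OF that]] x that by (auto simp: carr_direct_sum)
  have "(\<Sum>i\<in>J. (ip_norm (V i) (x i))\<^sup>2) \<le> (\<Sum>i\<in>J. ip_norm (V i) (x i))\<^sup>2" if "finite J" "J \<subseteq> I" for J
    using that
  proof (induction J)
    case (insert j J)
    have "0 \<le> (\<Sum>i\<in>J. ip_norm (V i) (x i))" using insert.prems nn by (intro sum_nonneg) auto
    then have "0 \<le> 2 * ip_norm (V j) (x j) * (\<Sum>i\<in>J. ip_norm (V i) (x i))"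
      using nn[of j] insert.prems by simp
    then show ?case using insert by (simp add: power2_sum)
  qed auto
  then show "(ip_norm (direct_sum I V) x)\<^sup>2 \<le> (\<Sum>i\<in>I. ip_norm (V i) (x i))\<^sup>2"
    unfolding norm_sq_direct_sum[OF x] using I by blast
  show "0 \<le> (\<Sum>i\<in>I. ip_norm (V i) (x i))" using nn by (intro sum_nonneg) auto
qed

end

lemma direct_sum_hilbert_sp:
  assumes hV: "\<And>i. i \<in> I \<Longrightarrow> hilbert_sp (V i)" and fI: "finite I"
  shows "hilbert_sp (direct_sum I V)"
proof -
  have Vi: "ip_sp (V i)" if "i \<in> I" for i using hV[OF that] by (simp add: hilbert_sp_def)
  let ?K = "direct_sum I V"
  interpret ip_family I V using Vi fI by (simp add: ip_family_def)
  show ?thesis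
  proof
    fix X :: "nat \<Rightarrow> nat \<Rightarrow> 'a"
    assume X: "\<And>k. X k \<in> carr ?K"
      and cauchy: "\<And>e. e > 0 \<Longrightarrow> \<exists>N. \<forall>k\<ge>N. \<forall>m\<ge>N. ip_norm ?K (X k - X m) < e"
    have Xi: "X k i \<in> carr (V i)" if "i \<in> I" for i k using X[of k] that by (auto simp: carr_direct_sum)
    have "\<exists>y\<in>carr (V i). (\<lambda>k. ip_norm (V i) (X k i - y)) \<longlonglongrightarrow> 0" if i: "i \<in> I" for i
    proof (rule hilbert_sp.complete[OF hV[OF i]])
      show "X k i \<in> carr (V i)" for k using Xi i .
      fix e :: real assume "e > 0"
      then obtain N where N: "\<forall>k\<ge>N. \<forall>m\<ge>N. ip_norm ?K (X k - X m) < e" using cauchy by blast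
      have "ip_norm (V i) (X k i - X m i) \<le> ip_norm ?K (X k - X m)" for k m
        using norm_component_le[OF K.diff_mem[OF X[of k] X[of m]] i] by simp
      then show "\<exists>N. \<forall>k\<ge>N. \<forall>m\<ge>N. ip_norm (V i) (X k i - X m i) < e"
        using N by (meson order_le_less_trans)
    qed
    then obtain y where y: "\<And>i. i \<in> I \<Longrightarrow> y i \<in> carr (V i)"
      "\<And>i. i \<in> I \<Longrightarrow> (\<lambda>k. ip_norm (V i) (X k i - y i)) \<longlonglongrightarrow> 0" by metis
    define z where "z i = (if i \<in> I then y i else 0)" for i
    have z: "z \<in> carr ?K" using y by (auto simp: carr_direct_sum z_def)
    have "(\<lambda>k. ip_norm ?K (X k - z)) \<longlonglongrightarrow> 0"
    proof (rule Lim_null_comparison)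
      show "\<forall>\<^sub>F k in sequentially. norm (ip_norm ?K (X k - z)) \<le> (\<Sum>i\<in>I. ip_norm (V i) (X k i - y i))"
      proof (intro always_eventually allI)
        fix k
        have "ip_norm ?K (X k - z) \<le> (\<Sum>i\<in>I. ip_norm (V i) ((X k - z) i))"
          using norm_direct_sum_le[OF K.diff_mem[OF X z]] .
        also have "\<dots> = (\<Sum>i\<in>I. ip_norm (V i) (X k i - y i))"
          by (intro sum.cong) (auto simp: z_def)
        finally show "norm (ip_norm ?K (X k - z)) \<le> (\<Sum>i\<in>I. ip_norm (V i) (X k i - y i))"
          using K.norm_nonneg[OF K.diff_mem[OF X z]] by simp
      qed
      show "(\<lambda>k. \<Sum>i\<in>I. ip_norm (V i) (X k i - y i)) \<longlonglongrightarrow> 0"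
        using tendsto_sum[of I "\<lambda>i k. ip_norm (V i) (X k i - y i)" "\<lambda>i. 0"] y(2) by simp
    qed
    then show "\<exists>x\<in>carr ?K. (\<lambda>k. ip_norm ?K (X k - x)) \<longlonglongrightarrow> 0" using z by blast
  qed
qed

definition block_op :: "nat set \<Rightarrow> (nat \<Rightarrow> nat \<Rightarrow> 'a::complex_vector \<Rightarrow> 'a) \<Rightarrow> (nat \<Rightarrow> 'a) \<Rightarrow> nat \<Rightarrow> 'a" where
  "block_op I A x = (\<lambda>i. if i \<in> I then \<Sum>j\<in>I. A i j (x j) else 0)"

definition single :: "nat \<Rightarrow> 'a::zero \<Rightarrow> nat \<Rightarrow> 'a" where
  "single j f = (\<lambda>i. if i = j then f else 0)"

context ip_family
begin

lemma block_op_bounded: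
  assumes A: "\<And>i j. i \<in> I \<Longrightarrow> j \<in> I \<Longrightarrow> bounded_op (V j) (V i) (A i j)"
  shows "bounded_op (direct_sum I V) (direct_sum I V) (block_op I A)"
proof -
  have xm: "x j \<in> carr (V j)" if "x \<in> carr (direct_sum I V)" "j \<in> I" for x j
    using that by (auto simp: carr_direct_sum)
  have "\<forall>i\<in>I. \<forall>j\<in>I. \<exists>C. C > 0 \<and> (\<forall>x\<in>carr (V j). ip_norm (V i) (A i j x) \<le> C * ip_norm (V j) x)"
    using bounded_op_bound[OF V A] by metis
  then obtain C where C: "\<And>i j. i \<in> I \<Longrightarrow> j \<in> I \<Longrightarrow> C i j > 0"
    "\<And>i j x. i \<in> I \<Longrightarrow> j \<in> I \<Longrightarrow> x \<in> carr (V j) \<Longrightarrow> ip_norm (V i) (A i j x) \<le> C i j * ip_norm (V j) x"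
    by metis
  have mem: "block_op I A x \<in> carr (direct_sum I V)" if "x \<in> carr (direct_sum I V)" for x
    using that by (auto simp: block_op_def carr_direct_sum intro!: ip_sp.sum_mem[OF V] bounded_opD(1)[OF A])
  have bound: "ip_norm (direct_sum I V) (block_op I A x) \<le> (\<Sum>i\<in>I. \<Sum>j\<in>I. C i j) * ip_norm (direct_sum I V) x"
    if x: "x \<in> carr (direct_sum I V)" for x
  proof -
    have tri: "ip_norm (V i) (\<Sum>j\<in>J. A i j (x j)) \<le> (\<Sum>j\<in>J. C i j) * ip_norm (direct_sum I V) x"
      if i: "i \<in> I" and J: "finite J" "J \<subseteq> I" for i J
      using J
    proof (induction J)
      case empty
      then show ?case by (simp add: ip_sp.norm_zero[OF V[OF i]])
    next
      case (insert j J)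
      then have j: "j \<in> I" and J: "J \<subseteq> I" by auto
      have "ip_norm (V i) (A i j (x j)) \<le> C i j * ip_norm (V j) (x j)"
        using C(2)[OF i j xm[OF x j]] .
      also have "\<dots> \<le> C i j * ip_norm (direct_sum I V) x"
        using C(1)[OF i j] norm_component_le[OF x j] by (intro mult_left_mono) auto
      finally have 1: "ip_norm (V i) (A i j (x j)) \<le> C i j * ip_norm (direct_sum I V) x" .
      have "ip_norm (V i) (A i j (x j) + (\<Sum>j\<in>J. A i j (x j))) \<le> ip_norm (V i) (A i j (x j)) + ip_norm (V i) (\<Sum>j\<in>J. A i j (x j))"
        using i j J x xm by (intro ip_sp.norm_triangle[OF V[OF i]] ip_sp.sum_mem[OF V[OF i]] bounded_opD(1)[OF A]) auto
      then show ?case using insert 1 J by (simp add: algebra_simps)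
    qed
    have "ip_norm (direct_sum I V) (block_op I A x) \<le> (\<Sum>i\<in>I. ip_norm (V i) (block_op I A x i))"
      by (rule norm_direct_sum_le[OF mem[OF x]])
    also have "\<dots> \<le> (\<Sum>i\<in>I. (\<Sum>j\<in>I. C i j) * ip_norm (direct_sum I V) x)"
      using tri[OF _ I] by (intro sum_mono) (simp add: block_op_def)
    finally show ?thesis by (simp add: sum_distrib_right)
  qed
  have lin: "block_op I A (x + y) = block_op I A x + block_op I A y"
    if "x \<in> carr (direct_sum I V)" "y \<in> carr (direct_sum I V)" for x y
    using xm[OF that(1)] xm[OF that(2)] bounded_opD(2)[OF A]
    by (auto simp: block_op_def fun_eq_iff sum.distrib[symmetric] intro!: sum.cong)
  have scal: "block_op I A (c *\<^sub>C x) = c *\<^sub>C block_op I A x" if "x \<in> carr (direct_sum I V)" for c x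
  proof
    fix i
    have "c *\<^sub>C (\<Sum>j\<in>J. f j) = (\<Sum>j\<in>J. c *\<^sub>C (f j :: 'a))" for J :: "nat set" and f
      by (induction J rule: infinite_finite_induct) (auto simp: scaleC_add_right)
    then show "block_op I A (c *\<^sub>C x) i = (c *\<^sub>C block_op I A x) i"
      using xm[OF that] bounded_opD(3)[OF A] by (auto simp: block_op_def intro!: sum.cong)
  qed
  show ?thesis unfolding bounded_op_def using mem lin scal bound by blast
qed

lemma block_op_is_adjoint:
  assumes A: "\<And>i j. i \<in> I \<Longrightarrow> j \<in> I \<Longrightarrow> bounded_op (V j) (V i) (A i j)"
    and B: "\<And>i j. i \<in> I \<Longrightarrow> j \<in> I \<Longrightarrow> bounded_op (V j) (V i) (B i j)"
    and AB: "\<And>i j. i \<in> I \<Longrightarrow> j \<in> I \<Longrightarrow> is_adjoint (V j) (V i) (A i j) (B j i)"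
  shows "is_adjoint (direct_sum I V) (direct_sum I V) (block_op I A) (block_op I B)"
  unfolding is_adjoint_def
proof (intro ballI)
  fix x y assume x: "x \<in> carr (direct_sum I V)" and y: "y \<in> carr (direct_sum I V)"
  have xm: "x j \<in> carr (V j)" "y j \<in> carr (V j)" if "j \<in> I" for j
    using that x y by (auto simp: carr_direct_sum)
  have "ip (direct_sum I V) (block_op I A x) y = (\<Sum>i\<in>I. \<Sum>j\<in>I. ip (V i) (A i j (x j)) (y i))"
    unfolding ip_direct_sum block_op_def
    using xm bounded_opD(1)[OF A] by (auto intro!: sum.cong ip_sp.ip_sum_left[OF V])
  also have "\<dots> = (\<Sum>i\<in>I. \<Sum>j\<in>I. ip (V j) (x j) (B j i (y i)))"
    using AB xm by (auto intro!: sum.cong simp: is_adjoint_def)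
  also have "\<dots> = (\<Sum>j\<in>I. \<Sum>i\<in>I. ip (V j) (x j) (B j i (y i)))" by (rule sum.swap)
  also have "\<dots> = ip (direct_sum I V) x (block_op I B y)"
    unfolding ip_direct_sum block_op_def
    using xm bounded_opD(1)[OF B] by (auto intro!: sum.cong simp: ip_sp.ip_sum_right[OF V])
  finally show "ip (direct_sum I V) (block_op I A x) y = ip (direct_sum I V) x (block_op I B y)" .
qed

lemma single_mem: "j \<in> I \<Longrightarrow> f \<in> carr (V j) \<Longrightarrow> single j f \<in> carr (direct_sum I V)"
  using ip_sp.zero_mem[OF V] by (auto simp: carr_direct_sum single_def)

lemma norm_single:
  assumes j: "j \<in> I" and f: "f \<in> carr (V j)"
  shows "ip_norm (direct_sum I V) (single j f) = ip_norm (V j) f"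
proof -
  have "ip (direct_sum I V) (single j f) (single j f) = (\<Sum>i\<in>I. if i = j then ip (V j) f f else 0)"
    unfolding ip_direct_sum using ip_sp.ip_zero_left[OF V ip_sp.zero_mem[OF V]]
    by (intro sum.cong) (auto simp: single_def)
  then show ?thesis using I j by (simp add: ip_norm_def)
qed

lemma sum_single: "x \<in> carr (direct_sum I V) \<Longrightarrow> x = (\<Sum>j\<in>I. single j (x j))"
proof (rule ext)
  fix i assume x: "x \<in> carr (direct_sum I V)"
  have "(\<Sum>j\<in>I. single j (x j)) i = (\<Sum>j\<in>I. if j = i then x j else 0)"
    unfolding sum_fun_apply by (intro sum.cong) (auto simp: single_def)
  then show "x i = (\<Sum>j\<in>I. single j (x j)) i"
    using I x by (auto simp: carr_direct_sum)
qed

lemma block_entry_bounded: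
  assumes Z: "bounded_op (direct_sum I V) (direct_sum I V) Z" and i: "i \<in> I" and j: "j \<in> I"
  shows "bounded_op (V j) (V i) (\<lambda>f. Z (single j f) i)"
proof -
  obtain C where C: "C > 0" "\<And>x. x \<in> carr (direct_sum I V) \<Longrightarrow> ip_norm (direct_sum I V) (Z x) \<le> C * ip_norm (direct_sum I V) x"
    using bounded_op_bound[OF K.ip_sp_axioms Z] by blast
  have s_add: "single j (f + g) = single j f + single j g" and s_scale: "single j (c *\<^sub>C f) = c *\<^sub>C single j f"
    for f g :: 'a and c by (auto simp: single_def fun_eq_iff)
  note sm = single_mem[OF j]
  have "ip_norm (V i) (Z (single j f) i) \<le> C * ip_norm (V j) f" if f: "f \<in> carr (V j)" for f
    using norm_component_le[OF bounded_opD(1)[OF Z sm[OF f]] i] C(2)[OF sm[OF f]] norm_single[OF j f]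
    by simp
  moreover have "Z (single j f) i \<in> carr (V i)" if "f \<in> carr (V j)" for f
    using bounded_opD(1)[OF Z sm[OF that]] i by (auto simp: carr_direct_sum)
  ultimately show ?thesis
    unfolding bounded_op_def using bounded_opD(2,3)[OF Z] sm
    by (auto simp: s_add s_scale simp del: plus_fun_apply) auto
qed

lemma block_expansion:
  assumes Z: "bounded_op (direct_sum I V) (direct_sum I V) Z" and x: "x \<in> carr (direct_sum I V)"
  shows "Z x i = (\<Sum>j\<in>I. Z (single j (x j)) i)"
proof -
  have "Z x = Z (\<Sum>j\<in>I. single j (x j))" using sum_single[OF x] by simp
  also have "\<dots> = (\<Sum>j\<in>I. Z (single j (x j)))"
    using x by (intro bounded_op_sum[OF K.ip_sp_axioms Z] single_mem) (auto simp: carr_direct_sum)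
  finally show ?thesis by (simp add: sum_fun_apply)
qed

end


section \<open>Taylor coefficients on the disc\<close>

definition tc :: "(complex \<Rightarrow> complex) \<Rightarrow> nat \<Rightarrow> complex" where
  "tc f k = (deriv ^^ k) f 0 / fact k"

lemma tc_sums:
  "f holomorphic_on ball 0 1 \<Longrightarrow> cmod w < 1 \<Longrightarrow> (\<lambda>k. tc f k * w ^ k) sums f w"
  using holomorphic_power_series[of f 0 1 w] by (simp add: tc_def)

lemma tc_eq_fps_nth: "f has_fps_expansion F \<Longrightarrow> tc f k = fps_nth F k"
  by (simp add: tc_def fps_nth_fps_expansion)

lemma has_fps_expansion_tc:
  "f holomorphic_on ball 0 1 \<Longrightarrow> f has_fps_expansion fps_expansion f 0"
  by (rule has_fps_expansion_fps_expansion[of "ball 0 1"]) auto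

lemma tc_unique:
  assumes "\<And>w. cmod w < 1 \<Longrightarrow> (\<lambda>k. a k * w ^ k) sums f w"
  shows "tc f k = a k"
proof -
  have "fps_conv_radius (Abs_fps a) \<ge> 1"
    unfolding fps_conv_radius_def
  proof (rule conv_radius_geI_ex)
    fix r :: real assume r: "0 < r" "ereal r < 1"
    then have "cmod (of_real r) = r \<and> summable (\<lambda>n. fps_nth (Abs_fps a) n * of_real r ^ n)"
      using assms[of "of_real r"] by (auto simp: sums_iff)
    then show "\<exists>z. norm z = r \<and> summable (\<lambda>n. fps_nth (Abs_fps a) n * z ^ n)" by blast
  qed
  moreover have "\<forall>\<^sub>F w in nhds 0. eval_fps (Abs_fps a) w = f w"
  proof (rule eventually_mono[OF eventually_nhds_in_open[of "ball 0 1"]])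
    fix w :: complex assume "w \<in> ball 0 1"
    then show "eval_fps (Abs_fps a) w = f w"
      using assms[of w] by (simp add: eval_fps_def sums_iff)
  qed auto
  ultimately have "f has_fps_expansion Abs_fps a"
    unfolding has_fps_expansion_def by (auto intro: less_le_trans[of 0 1])
  then show ?thesis by (simp add: tc_eq_fps_nth)
qed

lemma tc_cong:
  assumes "\<And>w. cmod w < 1 \<Longrightarrow> f w = g w" "g holomorphic_on ball 0 1"
  shows "tc f k = tc g k"
  using assms tc_sums by (intro tc_unique) auto

lemma tc_mult:
  assumes "f holomorphic_on ball 0 1" "g holomorphic_on ball 0 1"
  shows "tc (\<lambda>z. f z * g z) k = (\<Sum>i\<le>k. tc f i * tc g (k - i))"
proof -
  have "(\<lambda>z. f z * g z) has_fps_expansion fps_expansion f 0 * fps_expansion g 0"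
    by (intro has_fps_expansion_mult has_fps_expansion_tc assms)
  then have "tc (\<lambda>z. f z * g z) k = fps_nth (fps_expansion f 0 * fps_expansion g 0) k"
    by (rule tc_eq_fps_nth)
  also have "\<dots> = (\<Sum>i\<le>k. fps_nth (fps_expansion f 0) i * fps_nth (fps_expansion g 0) (k - i))"
    by (simp only: fps_mult_nth atLeast0AtMost)
  finally show ?thesis by (simp add: fps_expansion_def tc_def)
qed

lemma tc_add:
  assumes "f holomorphic_on ball 0 1" "g holomorphic_on ball 0 1"
  shows "tc (\<lambda>z. f z + g z) k = tc f k + tc g k"
  using sums_add[OF tc_sums[OF assms(1)] tc_sums[OF assms(2)]]
  by (intro tc_unique) (simp add: algebra_simps)

lemma tc_cmult:
  assumes "f holomorphic_on ball 0 1"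
  shows "tc (\<lambda>z. c * f z) k = c * tc f k"
  using sums_mult[OF tc_sums[OF assms], of _ c]
  by (intro tc_unique) (simp add: algebra_simps)

lemma tc_monomial: "tc (\<lambda>z. z ^ p) k = (if k = p then 1 else 0)"
proof (rule tc_unique)
  fix w :: complex
  have "(\<lambda>k. if k = p then w ^ k else 0) sums w ^ p" by (rule sums_single)
  then show "(\<lambda>k. (if k = p then 1 else 0) * w ^ k) sums w ^ p"
    by (rule sums_cong[THEN iffD1, rotated]) auto
qed

lemma holomorphic_eq_zero_if_tc_zero:
  assumes "f holomorphic_on ball 0 1" "\<And>k. tc f k = 0" "cmod w < 1"
  shows "f w = 0"
  using sums_unique2[OF tc_sums[OF assms(1,3)], of 0] assms(2) by simp


section \<open>The weights of the kernel \<open>(1 - z w)\<^sup>-\<^sup>l\<close>\<close>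

definition kc :: "real \<Rightarrow> nat \<Rightarrow> real" where
  "kc l k = pochhammer l k / fact k"

lemma kc_0 [simp]: "kc l 0 = 1"
  by (simp add: kc_def)

lemma kc_Suc: "kc l (Suc k) = kc l k * ((l + k) / (k + 1))"
  by (simp add: kc_def pochhammer_Suc field_simps)

lemma kc_pos: "l > 0 \<Longrightarrow> kc l k > 0"
  by (simp add: kc_def pochhammer_pos)

lemma kc_mono:
  assumes "0 < l" "l \<le> l'"
  shows "kc l k \<le> kc l' k"
proof (induction k)
  case (Suc k)
  have "(l + k) / (k + 1) \<le> (l' + k) / (k + 1)" using assms by (intro divide_right_mono) auto
  then show ?case
    unfolding kc_Suc using Suc assms kc_pos[of l k] by (intro mult_mono) (auto intro: less_imp_le kc_pos)
qed simp

lemma kc_le_Suc: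
  assumes "1 \<le> l"
  shows "kc l k \<le> kc l (Suc k)"
proof -
  have "kc l k * 1 \<le> kc l k * ((l + k) / (k + 1))"
    using assms kc_pos[of l k] by (intro mult_left_mono) auto
  then show ?thesis by (simp add: kc_Suc)
qed

lemma disc_kernel_sums:
  assumes "cmod z < 1" "cmod w < 1"
  shows "(\<lambda>k. of_real (kc l k) * cnj w ^ k * z ^ k) sums disc_kernel l z w"
proof -
  define x where "x = z * cnj w"
  have "cmod x < 1" unfolding x_def norm_mult complex_mod_cnj
    using assms by (metis mult_less_cancel_right2 mult_strict_mono' norm_ge_zero mult_1)
  then have "(\<lambda>k. (- of_real l gchoose k) * (- x) ^ k) sums (1 + - x) powr (- of_real l)"
    by (intro gen_binomial_complex) simp
  moreover have "(- of_real l gchoose k) * (- x) ^ k = of_real (kc l k) * cnj w ^ k * z ^ k" for k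
  proof -
    have "(- of_real l gchoose k) * (- x) ^ k = ((-1) ^ k * (-1) ^ k) * of_real (kc l k) * x ^ k"
      by (simp add: gbinomial_pochhammer kc_def pochhammer_of_real power_minus[of x])
    also have "(-1::complex) ^ k * (-1) ^ k = 1"
      by (simp flip: power_mult_distrib)
    finally show ?thesis by (simp add: x_def power_mult_distrib)
  qed
  moreover have "(1 + - x) powr (- of_real l) = disc_kernel l z w"
    by (simp add: disc_kernel_def x_def powr_minus inverse_eq_divide)
  ultimately show ?thesis by (simp only:)
qed

text \<open>This is Euler's limit formula for the Gamma function, up to the factor \<open>k / (l + k)\<close>.\<close>

lemma kc_asymp:
  assumes "l > 0"
  shows "(\<lambda>k. kc l k / (real k powr (l - 1))) \<longlonglongrightarrow> rGamma l"
proof -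
  have "(\<lambda>k. rGamma_series l k * (real k / (l + real k))) \<longlonglongrightarrow> rGamma l * 1"
  proof (rule tendsto_mult[OF rGamma_series_LIMSEQ])
    show "(\<lambda>k. real k / (l + real k)) \<longlonglongrightarrow> 1" by real_asymp
  qed
  moreover have "\<forall>\<^sub>F k in sequentially. rGamma_series l k * (real k / (l + real k)) = kc l k / (real k powr (l - 1))"
    using eventually_gt_at_top[of 0]
  proof eventually_elim
    case (elim k)
    have "exp (l * ln (real k)) = real k powr (l - 1) * real k"
      using elim by (simp add: powr_def exp_diff left_diff_distrib)
    moreover have "l + real k > 0" using assms by simp
    ultimately show ?case using elim
      by (simp add: rGamma_series_def kc_def pochhammer_Suc frac_eq_eq)
  qed
  ultimately show ?thesis by (simp add: tendsto_cong)
qed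


section \<open>The reproducing kernel space as a weighted sequence space\<close>

text \<open>Elements of the spaces vanish outside the disc, so formulas have to be cut off there.\<close>

definition dfun :: "(complex \<Rightarrow> complex) \<Rightarrow> complex \<Rightarrow> complex" where
  "dfun g = (\<lambda>z. if z \<in> ball 0 1 then g z else 0)"

abbreviation mon :: "nat \<Rightarrow> complex \<Rightarrow> complex" where
  "mon k \<equiv> dfun (\<lambda>z. z ^ k)"

locale disc_space = hilbert_sp V for V :: "(complex \<Rightarrow> complex) ip_space" +
  fixes l :: real
  assumes l: "1 \<le> l"
    and vanish: "\<And>f z. f \<in> carr V \<Longrightarrow> z \<notin> ball 0 1 \<Longrightarrow> f z = 0"
    and hol: "\<And>f. f \<in> carr V \<Longrightarrow> f holomorphic_on ball 0 1"
    and kern_mem: "\<And>w. w \<in> ball 0 1 \<Longrightarrow> dfun (\<lambda>z. disc_kernel l z w) \<in> carr V"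
    and kern_ip: "\<And>w f. w \<in> ball 0 1 \<Longrightarrow> f \<in> carr V \<Longrightarrow> ip V f (dfun (\<lambda>z. disc_kernel l z w)) = f w"

lemma disc_space_iff:
  "disc_space V l \<longleftrightarrow> 1 \<le> l \<and> rkhs (ball 0 1) (disc_kernel l) V \<and> (\<forall>f\<in>carr V. f holomorphic_on ball 0 1)"
  unfolding disc_space_def disc_space_axioms_def rkhs_def hilbert_sp_iff dfun_def by blast

context disc_space
begin

abbreviation kern :: "complex \<Rightarrow> complex \<Rightarrow> complex" where
  "kern w \<equiv> dfun (\<lambda>z. disc_kernel l z w)"

lemma kc_gt_0: "kc l k > 0"
  using l by (simp add: kc_pos)

lemma tc_kern:
  assumes "cmod w < 1"
  shows "tc (kern w) k = of_real (kc l k) * cnj w ^ k"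
proof (rule tc_unique)
  fix z :: complex assume "cmod z < 1"
  then show "(\<lambda>k. of_real (kc l k) * cnj w ^ k * z ^ k) sums kern w z"
    using disc_kernel_sums[of z w l] assms by (simp add: dfun_def)
qed

lemma eqI:
  assumes "f \<in> carr V" "g \<in> carr V" "\<And>w. cmod w < 1 \<Longrightarrow> f w = g w"
  shows "f = g"
  using assms vanish by (metis ext mem_ball_0)

lemma pointwise_bound:
  assumes "f \<in> carr V" "cmod w < 1"
  shows "cmod (f w) \<le> ip_norm V f * ip_norm V (kern w)"
  using Cauchy_Schwarz[OF assms(1) kern_mem[of w]] kern_ip[of w f] assms by simp

lemma tc_bound: "\<exists>C. \<forall>f\<in>carr V. cmod (tc f k) \<le> C * ip_norm V f"
proof -
  \<comment> \<open>the norm of the kernel function at \<open>w\<close> depends only on \<open>\<bar>w\<bar>\<close>\<close>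
  define B where "B = sqrt (Re (1 / (1 - 1 / 4) powr (of_real l)))"
  have B: "ip_norm V (kern w) = B" if "cmod w = 1 / 2" for w
  proof -
    have "w * cnj w = 1 / 4"
      using that by (simp only: complex_norm_square[symmetric]) (simp add: power2_eq_square)
    then have "1 - w * cnj w = 1 - 1 / 4" by (simp only:)
    moreover have "ip V (kern w) (kern w) = 1 / (1 - w * cnj w) powr (of_real l)"
      using kern_ip[of w "kern w"] kern_mem[of w] that
      by (simp add: dfun_def disc_kernel_def)
    ultimately show ?thesis by (simp only: ip_norm_def B_def)
  qed
  have "cmod (tc f k) \<le> (B / (1 / 2) ^ k) * ip_norm V f" if f: "f \<in> carr V" for f
  proof -
    have "cmod ((deriv ^^ k) f 0) \<le> fact k * (ip_norm V f * B) / (1 / 2) ^ k"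
    proof (rule Cauchy_inequality)
      show "f holomorphic_on ball 0 (1 / 2)"
        by (rule holomorphic_on_subset[OF hol[OF f]]) auto
      show "continuous_on (cball 0 (1 / 2)) f"
        by (rule continuous_on_subset[OF holomorphic_on_imp_continuous_on[OF hol[OF f]]]) auto
      show "cmod (f w) \<le> ip_norm V f * B" if "cmod (0 - w) = 1 / 2" for w
        using pointwise_bound[OF f, of w] B[of w] that by simp
    qed simp
    then show ?thesis
      by (simp add: tc_def norm_divide field_simps)
  qed
  then show ?thesis by blast
qed

text \<open>
  The vector \<open>g\<close> that represents the \<open>k\<close>-th Taylor coefficient is a multiple of \<open>z\<^sup>k\<close>:
  \<open>g w = \<langle>g, k\<^sub>w\<rangle>\<close> is the conjugate of the \<open>k\<close>-th coefficient of the kernel function \<open>k\<^sub>w\<close>.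
\<close>

lemma mon_representer:
  shows mon_mem: "mon k \<in> carr V"
    and ip_mon: "\<And>f. f \<in> carr V \<Longrightarrow> ip V f (mon k) = tc f k / of_real (kc l k)"
proof -
  obtain C where C: "\<And>f. f \<in> carr V \<Longrightarrow> cmod (tc f k) \<le> C * ip_norm V f"
    using tc_bound by blast
  obtain g where g: "g \<in> carr V" "\<And>f. f \<in> carr V \<Longrightarrow> tc f k = ip V f g"
  proof (rule Riesz[of "\<lambda>f. tc f k" C])
    show "tc (f + g) k = tc f k + tc g k" if "f \<in> carr V" "g \<in> carr V" for f g
      using tc_add[OF hol[OF that(1)] hol[OF that(2)]] by (simp add: plus_fun_def)
    show "tc (c *\<^sub>C f) k = c * tc f k" if "f \<in> carr V" for c f
      using tc_cmult[OF hol[OF that]] by (simp add: scaleC_fun_def)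
  qed (use C in auto)
  have gw: "g w = of_real (kc l k) * w ^ k" if "cmod w < 1" for w
  proof -
    have "g w = cnj (ip V (kern w) g)"
      using kern_ip[of w g] ip_cnj[OF kern_mem[of w] g(1)] g(1) that by simp
    also have "\<dots> = cnj (tc (kern w) k)" using g(2)[OF kern_mem] that by simp
    finally show ?thesis using tc_kern[OF that] by simp
  qed
  have kc0: "complex_of_real (kc l k) \<noteq> 0" using kc_gt_0[of k] by simp
  have eq: "mon k = (1 / of_real (kc l k)) *\<^sub>C g"
    using gw vanish[OF g(1)] kc0 by (auto simp: dfun_def fun_eq_iff)
  show "mon k \<in> carr V" unfolding eq using g(1) by blast
  show "ip V f (mon k) = tc f k / of_real (kc l k)" if "f \<in> carr V" for f
    unfolding eq using g that by (simp add: ip_scale_right)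
qed

lemma tc_mon [simp]: "tc (mon p) k = (if k = p then 1 else 0)"
  using tc_cong[of "mon p" "\<lambda>z. z ^ p" k] by (simp add: tc_monomial dfun_def holomorphic_intros)

lemma ip_mon_mon: "ip V (mon p) (mon k) = (if k = p then 1 / of_real (kc l k) else 0)"
  by (simp add: ip_mon mon_mem)

lemma norm_mon_sq: "(ip_norm V (mon k))\<^sup>2 = 1 / kc l k"
proof -
  have "ip V (mon k) (mon k) = of_real (1 / kc l k)" by (simp add: ip_mon_mon)
  then show ?thesis by (simp add: norm_sq[OF mon_mem])
qed

definition psum :: "(nat \<Rightarrow> complex) \<Rightarrow> nat \<Rightarrow> complex \<Rightarrow> complex" where
  "psum a N = (\<Sum>k<N. a k *\<^sub>C mon k)"

lemma psum_mem [simp, intro]: "psum a N \<in> carr V"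
  unfolding psum_def by (intro sum_mem scale_mem mon_mem)

lemma psum_apply: "cmod w < 1 \<Longrightarrow> psum a N w = (\<Sum>k<N. a k * w ^ k)"
  by (simp add: psum_def sum_fun_apply dfun_def)

lemma ip_psum: "f \<in> carr V \<Longrightarrow> ip V f (psum a N) = (\<Sum>k<N. tc f k * cnj (a k) / of_real (kc l k))"
  unfolding psum_def
  by (subst ip_sum_right) (auto simp: ip_scale_right ip_mon mon_mem mult_ac intro!: sum.cong)

lemma tc_psum: "tc (psum a N) k = (if k < N then a k else 0)"
proof (rule tc_unique)
  fix w :: complex assume w: "cmod w < 1"
  have "(\<lambda>k. if k < N then a k * w ^ k else 0) sums (\<Sum>k<N. a k * w ^ k)"
    using sums_If_finite_set[of "{..<N}" "\<lambda>k. a k * w ^ k"] by simp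
  then show "(\<lambda>k. (if k < N then a k else 0) * w ^ k) sums psum a N w"
    unfolding psum_apply[OF w] by (rule sums_cong[THEN iffD1, rotated]) auto
qed

lemma norm_psum_sq: "(ip_norm V (psum a N))\<^sup>2 = (\<Sum>k<N. (cmod (a k))\<^sup>2 / kc l k)"
proof -
  have "ip V (psum a N) (psum a N) = of_real (\<Sum>k<N. (cmod (a k))\<^sup>2 / kc l k)"
    unfolding ip_psum[OF psum_mem] of_real_sum
    by (intro sum.cong refl) (simp add: tc_psum complex_norm_square[of "a _"] flip: of_real_power)
  then show ?thesis by (simp add: norm_sq)
qed

lemma norm_sub_psum_sq:
  assumes "f \<in> carr V"
  shows "(ip_norm V (f - psum (tc f) N))\<^sup>2 = (ip_norm V f)\<^sup>2 - (\<Sum>k<N. (cmod (tc f k))\<^sup>2 / kc l k)"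
proof -
  have "ip V f (psum (tc f) N) = of_real (\<Sum>k<N. (cmod (tc f k))\<^sup>2 / kc l k)"
    unfolding ip_psum[OF assms] of_real_sum by (intro sum.cong refl) (simp add: complex_norm_square[of "tc f _"] flip: of_real_power)
  then show ?thesis using assms by (simp add: norm_sq_diff norm_psum_sq)
qed

lemma summable_tc:
  assumes "f \<in> carr V"
  shows "summable (\<lambda>k. (cmod (tc f k))\<^sup>2 / kc l k)"
proof (rule bounded_imp_summable)
  show "0 \<le> (cmod (tc f k))\<^sup>2 / kc l k" for k using kc_gt_0[of k] by simp
  have "(\<Sum>k<Suc N. (cmod (tc f k))\<^sup>2 / kc l k) \<le> (ip_norm V f)\<^sup>2" for N
    using norm_sub_psum_sq[OF assms, of "Suc N"] by (metis diff_ge_0_iff_ge zero_le_power2)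
  then show "(\<Sum>k\<le>N. (cmod (tc f k))\<^sup>2 / kc l k) \<le> (ip_norm V f)\<^sup>2" for N
    by (simp add: lessThan_Suc_atMost)
qed

text \<open>
  The partial sums form a Cauchy sequence; pairing with the kernel functions identifies the
  coefficients of the limit.
\<close>

lemma series_mem:
  assumes "summable (\<lambda>k. (cmod (a k))\<^sup>2 / kc l k)"
  obtains g where "g \<in> carr V" "\<And>k. tc g k = a k" "(\<lambda>N. ip_norm V (psum a N - g)) \<longlonglongrightarrow> 0"
proof -
  let ?s = "\<lambda>k. (cmod (a k))\<^sup>2 / kc l k"
  have diff: "(ip_norm V (psum a N - psum a M))\<^sup>2 = sum ?s {M..<N}" if "M \<le> N" for M N
  proof -
    define b where "b k = (if k < M then 0 else a k)" for k
    have "psum a N = psum a M + psum b N"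
    proof (rule eqI)
      fix w :: complex assume w: "cmod w < 1"
      have "(\<Sum>k<N. a k * w ^ k) = (\<Sum>k<M. a k * w ^ k) + (\<Sum>k\<in>{M..<N}. b k * w ^ k)"
        using sum.atLeastLessThan_concat[of 0 M N "\<lambda>k. a k * w ^ k"] that
        by (simp add: lessThan_atLeast0 b_def)
      also have "(\<Sum>k\<in>{M..<N}. b k * w ^ k) = (\<Sum>k<N. b k * w ^ k)"
        by (intro sum.mono_neutral_left) (auto simp: b_def)
      finally show "psum a N w = (psum a M + psum b N) w" using w by (simp add: psum_apply)
    qed auto
    then have "(ip_norm V (psum a N - psum a M))\<^sup>2 = (\<Sum>k<N. (cmod (b k))\<^sup>2 / kc l k)"
      by (simp add: norm_psum_sq)
    also have "\<dots> = (\<Sum>k\<in>{M..<N}. (cmod (b k))\<^sup>2 / kc l k)"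
      by (intro sum.mono_neutral_right) (auto simp: b_def)
    also have "\<dots> = sum ?s {M..<N}" by (intro sum.cong) (auto simp: b_def)
    finally show ?thesis .
  qed
  have "\<exists>g\<in>carr V. (\<lambda>N. ip_norm V (psum a N - g)) \<longlonglongrightarrow> 0"
  proof (rule complete)
    fix e :: real assume e: "e > 0"
    obtain N0 where N0: "\<And>m n. m \<ge> N0 \<Longrightarrow> norm (sum ?s {m..<n}) < e\<^sup>2"
      using summable_Cauchy[THEN iffD1, OF assms] e by (meson zero_less_power)
    have *: "ip_norm V (psum a N - psum a M) < e" if "M \<ge> N0" "M \<le> N" for M N
    proof -
      have "(ip_norm V (psum a N - psum a M))\<^sup>2 < e\<^sup>2"
        using N0[OF that(1), of N] diff[OF that(2)] by simp
      then show ?thesis using e by (simp add: power2_less_imp_less)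
    qed
    have "ip_norm V (psum a k - psum a m) < e" if "k \<ge> N0" "m \<ge> N0" for k m
    proof (cases "m \<le> k")
      case False
      then show ?thesis using *[OF that(1), of m] norm_diff_commute[OF psum_mem psum_mem] by simp
    qed (use * that in blast)
    then show "\<exists>N. \<forall>k\<ge>N. \<forall>m\<ge>N. ip_norm V (psum a k - psum a m) < e" by blast
  qed auto
  then obtain g where g: "g \<in> carr V" "(\<lambda>N. ip_norm V (psum a N - g)) \<longlonglongrightarrow> 0" by blast
  have "tc g k = a k" for k
  proof (rule tc_unique)
    fix w :: complex assume w: "cmod w < 1"
    have "(\<lambda>N. ip V (psum a N) (kern w)) \<longlonglongrightarrow> ip V g (kern w)"
      by (rule ip_tendsto[OF _ g(1) _ g(2)]) (use w kern_mem in auto)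
    then show "(\<lambda>k. a k * w ^ k) sums g w"
      using w g(1) by (simp add: kern_ip psum_apply sums_def)
  qed
  with g that show ?thesis by blast
qed

lemma eqI_tc:
  assumes "f \<in> carr V" "g \<in> carr V" "\<And>k. tc f k = tc g k"
  shows "f = g"
  using assms by (intro eqI) (auto dest!: hol tc_sums intro: sums_unique2)

theorem psum_tendsto:
  assumes "f \<in> carr V"
  shows "(\<lambda>N. ip_norm V (psum (tc f) N - f)) \<longlonglongrightarrow> 0"
  using series_mem[OF summable_tc[OF assms]] eqI_tc[OF assms] by metis

theorem norm_sq_sums:
  assumes "f \<in> carr V"
  shows "(\<lambda>k. (cmod (tc f k))\<^sup>2 / kc l k) sums (ip_norm V f)\<^sup>2"
proof -
  have "(\<lambda>N. (ip_norm V (psum (tc f) N))\<^sup>2) \<longlonglongrightarrow> (ip_norm V f)\<^sup>2"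
    by (intro tendsto_power norm_tendsto psum_mem assms psum_tendsto)
  then show ?thesis by (simp add: norm_psum_sq sums_def)
qed

theorem memI:
  assumes "f holomorphic_on ball 0 1" "\<And>z. z \<notin> ball 0 1 \<Longrightarrow> f z = 0"
    and "summable (\<lambda>k. (cmod (tc f k))\<^sup>2 / kc l k)"
  shows "f \<in> carr V"
proof -
  obtain g where g: "g \<in> carr V" "\<And>k. tc g k = tc f k" using series_mem[OF assms(3)] by metis
  have "f w = g w" for w
  proof (cases "cmod w < 1")
    case True
    then show ?thesis
      using tc_sums[OF assms(1) True] tc_sums[OF hol[OF g(1)] True] g(2) sums_unique2 by fastforce
  next
    case False
    then show ?thesis using assms(2) vanish[OF g(1)] by simp
  qed
  then show ?thesis using g(1) by presburger
qed

end


section \<open>Bounded analytic functions as multipliers\<close>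

definition hinf :: "(complex \<Rightarrow> complex) \<Rightarrow> bool" where
  "hinf g \<longleftrightarrow> g holomorphic_on ball 0 1 \<and> (\<exists>B. \<forall>z\<in>ball 0 1. cmod (g z) \<le> B)"

lemma has_integral_circle_coeff:
  assumes h: "h holomorphic_on ball 0 1" and r: "0 < r" "r < 1"
  shows "((\<lambda>t. h (circlepath 0 r t) * cnj (circlepath 0 r t ^ k)) has_integral tc h k * of_real (r ^ (2 * k))) {0..1}"
proof -
  define E where "E = circlepath 0 r"
  have E_eq: "E t = r * exp (2 * of_real pi * \<i> * of_real t)" for t by (simp add: E_def circlepath)
  have normE: "cmod (E t) = r" for t using r by (simp add: E_eq norm_mult norm_exp_eq_Re)
  have E0: "E t \<noteq> 0" for t using normE[of t] r by auto
  have "((\<lambda>u. h u / (u - 0) ^ Suc k) has_contour_integral (2 * pi * \<i>) / fact k * (deriv ^^ k) h 0) (circlepath 0 r)"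
    using h r by (intro Cauchy_has_contour_integral_higher_derivative_circlepath)
      (auto intro!: holomorphic_on_imp_continuous_on elim: holomorphic_on_subset)
  then have "((\<lambda>t. h (E t) / E t ^ Suc k * vector_derivative E (at t)) has_integral (2 * pi * \<i>) * tc h k) {0..1}"
    by (simp add: has_contour_integral E_def tc_def mult.assoc)
  moreover have "vector_derivative E (at t) = 2 * pi * \<i> * E t" for t
    unfolding E_def vector_derivative_circlepath by (simp add: circlepath)
  ultimately have "((\<lambda>t. of_real (r ^ (2 * k)) / (2 * pi * \<i>) * (h (E t) / E t ^ Suc k * (2 * pi * \<i> * E t)))
      has_integral of_real (r ^ (2 * k)) / (2 * pi * \<i>) * ((2 * pi * \<i>) * tc h k)) {0..1}"
    by (intro has_integral_mult_right) simp
  moreover have "of_real (r ^ (2 * k)) / (2 * pi * \<i>) * (h (E t) / E t ^ Suc k * (2 * pi * \<i> * E t))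
      = h (E t) * cnj (E t ^ k)" for t
  proof -
    have "of_real (r ^ (2 * k)) = (E t * cnj (E t)) ^ k"
      using complex_norm_square[of "E t"] by (simp add: normE power_mult)
    then show ?thesis using E0[of t] by (simp add: field_simps power_mult_distrib)
  qed
  moreover have "of_real (r ^ (2 * k)) / (2 * pi * \<i>) * ((2 * pi * \<i>) * tc h k) = tc h k * of_real (r ^ (2 * k))"
    using pi_gt_zero by (simp add: field_simps)
  ultimately show ?thesis by (simp only: E_def)
qed

definition tpoly :: "(nat \<Rightarrow> complex) \<Rightarrow> nat \<Rightarrow> complex \<Rightarrow> complex" where
  "tpoly a N z = (\<Sum>k<N. a k * z ^ k)"

lemma tpoly_hol [intro]: "tpoly a N holomorphic_on S"
  unfolding tpoly_def by (intro holomorphic_intros)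

lemma tc_tpoly: "tc (tpoly a N) k = (if k < N then a k else 0)"
proof (rule tc_unique)
  fix w :: complex
  have "(\<lambda>k. if k < N then a k * w ^ k else 0) sums (\<Sum>k<N. a k * w ^ k)"
    using sums_If_finite_set[of "{..<N}" "\<lambda>k. a k * w ^ k"] by simp
  then show "(\<lambda>k. (if k < N then a k else 0) * w ^ k) sums tpoly a N w"
    unfolding tpoly_def by (rule sums_cong[THEN iffD1, rotated]) auto
qed

lemma has_integral_circle_tpoly:
  assumes h: "h holomorphic_on ball 0 1" and r: "0 < r" "r < 1"
  shows "((\<lambda>t. h (circlepath 0 r t) * cnj (tpoly a N (circlepath 0 r t))) has_integral
           (\<Sum>k<N. tc h k * cnj (a k) * of_real (r ^ (2 * k)))) {0..1}"
proof -
  let ?E = "circlepath 0 r"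
  have "((\<lambda>t. \<Sum>k<N. cnj (a k) * (h (?E t) * cnj (?E t ^ k))) has_integral
         (\<Sum>k<N. cnj (a k) * (tc h k * of_real (r ^ (2 * k))))) {0..1}"
    by (intro has_integral_sum has_integral_mult_right has_integral_circle_coeff h r) auto
  then show ?thesis
    by (simp add: tpoly_def sum_distrib_left mult_ac)
qed

lemma has_integral_circle_tpoly_sq:
  assumes r: "0 < r" "r < 1"
  shows "((\<lambda>t. (cmod (tpoly a N (circlepath 0 r t)))\<^sup>2) has_integral (\<Sum>k<N. (cmod (a k))\<^sup>2 * r ^ (2 * k))) {0..1}"
proof -
  have "((\<lambda>t. Re (tpoly a N (circlepath 0 r t) * cnj (tpoly a N (circlepath 0 r t)))) has_integral
         Re (\<Sum>k<N. tc (tpoly a N) k * cnj (a k) * of_real (r ^ (2 * k)))) {0..1}"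
    by (intro has_integral_Re has_integral_circle_tpoly r tpoly_hol)
  moreover have "Re (\<Sum>k<N. tc (tpoly a N) k * cnj (a k) * of_real (r ^ (2 * k))) = (\<Sum>k<N. (cmod (a k))\<^sup>2 * r ^ (2 * k))"
    unfolding Re_sum by (intro sum.cong refl) (simp add: tc_tpoly complex_norm_square[symmetric])
  moreover have "Re (z * cnj z) = (cmod z)\<^sup>2" for z by (simp add: complex_norm_square[symmetric])
  ultimately show ?thesis by simp
qed

lemma circle_continuous:
  assumes "h holomorphic_on ball 0 1" "0 < r" "r < 1"
  shows "continuous_on {0..1} (\<lambda>t. h (circlepath 0 r t))"
proof (rule continuous_on_compose2[OF holomorphic_on_imp_continuous_on[OF assms(1)]])
  show "continuous_on {0..1} (circlepath 0 r)"
    unfolding circlepath by (intro continuous_intros)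
  show "circlepath 0 r ` {0..1} \<subseteq> ball 0 1"
    using assms by (auto simp: circlepath norm_mult norm_exp_eq_Re)
qed

text \<open>The mean of \<open>\<bar>h - s\<bar>\<^sup>2\<close> over the circle is non-negative, where \<open>s\<close> is the Taylor polynomial.\<close>

lemma circle_Bessel:
  assumes h: "h holomorphic_on ball 0 1" and r: "0 < r" "r < 1"
  shows "(\<Sum>k<N. (cmod (tc h k))\<^sup>2 * r ^ (2 * k)) \<le> integral {0..1} (\<lambda>t. (cmod (h (circlepath 0 r t)))\<^sup>2)"
proof -
  let ?E = "circlepath 0 r"
  define s where "s = tpoly (tc h) N"
  define S where "S = (\<Sum>k<N. (cmod (tc h k))\<^sup>2 * r ^ (2 * k))"
  define J where "J = integral {0..1} (\<lambda>t. (cmod (h (?E t)))\<^sup>2)"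
  have 1: "((\<lambda>t. (cmod (h (?E t)))\<^sup>2) has_integral J) {0..1}"
    unfolding J_def
    by (intro integrable_integral integrable_continuous_interval continuous_intros circle_continuous h r)
  have 2: "((\<lambda>t. (cmod (s (?E t)))\<^sup>2) has_integral S) {0..1}"
    unfolding s_def S_def by (rule has_integral_circle_tpoly_sq[OF r])
  have "((\<lambda>t. Re (h (?E t) * cnj (s (?E t)))) has_integral
         Re (\<Sum>k<N. tc h k * cnj (tc h k) * of_real (r ^ (2 * k)))) {0..1}"
    unfolding s_def by (intro has_integral_Re has_integral_circle_tpoly h r)
  moreover have "Re (\<Sum>k<N. tc h k * cnj (tc h k) * of_real (r ^ (2 * k))) = S"
    unfolding Re_sum S_def by (intro sum.cong refl) (simp add: complex_norm_square[symmetric])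
  ultimately have 3: "((\<lambda>t. Re (h (?E t) * cnj (s (?E t)))) has_integral S) {0..1}" by simp
  have "((\<lambda>t. (cmod (h (?E t)))\<^sup>2 + (cmod (s (?E t)))\<^sup>2 - 2 * Re (h (?E t) * cnj (s (?E t)))) has_integral J + S - 2 * S) {0..1}"
    by (intro has_integral_diff has_integral_add has_integral_mult_right 1 2 3)
  moreover have "0 \<le> (cmod x)\<^sup>2 + (cmod y)\<^sup>2 - 2 * Re (x * cnj y)" for x y
  proof -
    have "(cmod x)\<^sup>2 + (cmod y)\<^sup>2 - 2 * Re (x * cnj y) = (cmod (x - y))\<^sup>2"
      unfolding cmod_power2 by (simp add: power2_eq_square algebra_simps)
    then show ?thesis by simp
  qed
  ultimately have "0 \<le> J + S - 2 * S" by (rule has_integral_nonneg)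
  then show ?thesis by (simp add: J_def S_def)
qed

text \<open>
  Multiplication by \<open>g\<close> is lower triangular on coefficient sequences, so its contractivity on the
  Hardy space holds for every initial segment of coefficients.
\<close>

lemma Hardy_partial_sums:
  assumes g: "g holomorphic_on ball 0 1" and B: "\<And>z. cmod z < 1 \<Longrightarrow> cmod (g z) \<le> B"
    and f: "f holomorphic_on ball 0 1"
  shows "(\<Sum>k<N. (cmod (tc (\<lambda>z. g z * f z) k))\<^sup>2) \<le> B\<^sup>2 * (\<Sum>k<N. (cmod (tc f k))\<^sup>2)"
proof -
  \<comment> \<open>truncating \<open>f\<close> leaves the first \<open>N\<close> coefficients of the product unchanged\<close>
  define p where "p = tpoly (tc f) N"
  define h where "h z = g z * p z" for z
  have hh: "h holomorphic_on ball 0 1"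
    unfolding h_def p_def by (intro holomorphic_intros g tpoly_hol)
  have B0: "0 \<le> B" using B[of 0] order_trans[OF norm_ge_zero, of "g 0" B] by simp
  have tch: "tc (\<lambda>z. g z * f z) k = tc h k" if "k < N" for k
  proof -
    have "tc h k = (\<Sum>i\<le>k. tc g i * tc p (k - i))"
      unfolding h_def by (rule tc_mult[OF g]) (simp add: p_def tpoly_hol)
    also have "\<dots> = (\<Sum>i\<le>k. tc g i * tc f (k - i))"
      using that by (intro sum.cong) (auto simp: p_def tc_tpoly)
    finally show ?thesis by (simp add: tc_mult[OF g f])
  qed
  have radius: "(\<Sum>k<N. (cmod (tc h k))\<^sup>2 * r ^ (2 * k)) \<le> B\<^sup>2 * (\<Sum>k<N. (cmod (tc f k))\<^sup>2 * r ^ (2 * k))"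
    if r: "0 < r" "r < 1" for r
  proof -
    let ?E = "circlepath 0 r"
    have Eb: "cmod (?E t) < 1" for t using r by (simp add: circlepath norm_mult norm_exp_eq_Re)
    have p2: "((\<lambda>t. B\<^sup>2 * (cmod (p (?E t)))\<^sup>2) has_integral B\<^sup>2 * (\<Sum>k<N. (cmod (tc f k))\<^sup>2 * r ^ (2 * k))) {0..1}"
      unfolding p_def by (intro has_integral_mult_right has_integral_circle_tpoly_sq r)
    have "integral {0..1} (\<lambda>t. (cmod (h (?E t)))\<^sup>2) \<le> B\<^sup>2 * (\<Sum>k<N. (cmod (tc f k))\<^sup>2 * r ^ (2 * k))"
    proof (rule has_integral_le[OF integrable_integral p2])
      show "(\<lambda>t. (cmod (h (?E t)))\<^sup>2) integrable_on {0..1}"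
        by (intro integrable_continuous_interval continuous_intros circle_continuous hh r)
      show "(cmod (h (?E t)))\<^sup>2 \<le> B\<^sup>2 * (cmod (p (?E t)))\<^sup>2" for t
        using B[OF Eb[of t]] B0
        by (simp add: h_def norm_mult mult_mono power_mono flip: power_mult_distrib)
    qed
    then show ?thesis using circle_Bessel[OF hh r, of N] by linarith
  qed
  have "(\<Sum>k<N. (cmod (tc h k))\<^sup>2 * 1 ^ (2 * k)) \<le> B\<^sup>2 * (\<Sum>k<N. (cmod (tc f k))\<^sup>2 * 1 ^ (2 * k))"
  proof (rule tendsto_le)
    show "((\<lambda>r. \<Sum>k<N. (cmod (tc h k))\<^sup>2 * r ^ (2 * k)) \<longlongrightarrow> (\<Sum>k<N. (cmod (tc h k))\<^sup>2 * 1 ^ (2 * k))) (at_left (1::real))"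
      by (intro tendsto_intros)
    show "((\<lambda>r. B\<^sup>2 * (\<Sum>k<N. (cmod (tc f k))\<^sup>2 * r ^ (2 * k))) \<longlongrightarrow> B\<^sup>2 * (\<Sum>k<N. (cmod (tc f k))\<^sup>2 * 1 ^ (2 * k))) (at_left (1::real))"
      by (intro tendsto_intros)
    show "\<forall>\<^sub>F r in at_left (1::real). (\<Sum>k<N. (cmod (tc h k))\<^sup>2 * r ^ (2 * k)) \<le> B\<^sup>2 * (\<Sum>k<N. (cmod (tc f k))\<^sup>2 * r ^ (2 * k))"
      using eventually_at_left_field[of "\<lambda>r. 0 < r \<and> r < 1" 1] radius
      by (auto intro: eventually_mono exI[of _ 0])
  qed simp
  then show ?thesis using tch by simp
qed

text \<open>Abel summation: domination of partial sums survives decreasing weights.\<close>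

lemma weighted_sum_le:
  fixes x y w :: "nat \<Rightarrow> real"
  assumes "\<And>N. (\<Sum>k<N. x k) \<le> (\<Sum>k<N. y k)" "\<And>k. 0 \<le> w k" "\<And>k. w (Suc k) \<le> w k"
  shows "(\<Sum>k<N. w k * x k) \<le> (\<Sum>k<N. w k * y k)"
proof -
  define D where "D N = (\<Sum>k<N. y k - x k)" for N
  have D: "0 \<le> D N" for N using assms(1)[of N] by (simp add: D_def sum_subtractf)
  have "w N * D N \<le> (\<Sum>k<N. w k * (y k - x k))" for N
  proof (induction N)
    case (Suc N)
    have "w (Suc N) * D (Suc N) \<le> w N * D (Suc N)" using assms(3) D by (intro mult_right_mono)
    also have "\<dots> = w N * D N + w N * (y N - x N)" by (simp add: D_def algebra_simps)
    finally show ?case using Suc by simp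
  qed (simp add: D_def)
  moreover have "0 \<le> w N * D N" using assms(2) D by simp
  ultimately have "0 \<le> (\<Sum>k<N. w k * (y k - x k))" by (meson order_trans)
  then show ?thesis by (simp add: right_diff_distrib sum_subtractf)
qed

text \<open>
  The weights \<open>1 / kc l k\<close> decrease both in \<open>k\<close> (as \<open>1 \<le> l\<close>) and in \<open>l\<close>, so the Hardy space estimate
  for initial segments of coefficients carries over to all these spaces.
\<close>

theorem mult_op_bound:
  assumes V: "disc_space V l" and W: "disc_space W m" and lm: "l \<le> m"
    and g: "g holomorphic_on ball 0 1" and B: "\<And>z. cmod z < 1 \<Longrightarrow> cmod (g z) \<le> B"
    and f: "f \<in> carr V"
  shows "mult_op g f \<in> carr W" "ip_norm W (mult_op g f) \<le> B * ip_norm V f"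
proof -
  interpret V: disc_space V l by fact
  interpret W: disc_space W m by fact
  have fh: "f holomorphic_on ball 0 1" by (rule V.hol[OF f])
  have gf: "mult_op g f holomorphic_on ball 0 1"
    unfolding mult_op_def by (intro holomorphic_intros g fh)
  have B0: "0 \<le> B" using B[of 0] order_trans[OF norm_ge_zero, of "g 0" B] by simp
  let ?s = "\<lambda>k. (cmod (tc (mult_op g f) k))\<^sup>2 / kc m k"
  have part: "(\<Sum>k<N. ?s k) \<le> (B * ip_norm V f)\<^sup>2" for N
  proof -
    have "(\<Sum>k<N. ?s k) \<le> (\<Sum>k<N. 1 / kc l k * (cmod (tc (mult_op g f) k))\<^sup>2)"
      using V.kc_gt_0 W.kc_gt_0 kc_mono[of l m] V.l lm by (intro sum_mono) (simp add: frac_le)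
    also have "\<dots> \<le> (\<Sum>k<N. 1 / kc l k * (B\<^sup>2 * (cmod (tc f k))\<^sup>2))"
    proof (rule weighted_sum_le)
      show "(\<Sum>k<N. (cmod (tc (mult_op g f) k))\<^sup>2) \<le> (\<Sum>k<N. B\<^sup>2 * (cmod (tc f k))\<^sup>2)" for N
        using Hardy_partial_sums[OF g B fh] by (simp add: mult_op_def sum_distrib_left)
      show "0 \<le> 1 / kc l k" for k using V.kc_gt_0[of k] by simp
      show "1 / kc l (Suc k) \<le> 1 / kc l k" for k
        using V.kc_gt_0 kc_le_Suc[OF V.l, of k] by (intro frac_le) auto
    qed
    also have "\<dots> = B\<^sup>2 * (\<Sum>k<N. (cmod (tc f k))\<^sup>2 / kc l k)"
      by (simp add: sum_distrib_left mult_ac)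
    also have "\<dots> \<le> B\<^sup>2 * (ip_norm V f)\<^sup>2"
    proof (rule mult_left_mono)
      show "(\<Sum>k<N. (cmod (tc f k))\<^sup>2 / kc l k) \<le> (ip_norm V f)\<^sup>2"
        using V.norm_sub_psum_sq[OF f, of N] by (metis diff_ge_0_iff_ge zero_le_power2)
    qed simp
    finally show ?thesis by (simp add: power_mult_distrib)
  qed
  have s0: "0 \<le> ?s k" for k using W.kc_gt_0[of k] by simp
  have sm: "summable ?s"
    using part[of "Suc _"] by (intro bounded_imp_summable[OF s0]) (simp add: lessThan_Suc_atMost)
  show mem: "mult_op g f \<in> carr W"
    by (rule W.memI[OF gf _ sm]) (simp add: mult_op_def V.vanish[OF f])
  have "(ip_norm W (mult_op g f))\<^sup>2 \<le> (B * ip_norm V f)\<^sup>2"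
    using W.norm_sq_sums[OF mem] part unfolding sums_def
    by (intro LIMSEQ_le_const2[of "\<lambda>N. \<Sum>k<N. ?s k"]) auto
  then show "ip_norm W (mult_op g f) \<le> B * ip_norm V f"
    by (rule power2_le_imp_le) (use B0 V.norm_nonneg[OF f] in simp)
qed

corollary mult_op_bounded:
  assumes "disc_space V l" "disc_space W m" "l \<le> m" "hinf g"
  shows "bounded_op V W (mult_op g)"
proof -
  obtain B where B: "\<And>z. cmod z < 1 \<Longrightarrow> cmod (g z) \<le> B" and g: "g holomorphic_on ball 0 1"
    using assms(4) unfolding hinf_def by (meson mem_ball_0)
  show ?thesis
    unfolding bounded_op_def
    using mult_op_bound[OF assms(1-3) g B]
    by (auto simp: mult_op_def fun_eq_iff algebra_simps)
qed

subsection \<open>The algebra of bounded analytic functions\<close>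

lemma hinf_holD: "hinf g \<Longrightarrow> g holomorphic_on ball 0 1"
  by (simp add: hinf_def)

lemma hinf_const [intro]: "hinf (\<lambda>z. c)"
  by (auto simp: hinf_def)

lemma hinf_ident [intro]: "hinf (\<lambda>z. z)"
  by (auto simp: hinf_def intro!: exI[of _ 1])

lemma hinf_add [intro]: "hinf f \<Longrightarrow> hinf g \<Longrightarrow> hinf (\<lambda>z. f z + g z)"
  unfolding hinf_def by (auto intro!: holomorphic_intros) (meson add_mono norm_triangle_le mem_ball_0)

lemma hinf_mult [intro]: "hinf f \<Longrightarrow> hinf g \<Longrightarrow> hinf (\<lambda>z. f z * g z)"
proof -
  assume f: "hinf f" and g: "hinf g"
  obtain A B where "\<And>z. z \<in> ball 0 1 \<Longrightarrow> cmod (f z) \<le> A" "\<And>z. z \<in> ball 0 1 \<Longrightarrow> cmod (g z) \<le> B"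
    using f g unfolding hinf_def by blast
  then have "cmod (f z * g z) \<le> A * B" if "z \<in> ball 0 1" for z
    using that order_trans[OF norm_ge_zero, of "f z" A] unfolding norm_mult by (intro mult_mono) auto
  then have "\<exists>C. \<forall>z\<in>ball 0 1. cmod (f z * g z) \<le> C" by blast
  then show ?thesis using f g unfolding hinf_def by (auto intro!: holomorphic_intros)
qed

lemma hinf_sum [intro]: "(\<And>k. k \<in> A \<Longrightarrow> hinf (f k)) \<Longrightarrow> hinf (\<lambda>z. \<Sum>k\<in>A. f k z)"
  by (induction A rule: infinite_finite_induct) auto

lemma hinf_uminus [intro]: "hinf f \<Longrightarrow> hinf (\<lambda>z. - f z)"
  using hinf_mult[OF hinf_const[of "-1"], of f] by simp

lemma hinf_cong: "(\<And>z. z \<in> ball 0 1 \<Longrightarrow> f z = g z) \<Longrightarrow> hinf f \<longleftrightarrow> hinf g"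
  unfolding hinf_def by (metis (no_types, lifting) holomorphic_cong)

lemma hinf_compose:
  assumes "hinf f" "u holomorphic_on ball 0 1" "\<And>z. z \<in> ball 0 1 \<Longrightarrow> u z \<in> ball 0 1"
  shows "hinf (\<lambda>z. f (u z))"
  using assms holomorphic_on_compose_gen[of u "ball 0 1" f "ball 0 1"]
  unfolding hinf_def o_def by (metis image_subsetI)

lemma hinf_inverse:
  assumes f: "f holomorphic_on ball 0 1" and d: "d > 0" "\<And>z. z \<in> ball 0 1 \<Longrightarrow> d \<le> cmod (f z)"
  shows "hinf (\<lambda>z. 1 / f z)"
proof -
  have f0: "f z \<noteq> 0" if "z \<in> ball 0 1" for z using d(1) d(2)[OF that] by auto
  have "cmod (1 / f z) \<le> 1 / d" if "z \<in> ball 0 1" for z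
    using d(1) d(2)[OF that] by (simp add: norm_divide frac_le)
  then have "\<exists>B. \<forall>z\<in>ball 0 1. cmod (1 / f z) \<le> B" by blast
  then show ?thesis using f f0 unfolding hinf_def by (auto intro!: holomorphic_intros)
qed

lemma hinf_of_continuous:
  assumes "f holomorphic_on ball 0 1" "continuous_on (cball 0 1) f"
  shows "hinf f"
proof -
  have "bounded (f ` cball 0 1)"
    using assms by (intro compact_imp_bounded compact_continuous_image) auto
  then obtain B where "\<And>z. z \<in> cball 0 1 \<Longrightarrow> cmod (f z) \<le> B" unfolding bounded_iff by blast
  then show ?thesis using assms(1) by (auto simp: hinf_def intro!: exI[of _ B])
qed

lemma hinf_inverse_of_continuous:
  assumes "f holomorphic_on ball 0 1" "continuous_on (cball 0 1) f" "\<And>z. z \<in> cball 0 1 \<Longrightarrow> f z \<noteq> 0"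
  shows "hinf (\<lambda>z. 1 / f z)"
  using assms
  by (intro hinf_of_continuous holomorphic_intros continuous_intros) auto


section \<open>Composition with disc automorphisms\<close>

lemma hilbert_sp_transport:
  fixes U :: "'a::complex_vector \<Rightarrow> 'b::complex_vector"
  assumes V: "hilbert_sp V"
    and add: "\<And>x y. x \<in> carr V \<Longrightarrow> y \<in> carr V \<Longrightarrow> U (x + y) = U x + U y"
    and scale: "\<And>c x. x \<in> carr V \<Longrightarrow> U (c *\<^sub>C x) = c *\<^sub>C U x"
    and inv: "\<And>x. x \<in> carr V \<Longrightarrow> Ui (U x) = x"
  shows "hilbert_sp \<lparr>carr = U ` carr V, ip = (\<lambda>f g. ip V (Ui f) (Ui g))\<rparr>" (is "hilbert_sp ?W")
proof -
  interpret V: hilbert_sp V by fact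
  have U0: "U 0 = 0" using scale[of 0 0] by simp
  have diff: "U (x - y) = U x - U y" if "x \<in> carr V" "y \<in> carr V" for x y
    using add[of x "- y"] scale[of y "-1"] that by (simp add: scaleC_minus_one)
  have mem: "U x + U y \<in> U ` carr V" "c *\<^sub>C U x \<in> U ` carr V" if "x \<in> carr V" "y \<in> carr V" for x y c
    using that V.add_mem V.scale_mem by (simp_all flip: add scale)
  have inv_add: "Ui (U x + U y) = x + y" if "x \<in> carr V" "y \<in> carr V" for x y
    using inv[of "x + y"] add that by simp
  have inv_scale: "Ui (c *\<^sub>C U x) = c *\<^sub>C x" if "x \<in> carr V" for x c
    using inv[of "c *\<^sub>C x"] scale that by simp
  have "inner_product_space ?W"
    unfolding inner_product_space_def csubspace_def
  proof (intro conjI ballI allI impI; (simp only: ip_space.simps)?)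
    show "0 \<in> U ` carr V" using U0 V.zero_mem by (metis image_eqI)
    show "Re (ip V (Ui f) (Ui f)) > 0" if "f \<in> U ` carr V" "f \<noteq> 0" for f
      using that U0 by (auto simp: inv intro!: V.ip_pos)
    show "ip V (Ui g) (Ui f) = cnj (ip V (Ui f) (Ui g))" if "f \<in> U ` carr V" "g \<in> U ` carr V" for f g
      using that by (auto simp: inv V.ip_cnj)
  qed (auto simp: mem inv inv_add inv_scale V.ip_add_left V.ip_scale_left)
  then interpret W: ip_sp ?W by unfold_locales
  have normW: "ip_norm ?W (U x) = ip_norm V x" if "x \<in> carr V" for x
    using that by (simp add: ip_norm_def inv)
  show ?thesis
  proof
    fix X :: "nat \<Rightarrow> 'b"
    assume X: "\<And>k. X k \<in> carr ?W"
      and cauchy: "\<And>e. e > 0 \<Longrightarrow> \<exists>N. \<forall>k\<ge>N. \<forall>m\<ge>N. ip_norm ?W (X k - X m) < e"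
    obtain x where x: "\<And>k. x k \<in> carr V" "\<And>k. X k = U (x k)" using X by (simp add: image_iff) metis
    have "ip_norm ?W (X k - X m) = ip_norm V (x k - x m)" for k m
      using normW[of "x k - x m"] x by (simp add: diff)
    then obtain y where y: "y \<in> carr V" "(\<lambda>k. ip_norm V (x k - y)) \<longlonglongrightarrow> 0"
      using V.complete[of x, OF x(1)] cauchy by auto
    have "ip_norm ?W (X k - U y) = ip_norm V (x k - y)" for k
      using normW[of "x k - y"] x y by (simp add: diff)
    then show "\<exists>x\<in>carr ?W. (\<lambda>k. ip_norm ?W (X k - x)) \<longlonglongrightarrow> 0"
      using y by (intro bexI[of _ "U y"]) auto
  qed
qed

text \<open>
  The kernel determines the space and its norm, as membership and norm are expressed by Taylor
  coefficients and the weights of the kernel alone.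
\<close>

lemma disc_space_unique:
  assumes "disc_space V l" "disc_space W l" "f \<in> carr V"
  shows "f \<in> carr W" "ip_norm W f = ip_norm V f"
proof -
  interpret V: disc_space V l by fact
  interpret W: disc_space W l by fact
  show W: "f \<in> carr W"
    by (rule W.memI[OF V.hol V.vanish V.summable_tc]) (use assms in auto)
  have "(ip_norm W f)\<^sup>2 = (ip_norm V f)\<^sup>2"
    using V.norm_sq_sums[OF assms(3)] W.norm_sq_sums[OF W] by (rule sums_unique2[symmetric])
  then show "ip_norm W f = ip_norm V f"
    using V.norm_nonneg[OF assms(3)] W.norm_nonneg[OF W] by (simp add: power2_eq_iff_nonneg)
qed

lemma one_minus_nonzero: "cmod x < 1 \<Longrightarrow> 1 - x \<noteq> 0"
  by auto

lemma norm_mult_cnj_less: "cmod z < 1 \<Longrightarrow> cmod w \<le> 1 \<Longrightarrow> cmod (z * cnj w) < 1"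
  unfolding norm_mult complex_mod_cnj
  by (metis le_less_trans mult.right_neutral mult_left_mono norm_ge_zero)

lemma norm_cnj_mult_less: "cmod b < 1 \<Longrightarrow> cmod z \<le> 1 \<Longrightarrow> cmod (cnj b * z) < 1"
  using norm_mult_cnj_less[of "cnj b" "cnj z"] by simp

text \<open>
  The principal logarithms add up exactly, because each of the four arguments lies in
  \<open>(-\<pi>/2, \<pi>/2)\<close>, so that no multiple of \<open>2 \<pi>\<close> fits in between.
\<close>

lemma powr_right_half_plane:
  assumes a: "Re a1 > 0" "Re a2 > 0" "Re a3 > 0" "Re a4 > 0" and s: "s > (0::real)"
    and eq: "a1 * a2 * a3 = of_real s * a4"
  shows "a1 powr x * a2 powr x * a3 powr x = of_real s powr x * a4 powr x"
proof -
  have nz: "a1 \<noteq> 0" "a2 \<noteq> 0" "a3 \<noteq> 0" "a4 \<noteq> 0" using a by auto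
  define F where "F = Ln a1 + Ln a2 + Ln a3 - Ln (of_real s) - Ln a4"
  have "exp F = 1"
    using eq nz s by (simp add: F_def exp_add exp_diff field_simps)
  then obtain n :: int where n: "Im F = of_int (2 * n) * pi" "Re F = 0"
    using exp_eq_1 by blast
  have "\<bar>Im (Ln a1)\<bar> < pi / 2" "\<bar>Im (Ln a2)\<bar> < pi / 2" "\<bar>Im (Ln a3)\<bar> < pi / 2" "\<bar>Im (Ln a4)\<bar> < pi / 2"
    using Re_Ln_pos_lt a nz by blast+
  moreover have "Im (Ln (of_real s)) = 0" using s by simp
  ultimately have "\<bar>Im F\<bar> < 2 * pi" unfolding F_def by simp
  then have "\<bar>of_int n * (2 * pi)\<bar> < 1 * (2 * pi)" using n by (simp add: mult_ac)
  then have "n = 0" unfolding abs_mult by (simp add: mult_less_cancel_right)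
  then have "F = 0" using n by (simp add: complex_eq_iff)
  then have "Ln a1 + Ln a2 + Ln a3 = Ln (of_real s) + Ln a4" by (simp add: F_def algebra_simps)
  then have "x * Ln a1 + x * Ln a2 + x * Ln a3 = x * Ln (of_real s) + x * Ln a4" by (metis distrib_left)
  then have "exp (x * Ln a1 + x * Ln a2 + x * Ln a3) = exp (x * Ln (of_real s) + x * Ln a4)" by simp
  then show ?thesis using nz s by (simp add: powr_def exp_add)
qed

lemma exp_mult_cnj: "exp (\<i> * of_real t) * cnj (exp (\<i> * of_real t)) = 1"
  using complex_norm_square[of "exp (\<i> * of_real t)"] by (simp add: norm_exp_eq_Re)

text \<open>Raised to the power \<open>-l\<close>, this expresses the kernel at \<open>(u z, u w)\<close> by the kernel at \<open>(z, w)\<close>.\<close>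

lemma Moebius_kernel_identity:
  fixes t :: real
  assumes b: "cmod b < 1" and z: "cmod z < 1" and w: "cmod w < 1"
  defines "u \<equiv> Moebius_function t b"
  shows "(1 - u z * cnj (u w)) * (1 - cnj b * z) * (1 - b * cnj w) = of_real (1 - (cmod b)\<^sup>2) * (1 - z * cnj w)"
proof -
  have n1: "1 - cnj b * z \<noteq> 0" using norm_cnj_mult_less[OF b, of z] z by (intro one_minus_nonzero) auto
  have n2: "1 - b * cnj w \<noteq> 0" using norm_mult_cnj_less[OF b, of w] w by (intro one_minus_nonzero) auto
  note e = exp_mult_cnj[of t]
  have "u z * cnj (u w) = (exp (\<i> * of_real t) * cnj (exp (\<i> * of_real t))) * (z - b) * cnj (w - b) / ((1 - cnj b * z) * (1 - b * cnj w))"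
    by (simp add: u_def Moebius_function_def mult_ac)
  then have uu: "u z * cnj (u w) = (z - b) * cnj (w - b) / ((1 - cnj b * z) * (1 - b * cnj w))"
    unfolding e by simp
  have "(1 - u z * cnj (u w)) * ((1 - cnj b * z) * (1 - b * cnj w))
      = (1 - cnj b * z) * (1 - b * cnj w) - (z - b) * cnj (w - b)"
    unfolding uu left_diff_distrib using n1 n2 by simp
  also have "\<dots> = (1 - b * cnj b) * (1 - z * cnj w)"
    by (simp add: algebra_simps)
  also have "1 - b * cnj b = of_real (1 - (cmod b)\<^sup>2)" by (simp add: complex_norm_square del: of_real_power)
  finally show ?thesis by (simp add: mult.assoc)
qed

lemma Moebius_inverse:
  assumes b: "cmod b < 1" and z: "cmod z < 1"
  shows "Moebius_function (- t) (- exp (\<i> * of_real t) * b) (Moebius_function t b z) = z"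
proof -
  let ?e = "exp (\<i> * of_real t)"
  have n1: "1 - cnj b * z \<noteq> 0" using norm_cnj_mult_less[OF b, of z] z by (intro one_minus_nonzero) auto
  have n2: "1 - b * cnj b \<noteq> 0" using norm_mult_cnj_less[OF b, of b] b by (intro one_minus_nonzero) auto
  have e: "exp (\<i> * of_real (- t)) * ?e = 1" "cnj ?e * ?e = 1"
    using exp_mult_cnj[of t] by (simp_all add: mult.commute flip: exp_add)
  define y where "y = (z - b) / (1 - cnj b * z)"
  have "Moebius_function t b z = ?e * y" by (simp add: Moebius_function_def y_def)
  then have "Moebius_function (- t) (- ?e * b) (Moebius_function t b z)
      = exp (\<i> * of_real (- t)) * (?e * y - - ?e * b) / (1 - cnj (- ?e * b) * (?e * y))"
    by (simp only: Moebius_function_def)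
  also have "exp (\<i> * of_real (- t)) * (?e * y - - ?e * b) = (exp (\<i> * of_real (- t)) * ?e) * (y + b)"
    by (simp only: algebra_simps) simp
  also have "1 - cnj (- ?e * b) * (?e * y) = 1 + cnj b * (cnj ?e * ?e) * y"
    by simp
  also have "(exp (\<i> * of_real (- t)) * ?e) * (y + b) / (1 + cnj b * (cnj ?e * ?e) * y) = (y + b) / (1 + cnj b * y)"
    unfolding e by simp
  also have "y + b = z * (1 - b * cnj b) / (1 - cnj b * z)"
    unfolding y_def using n1 by (simp add: field_simps)
  also have "1 + cnj b * y = (1 - b * cnj b) / (1 - cnj b * z)"
    unfolding y_def using n1 by (simp add: field_simps)
  finally show ?thesis using n1 n2 by simp
qed

lemma Moebius_mutually_inverse:
  fixes t :: real
  assumes b: "cmod b < 1"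
  defines "b' \<equiv> - exp (\<i> * of_real t) * b"
  shows "cmod b' < 1"
    and "cmod z < 1 \<Longrightarrow> Moebius_function (- t) b' (Moebius_function t b z) = z"
    and "cmod z < 1 \<Longrightarrow> Moebius_function t b (Moebius_function (- t) b' z) = z"
proof -
  show b': "cmod b' < 1" using b by (simp add: b'_def norm_mult norm_exp_eq_Re)
  show "cmod z < 1 \<Longrightarrow> Moebius_function (- t) b' (Moebius_function t b z) = z"
    unfolding b'_def by (rule Moebius_inverse[OF b])
  assume z: "cmod z < 1"
  have "Moebius_function (- (- t)) (- exp (\<i> * of_real (- t)) * b') (Moebius_function (- t) b' z) = z"
    by (rule Moebius_inverse[OF b' z])
  moreover have "- exp (\<i> * of_real (- t)) * b' = (exp (\<i> * of_real (- t)) * exp (\<i> * of_real t)) * b"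
    by (simp add: b'_def)
  moreover have "exp (\<i> * of_real (- t)) * exp (\<i> * of_real t) = 1" by (simp flip: exp_add)
  ultimately show "Moebius_function t b (Moebius_function (- t) b' z) = z" by (simp only: minus_minus mult_1)
qed

definition comp_op :: "(complex \<Rightarrow> complex) \<Rightarrow> (complex \<Rightarrow> complex) \<Rightarrow> complex \<Rightarrow> complex" where
  "comp_op u f = dfun (\<lambda>z. f (u z))"

text \<open>
  For \<open>u\<close> a disc automorphism the weighted composition \<open>U f = \<kappa> (f \<circ> u)\<close> is isometric:
  transporting the inner product along \<open>U\<close> gives a Hilbert space of analytic functions with the same
  reproducing kernel, hence the same space with the same norm.  The weight \<open>\<kappa>\<close> is bounded below,
  and dividing by it leaves plain composition.
\<close>

theorem comp_op_bounded:
  assumes V: "disc_space V l" and b: "cmod b < 1"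
  shows "bounded_op V V (comp_op (Moebius_function t b))"
proof -
  interpret V: disc_space V l by fact
  define u where "u = Moebius_function t b"
  define ui where "ui = Moebius_function (- t) (- exp (\<i> * of_real t) * b)"
  note inverse = Moebius_mutually_inverse[OF b, where t = t]
  have u1: "cmod (u z) < 1" and ui1: "cmod (ui z) < 1" and uui: "u (ui z) = z"
    if "cmod z < 1" for z
    using Moebius_function_norm_lt_1[OF b that] Moebius_function_norm_lt_1[OF inverse(1) that] inverse(2,3)[OF that]
    by (simp_all add: u_def ui_def)
  have u_hol: "u holomorphic_on ball 0 1" unfolding u_def by (rule Moebius_function_holomorphic[OF b])
  have fu_hol: "(\<lambda>z. f (u z)) holomorphic_on ball 0 1" if "f holomorphic_on ball 0 1" for f
    using holomorphic_on_compose_gen[OF u_hol that] u1 by (simp add: o_def image_subset_iff)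
  have Re_pos: "Re (1 - x) > 0" if "cmod x < 1" for x
    using complex_Re_le_cmod[of x] that by simp
  have bz: "cmod (cnj b * z) < 1" if "cmod z \<le> 1" for z
    by (rule norm_cnj_mult_less[OF b that])
  have b2: "1 - (cmod b)\<^sup>2 > 0" using b by (simp add: abs_square_less_1)

  \<comment> \<open>the weight, with its modulus normalised so that the kernel is reproduced exactly\<close>
  define c where "c = sqrt ((1 - (cmod b)\<^sup>2) powr l)"
  have c0: "c > 0" using b2 by (simp add: c_def)
  define \<kappa> where "\<kappa> z = of_real c / (1 - cnj b * z) powr (of_real l)" for z
  have \<kappa>0: "\<kappa> z \<noteq> 0" if "cmod z < 1" for z
    using one_minus_nonzero[OF bz[of z]] c0 that by (simp add: \<kappa>_def powr_def)
  have \<kappa>_hol: "\<kappa> holomorphic_on ball 0 1"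
  proof -
    have "1 - cnj b * z \<notin> \<real>\<^sub>\<le>\<^sub>0" if "z \<in> ball 0 1" for z
      using Re_pos[OF bz[of z]] that by (auto simp: complex_nonpos_Reals_iff)
    then show ?thesis
      unfolding \<kappa>_def using \<kappa>0[unfolded \<kappa>_def] c0
      by (intro holomorphic_intros) auto
  qed
  have kernel: "\<kappa> z * cnj (\<kappa> w) * disc_kernel l (u z) (u w) = disc_kernel l z w"
    if z: "cmod z < 1" and w: "cmod w < 1" for z w
  proof -
    let ?x = "complex_of_real l"
    let ?a1 = "1 - u z * cnj (u w)" and ?a2 = "1 - cnj b * z" and ?a3 = "1 - b * cnj w" and ?a4 = "1 - z * cnj w"
    have pos: "Re ?a1 > 0" "Re ?a2 > 0" "Re ?a3 > 0" "Re ?a4 > 0"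
      using Re_pos norm_mult_cnj_less bz b u1[OF z] u1[OF w] z w by (meson less_imp_le)+
    have "?a1 * ?a2 * ?a3 = of_real (1 - (cmod b)\<^sup>2) * ?a4"
      using Moebius_kernel_identity[OF b z w, of t] by (simp only: u_def)
    from powr_right_half_plane[OF pos b2 this, of ?x]
    have p: "?a1 powr ?x * ?a2 powr ?x * ?a3 powr ?x = of_real (1 - (cmod b)\<^sup>2) powr ?x * ?a4 powr ?x" .
    have "of_real (1 - (cmod b)\<^sup>2) powr ?x = of_real (c\<^sup>2)"
      using b2 by (simp only: c_def real_sqrt_pow2 powr_ge_zero powr_of_real less_imp_le)
    then have p: "?a1 powr ?x * ?a2 powr ?x * ?a3 powr ?x = of_real c * of_real c * ?a4 powr ?x"
      using p by (simp add: power2_eq_square)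
    have nz: "?a1 powr ?x \<noteq> 0" "?a2 powr ?x \<noteq> 0" "?a3 powr ?x \<noteq> 0" "?a4 powr ?x \<noteq> 0"
    proof -
      have "x powr ?x \<noteq> 0" if "Re x > 0" for x using that by (auto simp: powr_def)
      then show "?a1 powr ?x \<noteq> 0" "?a2 powr ?x \<noteq> 0" "?a3 powr ?x \<noteq> 0" "?a4 powr ?x \<noteq> 0"
        using pos by blast+
    qed
    have "cnj (\<kappa> w) = of_real c / ?a3 powr ?x"
    proof -
      have "1 - cnj b * w \<notin> \<real>\<^sub>\<le>\<^sub>0" using Re_pos[OF bz[of w]] w by (auto simp: complex_nonpos_Reals_iff)
      then have "cnj ((1 - cnj b * w) powr ?x) = ?a3 powr ?x"
        by (subst cnj_powr) (auto simp: complex_nonpos_Reals_iff)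
      then show ?thesis by (simp add: \<kappa>_def)
    qed
    moreover have "p / y2 * (p / y3) * (1 / y1) = p * p / (y1 * y2 * y3)" for p y1 y2 y3 :: complex
      by (simp add: mult_ac)
    ultimately have "\<kappa> z * cnj (\<kappa> w) * disc_kernel l (u z) (u w)
        = of_real c * of_real c / (?a1 powr ?x * ?a2 powr ?x * ?a3 powr ?x)"
      by (simp only: \<kappa>_def[of z] disc_kernel_def)
    also have "\<dots> = 1 / ?a4 powr ?x" unfolding p using c0 by simp
    finally show ?thesis by (simp add: disc_kernel_def)
  qed

  define U where "U f = dfun (\<lambda>z. \<kappa> z * f (u z))" for f
  define Ui where "Ui g = dfun (\<lambda>z. g (ui z) / \<kappa> (ui z))" for g
  have UiU: "Ui (U f) = f" if "f \<in> carr V" for f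
    using V.vanish[OF that] ui1 uui \<kappa>0 by (auto simp: Ui_def U_def dfun_def fun_eq_iff)
  define W where "W = \<lparr>carr = U ` carr V, ip = (\<lambda>f g. ip V (Ui f) (Ui g))\<rparr>"
  have W_h: "hilbert_sp W"
    unfolding W_def
    by (rule hilbert_sp_transport[OF V.hilbert_sp_axioms])
       (use UiU in \<open>auto simp: U_def dfun_def fun_eq_iff algebra_simps\<close>)
  have W: "disc_space W l"
  proof -
    interpret W: hilbert_sp W by fact
    have kern: "dfun (\<lambda>z. disc_kernel l z w) = U (cnj (\<kappa> w) *\<^sub>C V.kern (u w))" if "cmod w < 1" for w
      using kernel that u1 by (auto simp: U_def dfun_def fun_eq_iff mult_ac)
    have km: "cnj (\<kappa> w) *\<^sub>C V.kern (u w) \<in> carr V" if "cmod w < 1" for w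
      using V.kern_mem[of "u w"] u1[OF that] by (intro V.scale_mem) auto
    show ?thesis
    proof
      show "1 \<le> l" by (rule V.l)
      show "f z = 0" if "f \<in> carr W" "z \<notin> ball 0 1" for f z
        using that by (auto simp: W_def U_def dfun_def)
      show "f holomorphic_on ball 0 1" if "f \<in> carr W" for f
      proof -
        obtain g where g: "g \<in> carr V" "f = U g" using \<open>f \<in> carr W\<close> by (auto simp: W_def)
        have "(\<lambda>z. \<kappa> z * g (u z)) holomorphic_on ball 0 1"
          by (intro holomorphic_intros \<kappa>_hol fu_hol V.hol g)
        then show ?thesis by (rule holomorphic_transform) (simp add: g(2) U_def dfun_def)
      qed
      show "dfun (\<lambda>z. disc_kernel l z w) \<in> carr W" if "w \<in> ball 0 1" for w
        using kern km that by (simp add: W_def)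
      show "ip W f (dfun (\<lambda>z. disc_kernel l z w)) = f w" if w: "w \<in> ball 0 1" and f: "f \<in> carr W" for w f
      proof -
        obtain g where g: "g \<in> carr V" "f = U g" using f by (auto simp: W_def)
        have "ip W f (dfun (\<lambda>z. disc_kernel l z w)) = ip V g (cnj (\<kappa> w) *\<^sub>C V.kern (u w))"
          using kern[of w] km[of w] w g by (simp add: W_def UiU)
        also have "\<dots> = \<kappa> w * g (u w)"
          using u1[of w] w g by (simp add: V.ip_scale_right V.kern_mem V.kern_ip)
        finally show ?thesis using g w by (simp add: U_def dfun_def)
      qed
    qed
  qed
  have U_mem: "U f \<in> carr V" and U_norm: "ip_norm V (U f) = ip_norm V f" if f: "f \<in> carr V" for f
  proof -
    have UW: "U f \<in> carr W" using f by (simp add: W_def)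
    have "ip_norm W (U f) = ip_norm V f" using f by (simp add: W_def ip_norm_def UiU)
    then show "U f \<in> carr V" "ip_norm V (U f) = ip_norm V f"
      using disc_space_unique[OF W V UW] by simp_all
  qed

  define g where "g z = (1 - cnj b * z) powr (of_real l) / of_real c" for z
  have g: "hinf g"
  proof (rule hinf_of_continuous)
    have "1 - cnj b * z \<notin> \<real>\<^sub>\<le>\<^sub>0" if "z \<in> cball 0 1" for z
      using Re_pos[OF bz[of z]] that by (auto simp: complex_nonpos_Reals_iff)
    then show "g holomorphic_on ball 0 1"
      unfolding g_def using c0 by (intro holomorphic_intros) auto
    have "continuous_on (cball 0 1) (\<lambda>z. (1 - cnj b * z) powr (of_real l))"
    proof (rule continuous_on_powr_complex)
      have "0 \<le> Re (1 - cnj b * z)" if "z \<in> cball 0 1" for z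
        using Re_pos[OF bz[of z]] that by simp
      then show "cball 0 1 \<subseteq> {z. 0 \<le> Re (1 - cnj b * z) \<or> Im (1 - cnj b * z) \<noteq> 0}" by blast
      show "0 < Re (complex_of_real l)" using V.l by simp
    qed (intro continuous_intros)+
    then show "continuous_on (cball 0 1) g"
      unfolding g_def by (rule continuous_on_divide[OF _ continuous_on_const]) (use c0 in auto)
  qed
  have eq: "comp_op u f = mult_op g (U f)" for f
  proof
    fix z show "comp_op u f z = mult_op g (U f) z"
      using one_minus_nonzero[OF bz[of z]] c0
      by (auto simp: comp_op_def mult_op_def U_def dfun_def g_def \<kappa>_def powr_def)
  qed
  have "bounded_op V V U"
    unfolding bounded_op_def using U_mem U_norm
    by (auto simp: U_def dfun_def fun_eq_iff algebra_simps intro!: exI[of _ 1])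
  from bounded_op_compose[OF V.ip_sp_axioms V.ip_sp_axioms this mult_op_bounded[OF V V order_refl g]]
  show ?thesis by (simp add: eq[symmetric, unfolded u_def] u_def)
qed


section \<open>Operators that almost commute with multiplication by \<open>z\<close>\<close>

abbreviation zmul :: "(complex \<Rightarrow> complex) \<Rightarrow> complex \<Rightarrow> complex" where
  "zmul \<equiv> mult_op (\<lambda>z. z)"

lemma tc_shift:
  assumes "f holomorphic_on ball 0 1"
  shows "tc (\<lambda>z. z ^ q * f z) j = (if j < q then 0 else tc f (j - q))"
proof -
  have "tc (\<lambda>z. z ^ q * f z) j = (\<Sum>i\<le>j. tc (\<lambda>z. z ^ q) i * tc f (j - i))"
    by (rule tc_mult[OF _ assms]) (intro holomorphic_intros)
  also have "\<dots> = (\<Sum>i\<le>j. if i = q then tc f (j - i) else 0)"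
    by (intro sum.cong) (auto simp: tc_monomial)
  finally show ?thesis by simp
qed

text \<open>
  On monomials \<open>X z\<^sup>n = z\<^sup>n x + n z\<^sup>n\<^sup>-\<^sup>1 \<eta>\<close>: up to a multiplication operator, \<open>X\<close> is \<open>f \<mapsto> \<eta> f'\<close>.
  Differentiation raises the index of the space by exactly \<open>2\<close>, so for \<open>m < a + 2\<close> boundedness leaves
  no room for a coefficient of \<open>\<eta>\<close>: the coefficient \<open>c\<close> of \<open>z\<^sup>p\<close> in \<open>\<eta>\<close> contributes
  \<open>n c\<close> to the coefficient of \<open>X z\<^sup>n\<close> at \<open>z\<^sup>n\<^sup>+\<^sup>p\<^sup>-\<^sup>1\<close>, and the weights are of order \<open>n\<^sup>a\<^sup>-\<^sup>1\<close> and \<open>n\<^sup>m\<^sup>-\<^sup>1\<close>.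
\<close>

theorem commutator_multiplication_eq_zero:
  assumes V: "disc_space V a" and W: "disc_space W m" and am: "m < a + 2"
    and X: "bounded_op V W X" and \<eta>: "\<eta> holomorphic_on ball 0 1"
    and comm: "\<And>f. f \<in> carr V \<Longrightarrow> X (zmul f) = zmul (X f) + mult_op \<eta> f"
    and w: "cmod w < 1"
  shows "\<eta> w = 0"
proof (rule holomorphic_eq_zero_if_tc_zero[OF \<eta> _ w])
  interpret V: disc_space V a by fact
  interpret W: disc_space W m by fact
  obtain C where C: "C > 0" "\<And>f. f \<in> carr V \<Longrightarrow> ip_norm W (X f) \<le> C * ip_norm V f"
    using bounded_op_bound[OF V.ip_sp_axioms X] by blast
  define x where "x = X (mon 0)"
  have x_hol: "x holomorphic_on ball 0 1"
    unfolding x_def by (intro W.hol bounded_opD(1)[OF X] V.mon_mem)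
  have zm: "mon (Suc k) = zmul (mon k)" for k
    by (auto simp: mult_op_def dfun_def fun_eq_iff)
  have X_mon: "X (mon k) z = z ^ k * x z + of_nat k * (z ^ (k - 1) * \<eta> z)" if z: "cmod z < 1" for k z
  proof (induction k)
    case (Suc k)
    have "X (mon (Suc k)) z = z * X (mon k) z + \<eta> z * z ^ k"
      unfolding zm comm[OF V.mon_mem] using z by (simp add: mult_op_def dfun_def)
    then show ?case unfolding Suc by (cases k) (simp_all add: algebra_simps)
  qed (simp add: x_def)
  fix p
  define c where "c = tc \<eta> p"
  \<comment> \<open>the share of \<open>z\<^sup>n x\<close>, which starts only at \<open>z\<^sup>n\<close> and so misses the coefficient in question for \<open>p = 0\<close>\<close>
  define d where "d = (if p = 0 then 0 else tc x (p - 1))"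
  have coeff: "tc (X (mon n)) (n + p - 1) = of_nat n * c + d" if n: "n \<ge> 1" for n
  proof -
    have "tc (X (mon n)) (n + p - 1) = tc (\<lambda>z. z ^ n * x z + of_nat n * (z ^ (n - 1) * \<eta> z)) (n + p - 1)"
      by (intro tc_cong X_mon holomorphic_intros x_hol \<eta>)
    also have "\<dots> = tc (\<lambda>z. z ^ n * x z) (n + p - 1) + of_nat n * tc (\<lambda>z. z ^ (n - 1) * \<eta> z) (n + p - 1)"
      by (subst tc_add, intro holomorphic_intros x_hol \<eta>, intro holomorphic_intros x_hol \<eta>,
          subst tc_cmult, intro holomorphic_intros x_hol \<eta>) simp
    also have "\<dots> = of_nat n * c + d"
      using n by (cases p) (auto simp: tc_shift x_hol \<eta> c_def d_def)
    finally show ?thesis .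
  qed
  have ineq: "(cmod (of_nat n * c + d))\<^sup>2 * kc a n \<le> C\<^sup>2 * kc m (n + p)" if n: "n \<ge> 1" for n
  proof -
    have Xm: "X (mon n) \<in> carr W" by (intro bounded_opD(1)[OF X] V.mon_mem)
    have "(cmod (of_nat n * c + d))\<^sup>2 / kc m (n + p - 1) \<le> (ip_norm W (X (mon n)))\<^sup>2"
    proof -
      let ?s = "\<lambda>k. (cmod (tc (X (mon n)) k))\<^sup>2 / kc m k"
      have "sum ?s {n + p - 1} \<le> suminf ?s"
        using W.summable_tc[OF Xm] W.kc_gt_0 by (intro sum_le_suminf) (auto simp: less_imp_le)
      then show ?thesis using W.norm_sq_sums[OF Xm] coeff[OF n] by (simp add: sums_iff)
    qed
    also have "\<dots> \<le> (C * ip_norm V (mon n))\<^sup>2"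
      using C(2)[OF V.mon_mem] W.norm_nonneg[OF Xm] by (intro power_mono)
    also have "\<dots> = C\<^sup>2 / kc a n" by (simp add: power_mult_distrib V.norm_mon_sq)
    finally have "(cmod (of_nat n * c + d))\<^sup>2 * kc a n \<le> C\<^sup>2 * kc m (n + p - 1)"
      using V.kc_gt_0[of n] W.kc_gt_0[of "n + p - 1"] by (simp add: field_simps)
    also have "\<dots> \<le> C\<^sup>2 * kc m (n + p)"
      using kc_le_Suc[OF W.l, of "n + p - 1"] n by (intro mult_left_mono) auto
    finally show ?thesis .
  qed
  have lhs: "(\<lambda>n. (cmod (of_nat n * c + d))\<^sup>2 * kc a n / real n powr (a + 1)) \<longlonglongrightarrow> (cmod c)\<^sup>2 * rGamma a"
  proof -
    have "(\<lambda>n. (cmod (c + d / of_nat n))\<^sup>2 * (kc a n / real n powr (a - 1))) \<longlonglongrightarrow> (cmod (c + 0))\<^sup>2 * rGamma a"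
      using V.l by (intro tendsto_intros kc_asymp lim_const_over_n) auto
    moreover have "\<forall>\<^sub>F n in sequentially. (cmod (c + d / of_nat n))\<^sup>2 * (kc a n / real n powr (a - 1))
        = (cmod (of_nat n * c + d))\<^sup>2 * kc a n / real n powr (a + 1)"
      using eventually_gt_at_top[of 0]
    proof eventually_elim
      case (elim n)
      have "of_nat n * c + d = of_nat n * (c + d / of_nat n)" using elim by (simp add: field_simps)
      then have "cmod (of_nat n * c + d) = real n * cmod (c + d / of_nat n)" by (simp add: norm_mult)
      moreover have "real n powr (a + 1) = real n powr (a - 1) * (real n)\<^sup>2"
        using elim powr_add[of "real n" "a - 1" 2] by (simp add: add.commute)
      ultimately show ?case using elim by (simp add: power_mult_distrib)
    qed
    ultimately show ?thesis by (simp add: tendsto_cong)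
  qed
  have rhs: "(\<lambda>n. C\<^sup>2 * kc m (n + p) / real n powr (a + 1)) \<longlonglongrightarrow> 0"
  proof -
    have "(\<lambda>n. C\<^sup>2 * (kc m (n + p) / real (n + p) powr (m - 1)) * (real (n + p) / real n) powr (m - 1) * real n powr (m - 1 - (a + 1)))
        \<longlonglongrightarrow> C\<^sup>2 * rGamma m * 1 powr (m - 1) * 0"
    proof (intro tendsto_mult tendsto_powr tendsto_const)
      show "(\<lambda>n. kc m (n + p) / real (n + p) powr (m - 1)) \<longlonglongrightarrow> rGamma m"
        using LIMSEQ_ignore_initial_segment[OF kc_asymp, of m p] W.l by simp
      show "(\<lambda>n. real (n + p) / real n) \<longlonglongrightarrow> 1" by real_asymp
      show "(\<lambda>n. real n powr (m - 1 - (a + 1))) \<longlonglongrightarrow> 0"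
        using am by (intro tendsto_neg_powr filterlim_real_sequentially) simp
    qed simp
    moreover have "\<forall>\<^sub>F n in sequentially.
        C\<^sup>2 * (kc m (n + p) / real (n + p) powr (m - 1)) * (real (n + p) / real n) powr (m - 1) * real n powr (m - 1 - (a + 1))
        = C\<^sup>2 * kc m (n + p) / real n powr (a + 1)"
      using eventually_gt_at_top[of 0]
    proof eventually_elim
      case (elim n)
      have "(real (n + p) / real n) powr (m - 1) = real (n + p) powr (m - 1) / real n powr (m - 1)"
        using elim by (simp add: powr_divide)
      moreover have "real n powr (m - 1 - (a + 1)) = real n powr (m - 1) / real n powr (a + 1)"
        using powr_diff by blast
      moreover have "real (n + p) powr (m - 1) \<noteq> 0" "real n powr (m - 1) \<noteq> 0" using elim by auto
      ultimately show ?case by simp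
    qed
    ultimately show ?thesis by (simp add: tendsto_cong)
  qed
  have "(cmod c)\<^sup>2 * rGamma a \<le> 0"
  proof (rule LIMSEQ_le[OF lhs rhs], intro exI[of _ 1] allI impI)
    fix n :: nat assume "1 \<le> n"
    then show "(cmod (of_nat n * c + d))\<^sup>2 * kc a n / real n powr (a + 1) \<le> C\<^sup>2 * kc m (n + p) / real n powr (a + 1)"
      using ineq by (intro divide_right_mono) auto
  qed
  moreover have "rGamma a > 0" using Gamma_real_pos[of a] V.l by (simp add: rGamma_inverse_Gamma)
  ultimately show "tc \<eta> p = 0"
    by (simp add: c_def mult_le_0_iff)
qed

text \<open>On monomials \<open>X z\<^sup>k = z\<^sup>k X 1\<close>, and the Taylor polynomials converge in norm.\<close>

theorem commuting_eq_mult_op: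
  assumes V: "disc_space V a" and W: "disc_space W m" and X: "bounded_op V W X"
    and comm: "\<And>f. f \<in> carr V \<Longrightarrow> X (zmul f) = zmul (X f)" and f: "f \<in> carr V"
  shows "X f = mult_op (X (mon 0)) f"
proof -
  interpret V: disc_space V a by fact
  interpret W: disc_space W m by fact
  define x where "x = X (mon 0)"
  have zm: "mon (Suc k) = zmul (mon k)" for k
    by (auto simp: mult_op_def dfun_def fun_eq_iff)
  have X_mon: "X (mon k) z = z ^ k * x z" for k z
  proof (induction k)
    case (Suc k)
    then show ?case unfolding zm comm[OF V.mon_mem] by (simp add: mult_op_def)
  qed (simp add: x_def)
  have X_psum: "X (V.psum b N) z = V.psum b N z * x z" if "cmod z < 1" for b N z
  proof -
    have "X (V.psum b N) = (\<Sum>k<N. b k *\<^sub>C X (mon k))"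
      unfolding V.psum_def
      by (subst bounded_op_sum[OF V.ip_sp_axioms X]) (auto intro!: sum.cong bounded_opD(3)[OF X] V.mon_mem)
    then show ?thesis
      using that by (simp add: V.psum_apply X_mon sum_fun_apply sum_distrib_right mult.assoc)
  qed
  have "X f z = x z * f z" if z: "cmod z < 1" for z
  proof (rule LIMSEQ_unique)
    have "(\<lambda>N. ip W (X (V.psum (tc f) N)) (W.kern z)) \<longlonglongrightarrow> ip W (X f) (W.kern z)"
      using z f by (intro W.ip_tendsto bounded_op_tendsto[OF V.ip_sp_axioms W.ip_sp_axioms X] V.psum_tendsto W.kern_mem bounded_opD(1)[OF X]) auto
    then show "(\<lambda>N. X (V.psum (tc f) N) z) \<longlonglongrightarrow> X f z"
      using z f bounded_opD(1)[OF X] by (simp add: W.kern_ip)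
    have "(\<lambda>N. (\<Sum>k<N. tc f k * z ^ k) * x z) \<longlonglongrightarrow> f z * x z"
      using tc_sums[OF V.hol[OF f] z] by (intro tendsto_intros) (simp add: sums_def)
    then show "(\<lambda>N. X (V.psum (tc f) N) z) \<longlonglongrightarrow> x z * f z"
      using X_psum[OF z] V.psum_apply[OF z] by (simp add: mult.commute)
  qed
  moreover have "X f z = x z * f z" if "\<not> cmod z < 1" for z
    using that W.vanish[OF bounded_opD(1)[OF X f], of z] V.vanish[OF f, of z] by simp
  ultimately show ?thesis by (auto simp: mult_op_def fun_eq_iff x_def)
qed

text \<open>A multiplier is bounded by its operator norm: test it on the kernel functions.\<close>

lemma multiplier_bounded:
  assumes V: "disc_space V a" and X: "bounded_op V V (mult_op x)"
  shows "\<exists>C. \<forall>z\<in>ball 0 1. cmod (x z) \<le> C"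
proof -
  interpret V: disc_space V a by fact
  obtain C where C: "C > 0" "\<And>f. f \<in> carr V \<Longrightarrow> ip_norm V (mult_op x f) \<le> C * ip_norm V f"
    using bounded_op_bound[OF V.ip_sp_axioms X] by blast
  have "cmod (x z) \<le> C" if z: "z \<in> ball 0 1" for z
  proof -
    let ?k = "V.kern z"
    have km: "?k \<in> carr V" by (rule V.kern_mem[OF z])
    have kz: "?k z = of_real ((ip_norm V ?k)\<^sup>2)"
      using V.kern_ip[OF z km] V.ip_self[OF km] by simp
    have "1 - z * cnj z \<noteq> 0" using z norm_mult_cnj_less[of z z] by (intro one_minus_nonzero) auto
    then have "?k z \<noteq> 0" using z by (auto simp: dfun_def disc_kernel_def powr_def)
    then have pos: "(ip_norm V ?k)\<^sup>2 > 0" using kz by auto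
    have "cmod (x z) * (ip_norm V ?k)\<^sup>2 = cmod (mult_op x ?k z)"
      by (simp add: mult_op_def kz norm_mult del: of_real_power)
    also have "\<dots> \<le> ip_norm V (mult_op x ?k) * ip_norm V ?k"
      using V.pointwise_bound[OF bounded_opD(1)[OF X km]] z by simp
    also have "\<dots> \<le> (C * ip_norm V ?k) * ip_norm V ?k"
      using C(2)[OF km] V.norm_nonneg[OF km] by (rule mult_right_mono)
    finally show ?thesis using pos by (simp add: power2_eq_square mult.assoc mult_le_cancel_right)
  qed
  then show ?thesis by blast
qed


section \<open>Lower triangular matrices of bounded analytic functions\<close>

type_synonym matfun = "nat \<Rightarrow> nat \<Rightarrow> complex \<Rightarrow> complex"

definition lower_tri :: "nat \<Rightarrow> matfun \<Rightarrow> bool" where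
  "lower_tri n F \<longleftrightarrow> (\<forall>i\<in>{1..n}. \<forall>j\<in>{1..n}. hinf (F i j) \<and> (i < j \<longrightarrow> (\<forall>z\<in>ball 0 1. F i j z = 0)))"

definition mat_eq :: "nat \<Rightarrow> matfun \<Rightarrow> matfun \<Rightarrow> bool" where
  "mat_eq n F G \<longleftrightarrow> (\<forall>i\<in>{1..n}. \<forall>j\<in>{1..n}. \<forall>z\<in>ball 0 1. F i j z = G i j z)"

definition mat_mul :: "nat \<Rightarrow> matfun \<Rightarrow> matfun \<Rightarrow> matfun" where
  "mat_mul n F G i j z = (\<Sum>k\<in>{1..n}. F i k z * G k j z)"

definition mat_id :: matfun where
  "mat_id i j z = (if i = j then 1 else 0)"

lemma lower_triD:
  assumes "lower_tri n F" "i \<in> {1..n}" "j \<in> {1..n}"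
  shows "hinf (F i j)" "i < j \<Longrightarrow> z \<in> ball 0 1 \<Longrightarrow> F i j z = 0"
  using assms by (auto simp: lower_tri_def)

lemma lower_tri_id: "lower_tri n mat_id"
proof -
  have "mat_id i j = (\<lambda>z. if i = j then 1 else 0)" for i j by (simp add: mat_id_def fun_eq_iff)
  then show ?thesis by (auto simp: lower_tri_def)
qed

lemma lower_tri_mul:
  assumes "lower_tri n F" "lower_tri n G"
  shows "lower_tri n (mat_mul n F G)"
  unfolding lower_tri_def
proof (intro ballI conjI impI)
  fix i j assume ij: "i \<in> {1..n}" "j \<in> {1..n}"
  show "hinf (mat_mul n F G i j)"
    unfolding mat_mul_def using lower_triD(1)[OF assms(1)] lower_triD(1)[OF assms(2)] ij
    by (intro hinf_sum hinf_mult) auto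
  fix z :: complex assume z: "z \<in> ball 0 1" "i < j"
  have "F i k z * G k j z = 0" if "k \<in> {1..n}" for k
    using lower_triD(2)[OF assms(1) ij(1) that _ z(1)] lower_triD(2)[OF assms(2) that ij(2) _ z(1)] z(2)
    by (cases "i < k") auto
  then show "mat_mul n F G i j z = 0"
    unfolding mat_mul_def by (intro sum.neutral) auto
qed

lemma lower_tri_lincomb:
  assumes "lower_tri n F" "lower_tri n G"
  shows "lower_tri n (\<lambda>i j z. c * F i j z + d * G i j z)"
  unfolding lower_tri_def
proof (intro ballI conjI impI)
  fix i j assume ij: "i \<in> {1..n}" "j \<in> {1..n}"
  show "hinf (\<lambda>z. c * F i j z + d * G i j z)"
    by (intro hinf_add hinf_mult hinf_const lower_triD(1)[OF assms(1) ij] lower_triD(1)[OF assms(2) ij])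
qed (use assms in \<open>simp add: lower_tri_def\<close>)

lemma mat_mul_assoc: "mat_mul n (mat_mul n F G) L i j z = mat_mul n F (mat_mul n G L) i j z"
proof -
  have "mat_mul n (mat_mul n F G) L i j z = (\<Sum>k\<in>{1..n}. \<Sum>m\<in>{1..n}. F i m z * G m k z * L k j z)"
    by (simp add: mat_mul_def sum_distrib_right)
  also have "\<dots> = (\<Sum>m\<in>{1..n}. \<Sum>k\<in>{1..n}. F i m z * G m k z * L k j z)" by (rule sum.swap)
  finally show ?thesis by (simp add: mat_mul_def sum_distrib_left mult.assoc)
qed

lemma mat_mul_id_left: "i \<in> {1..n} \<Longrightarrow> mat_mul n mat_id F i j z = F i j z"
proof -
  assume i: "i \<in> {1..n}"
  have "mat_mul n mat_id F i j z = (\<Sum>k\<in>{1..n}. if k = i then F k j z else 0)"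
    unfolding mat_mul_def mat_id_def by (intro sum.cong) auto
  then show ?thesis using i by simp
qed

lemma mat_mul_id_right: "j \<in> {1..n} \<Longrightarrow> mat_mul n F mat_id i j z = F i j z"
proof -
  assume j: "j \<in> {1..n}"
  have "mat_mul n F mat_id i j z = (\<Sum>k\<in>{1..n}. if k = j then F i k z else 0)"
    unfolding mat_mul_def mat_id_def by (intro sum.cong) auto
  then show ?thesis using j by simp
qed

lemma mat_mul_cong: "mat_eq n F F' \<Longrightarrow> mat_eq n G G' \<Longrightarrow> mat_eq n (mat_mul n F G) (mat_mul n F' G')"
  unfolding mat_eq_def mat_mul_def by (auto intro!: sum.cong)

lemma mat_mul_lower:
  assumes "lower_tri n F" "lower_tri n G" "i \<in> {1..n}" "j \<in> {1..n}" "z \<in> ball 0 1"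
  shows "mat_mul n F G i j z = (\<Sum>k\<in>{j..i}. F i k z * G k j z)"
  unfolding mat_mul_def
proof (rule sum.mono_neutral_right)
  show "\<forall>k\<in>{1..n} - {j..i}. F i k z * G k j z = 0"
  proof
    fix k assume k: "k \<in> {1..n} - {j..i}"
    then have "i < k \<or> k < j" by auto
    then show "F i k z * G k j z = 0"
      using lower_triD(2)[OF assms(1,3) _ _ assms(5), of k] lower_triD(2)[OF assms(2) _ assms(4) _ assms(5), of k] k
      by auto
  qed
qed (use assms in auto)

subsection \<open>Inverses\<close>

text \<open>Forward substitution for the columns of the right inverse of a lower triangular matrix.\<close>

fun fsub :: "matfun \<Rightarrow> nat \<Rightarrow> nat \<Rightarrow> complex \<Rightarrow> complex" where
  "fsub F i j z = ((if i = j then 1 else 0) - (\<Sum>k\<in>{1..<i}. F i k z * fsub F k j z)) / F i i z"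

declare fsub.simps [simp del]

lemma lower_tri_right_inverse:
  assumes F: "lower_tri n F"
    and diag: "\<And>i. i \<in> {1..n} \<Longrightarrow> hinf (\<lambda>z. 1 / F i i z)"
    and nz: "\<And>i z. i \<in> {1..n} \<Longrightarrow> z \<in> ball 0 1 \<Longrightarrow> F i i z \<noteq> 0"
  shows "lower_tri n (fsub F)" "mat_eq n (mat_mul n F (fsub F)) mat_id"
    and "\<And>i z. i \<in> {1..n} \<Longrightarrow> z \<in> ball 0 1 \<Longrightarrow> fsub F i i z = 1 / F i i z"
proof -
  have zero: "fsub F i j z = 0" if "i \<in> {1..n}" "i < j" for i j z
    using that
  proof (induction i rule: less_induct)
    case (less i)
    have "(\<Sum>k\<in>{1..<i}. F i k z * fsub F k j z) = 0"
      using less by (intro sum.neutral) auto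
    then show ?case using less.prems by (subst fsub.simps) simp
  qed
  show d: "fsub F i i z = 1 / F i i z" if "i \<in> {1..n}" "z \<in> ball 0 1" for i z
  proof -
    have "(\<Sum>k\<in>{1..<i}. F i k z * fsub F k i z) = 0"
      using zero that by (intro sum.neutral) auto
    then show ?thesis by (subst fsub.simps) simp
  qed
  have "hinf (fsub F i j)" if "i \<in> {1..n}" "j \<in> {1..n}" for i j
    using that
  proof (induction i rule: less_induct)
    case (less i)
    have "hinf (\<lambda>z. ((if i = j then 1 else 0) + - (\<Sum>k\<in>{1..<i}. F i k z * fsub F k j z)) * (1 / F i i z))"
      using less by (intro hinf_mult hinf_add hinf_const hinf_uminus hinf_sum diag lower_triD(1)[OF F]) auto
    then show ?case by (subst fsub.simps[abs_def]) simp
  qed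
  then show L: "lower_tri n (fsub F)" using zero by (auto simp: lower_tri_def)
  show "mat_eq n (mat_mul n F (fsub F)) mat_id"
    unfolding mat_eq_def
  proof (intro ballI)
    fix i j z assume ij: "i \<in> {1..n}" "j \<in> {1..n}" and z: "z \<in> ball (0::complex) 1"
    have "mat_mul n F (fsub F) i j z = (\<Sum>k\<in>{1..i}. F i k z * fsub F k j z)"
      unfolding mat_mul_def
      by (rule sum.mono_neutral_right) (use ij lower_triD(2)[OF F ij(1) _ _ z] in auto)
    also have "{1..i} = insert i {1..<i}" using ij by auto
    also have "(\<Sum>k\<in>insert i {1..<i}. F i k z * fsub F k j z)
        = F i i z * fsub F i j z + (\<Sum>k\<in>{1..<i}. F i k z * fsub F k j z)" by simp
    also have "F i i z * fsub F i j z = (if i = j then 1 else 0) - (\<Sum>k\<in>{1..<i}. F i k z * fsub F k j z)"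
      using nz[OF ij(1) z] by (subst fsub.simps) simp
    finally show "mat_mul n F (fsub F) i j z = mat_id i j z" by (simp add: mat_id_def)
  qed
qed

text \<open>
  The right inverse \<open>G\<close> has a right inverse \<open>L\<close> of its own, and then \<open>F = F (G L) = (F G) L = L\<close>,
  so \<open>G\<close> is two-sided.
\<close>

theorem lower_tri_inverse:
  assumes F: "lower_tri n F"
    and diag: "\<And>i. i \<in> {1..n} \<Longrightarrow> hinf (\<lambda>z. 1 / F i i z)"
    and nz: "\<And>i z. i \<in> {1..n} \<Longrightarrow> z \<in> ball 0 1 \<Longrightarrow> F i i z \<noteq> 0"
  obtains G where "lower_tri n G" "mat_eq n (mat_mul n F G) mat_id" "mat_eq n (mat_mul n G F) mat_id"
proof -
  define G where "G = fsub F"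
  note G = lower_tri_right_inverse[OF F diag nz, folded G_def]
  have "hinf (\<lambda>z. 1 / G i i z)" if "i \<in> {1..n}" for i
  proof -
    have "hinf (\<lambda>z. 1 / G i i z) \<longleftrightarrow> hinf (F i i)" using G(3) that by (intro hinf_cong) auto
    then show ?thesis using lower_triD(1)[OF F that that] by simp
  qed
  have GL: "mat_eq n (mat_mul n G (fsub G)) mat_id"
    by (rule lower_tri_right_inverse(2)[OF G(1)])
       (use \<open>\<And>i. i \<in> {1..n} \<Longrightarrow> hinf (\<lambda>z. 1 / G i i z)\<close> G(3) nz in auto)
  have "F i j z = fsub G i j z" if ij: "i \<in> {1..n}" "j \<in> {1..n}" and z: "z \<in> ball 0 1" for i j z
  proof -
    have "F i j z = mat_mul n F mat_id i j z" using ij by (simp add: mat_mul_id_right)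
    also have "\<dots> = mat_mul n F (mat_mul n G (fsub G)) i j z"
      using GL ij z by (auto simp: mat_mul_def[of n F] mat_eq_def intro!: sum.cong)
    also have "\<dots> = mat_mul n (mat_mul n F G) (fsub G) i j z" by (simp add: mat_mul_assoc)
    also have "\<dots> = mat_mul n mat_id (fsub G) i j z"
      using G(2) ij z unfolding mat_mul_def[of n "mat_mul n F G"] mat_mul_def[of n mat_id]
      by (auto simp: mat_eq_def intro!: sum.cong)
    finally show ?thesis using ij by (simp add: mat_mul_id_left)
  qed
  then have "mat_eq n (mat_mul n G F) (mat_mul n G (fsub G))"
    by (intro mat_mul_cong) (auto simp: mat_eq_def)
  then have "mat_eq n (mat_mul n G F) mat_id" using GL by (simp add: mat_eq_def)
  with G(1,2) that show ?thesis by blast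
qed


section \<open>Matrix multiplication operators on the direct sum\<close>

definition mat_op :: "nat \<Rightarrow> matfun \<Rightarrow> (nat \<Rightarrow> complex \<Rightarrow> complex) \<Rightarrow> nat \<Rightarrow> complex \<Rightarrow> complex" where
  "mat_op n F = block_op {1..n} (\<lambda>i j. mult_op (F i j))"

definition comp_all :: "nat \<Rightarrow> (complex \<Rightarrow> complex) \<Rightarrow> (nat \<Rightarrow> complex \<Rightarrow> complex) \<Rightarrow> nat \<Rightarrow> complex \<Rightarrow> complex" where
  "comp_all n u = block_op {1..n} (\<lambda>i j. if i = j then comp_op u else (\<lambda>_. 0))"

lemma mat_op_apply: "mat_op n F x i z = (if i \<in> {1..n} then \<Sum>j\<in>{1..n}. F i j z * x j z else 0)"
  by (simp add: mat_op_def block_op_def sum_fun_apply mult_op_def)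

lemma comp_all_apply: "comp_all n u x i z = (if i \<in> {1..n} \<and> z \<in> ball 0 1 then x i (u z) else 0)"
proof -
  have "(\<Sum>j\<in>{1..n}. (if i = j then comp_op u else (\<lambda>_. 0)) (x j) z) = (\<Sum>j\<in>{1..n}. if j = i then comp_op u (x i) z else 0)"
    by (intro sum.cong) auto
  then show ?thesis
    by (simp add: comp_all_def block_op_def sum_fun_apply comp_op_def dfun_def)
qed

locale disc_tuple =
  fixes n :: nat and H :: "nat \<Rightarrow> (complex \<Rightarrow> complex) ip_space" and lam :: "nat \<Rightarrow> real"
  assumes disc: "\<And>i. i \<in> {1..n} \<Longrightarrow> disc_space (H i) (lam i)"
    and lam_mono: "\<And>i j. i \<in> {1..n} \<Longrightarrow> j \<in> {1..n} \<Longrightarrow> i \<le> j \<Longrightarrow> lam i \<le> lam j"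
begin

abbreviation S :: "(nat \<Rightarrow> complex \<Rightarrow> complex) ip_space" where
  "S \<equiv> direct_sum {1..n} H"

lemma H_hilbert: "i \<in> {1..n} \<Longrightarrow> hilbert_sp (H i)"
  using disc by (simp add: disc_space_def)

lemma H_ip: "i \<in> {1..n} \<Longrightarrow> ip_sp (H i)"
  using H_hilbert by (simp add: hilbert_sp_def)

sublocale ip_family "{1..n}" H
  by (rule ip_family.intro[OF H_ip]) auto

lemma S_hilbert: "hilbert_sp S"
  by (rule direct_sum_hilbert_sp[OF H_hilbert]) auto

lemma S_vanish: "x \<in> carr S \<Longrightarrow> z \<notin> ball 0 1 \<Longrightarrow> x i z = 0"
  using disc_space.vanish[OF disc] by (cases "i \<in> {1..n}") (auto simp: carr_direct_sum)

lemma mult_op_entry_bounded: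
  assumes F: "lower_tri n F" and i: "i \<in> {1..n}" and j: "j \<in> {1..n}"
  shows "bounded_op (H j) (H i) (mult_op (F i j))"
proof (cases "i < j")
  case True
  have "mult_op (F i j) x = 0" if "x \<in> carr (H j)" for x
    using lower_triD(2)[OF F i j True] disc_space.vanish[OF disc[OF j] that]
    by (force simp: mult_op_def fun_eq_iff)
  then show ?thesis
    using bounded_op_cong[OF H_ip[OF j], of "mult_op (F i j)" "\<lambda>_. 0"] bounded_op_zero_op[OF H_ip[OF j] H_ip[OF i]]
    by simp
next
  case False
  then show ?thesis
    by (intro mult_op_bounded[OF disc[OF j] disc[OF i]] lam_mono lower_triD(1)[OF F]) (use i j in auto)
qed

lemma mat_op_bounded: "lower_tri n F \<Longrightarrow> bounded_op S S (mat_op n F)"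
  unfolding mat_op_def by (intro block_op_bounded mult_op_entry_bounded)

lemma mat_op_mem: "lower_tri n F \<Longrightarrow> x \<in> carr S \<Longrightarrow> mat_op n F x \<in> carr S"
  using bounded_opD(1)[OF mat_op_bounded] .

lemma mat_op_mul: "mat_op n F (mat_op n G x) = mat_op n (mat_mul n F G) x"
proof (intro ext)
  fix i z
  have "(\<Sum>k\<in>{1..n}. \<Sum>j\<in>{1..n}. F i k z * (G k j z * x j z)) = (\<Sum>j\<in>{1..n}. \<Sum>k\<in>{1..n}. F i k z * (G k j z * x j z))"
    by (rule sum.swap)
  then show "mat_op n F (mat_op n G x) i z = mat_op n (mat_mul n F G) x i z"
    by (simp add: mat_op_apply mat_mul_def sum_distrib_left sum_distrib_right mult.assoc)
qed

lemma mat_op_cong: "x \<in> carr S \<Longrightarrow> mat_eq n F G \<Longrightarrow> mat_op n F x = mat_op n G x"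
proof (intro ext)
  fix i z assume "x \<in> carr S" "mat_eq n F G"
  then show "mat_op n F x i z = mat_op n G x i z"
    using S_vanish[of x z] by (cases "z \<in> ball 0 1") (auto simp: mat_op_apply mat_eq_def intro!: sum.cong)
qed

lemma mat_op_id: "x \<in> carr S \<Longrightarrow> mat_op n mat_id x = x"
proof (intro ext)
  fix i z assume x: "x \<in> carr S"
  have "(\<Sum>j\<in>{1..n}. mat_id i j z * x j z) = (\<Sum>j\<in>{1..n}. if j = i then x i z else 0)"
    by (intro sum.cong) (auto simp: mat_id_def)
  then show "mat_op n mat_id x i z = x i z"
    using x by (auto simp: mat_op_apply carr_direct_sum)
qed

lemma mat_op_lincomb:
  "mat_op n (\<lambda>i j z. c * F i j z + d * G i j z) x = c *\<^sub>C mat_op n F x + d *\<^sub>C mat_op n G x"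
  by (intro ext) (simp add: mat_op_apply sum.distrib sum_distrib_left algebra_simps)

lemma mat_op_invertible:
  assumes F: "lower_tri n F" and G: "lower_tri n G"
    and FG: "mat_eq n (mat_mul n F G) mat_id" and GF: "mat_eq n (mat_mul n G F) mat_id"
  shows "invertible_op S (mat_op n F)"
proof -
  have "mat_op n G (mat_op n F x) = x" "mat_op n F (mat_op n G x) = x" if "x \<in> carr S" for x
    using mat_op_cong[OF that GF] mat_op_cong[OF that FG] mat_op_id[OF that] by (simp_all add: mat_op_mul)
  then show ?thesis
    unfolding invertible_op_def using mat_op_bounded[OF F] mat_op_bounded[OF G] by blast
qed

lemma mat_op_invertible_of_diagonal:
  assumes "lower_tri n F" "\<And>i. i \<in> {1..n} \<Longrightarrow> hinf (\<lambda>z. 1 / F i i z)"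
    and "\<And>i z. i \<in> {1..n} \<Longrightarrow> z \<in> ball 0 1 \<Longrightarrow> F i i z \<noteq> 0"
  shows "invertible_op S (mat_op n F)"
  using lower_tri_inverse[OF assms] mat_op_invertible[OF assms(1)] by metis

lemma comp_all_bounded:
  assumes "cmod b < 1"
  shows "bounded_op S S (comp_all n (Moebius_function t b))"
  unfolding comp_all_def
  by (rule block_op_bounded)
     (auto intro!: comp_op_bounded[OF disc assms] bounded_op_zero_op[OF H_ip H_ip])

lemma comp_all_mat_op:
  assumes "\<And>z. cmod z < 1 \<Longrightarrow> cmod (u z) < 1" and x: "x \<in> carr S"
  shows "comp_all n u (mat_op n F x) = mat_op n (\<lambda>i j z. F i j (u z)) (comp_all n u x)"
  by (intro ext) (auto simp: comp_all_apply mat_op_apply intro!: sum.cong)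

lemma comp_all_inverse:
  assumes "\<And>z. cmod z < 1 \<Longrightarrow> cmod (u z) < 1" "\<And>z. cmod z < 1 \<Longrightarrow> v (u z) = z" and x: "x \<in> carr S"
  shows "comp_all n u (comp_all n v x) = x"
proof (intro ext)
  fix i z
  show "comp_all n u (comp_all n v x) i z = x i z"
    using assms S_vanish[OF x, of z i] by (auto simp: comp_all_apply carr_direct_sum)
qed

end


section \<open>Similarity of \<open>\<phi>(T)\<close> and \<open>T\<close> in terms of analytic matrices\<close>

text \<open>
  For \<open>\<phi>(T) = c (T - a) (1 - d T)\<^sup>-\<^sup>1\<close> the relation \<open>X \<phi>(T) = T X\<close> is equivalent to
  \<open>X c (T - a) = T X (1 - d T)\<close>; without the inverse, the adjoint relation can be read off.
\<close>

lemma adjoint_intertwining: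
  assumes V: "ip_sp V" and T: "bounded_op V V T" and M: "bounded_op V V M" and MT: "is_adjoint V V M T"
    and X: "bounded_op V V X" and Y: "bounded_op V V Y" and XY: "is_adjoint V V X Y"
  shows "(\<forall>x\<in>carr V. X (c *\<^sub>C (T x - a *\<^sub>C x)) = T (X (x - d *\<^sub>C T x))) \<longleftrightarrow>
         (\<forall>y\<in>carr V. cnj c *\<^sub>C (M (Y y) - cnj a *\<^sub>C Y y) = Y (M y) - cnj d *\<^sub>C M (Y (M y)))"
proof -
  have TM: "is_adjoint V V T M" by (rule is_adjoint_sym[OF V V M T MT])
  let ?L = "\<lambda>x. c *\<^sub>C (T x - a *\<^sub>C x)" and ?L' = "\<lambda>x. cnj c *\<^sub>C (M x - cnj a *\<^sub>C x)"
  let ?R = "\<lambda>x. x - d *\<^sub>C T x" and ?R' = "\<lambda>x. x - cnj d *\<^sub>C M x"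
  have L: "bounded_op V V ?L" "bounded_op V V ?L'" "is_adjoint V V ?L ?L'"
    by (intro bounded_op_scale bounded_op_sub_scale is_adjoint_scale is_adjoint_sub_scale V T M TM)+
  have R: "bounded_op V V ?R" "bounded_op V V ?R'" "is_adjoint V V ?R ?R'"
    by (intro bounded_op_id_sub_scale is_adjoint_id_sub_scale V T M TM)+
  have A1: "bounded_op V V (\<lambda>x. X (?L x))" "bounded_op V V (\<lambda>y. ?L' (Y y))"
    by (rule bounded_op_compose[OF V V L(1) X], rule bounded_op_compose[OF V V Y L(2)])
  have adj1: "is_adjoint V V (\<lambda>x. X (?L x)) (\<lambda>y. ?L' (Y y))"
    by (rule is_adjoint_compose[OF L(1) Y L(3) XY])
  have XR: "bounded_op V V (\<lambda>x. X (?R x))" "bounded_op V V (\<lambda>y. ?R' (Y y))"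
    by (rule bounded_op_compose[OF V V R(1) X], rule bounded_op_compose[OF V V Y R(2)])
  have A2: "bounded_op V V (\<lambda>x. T (X (?R x)))" "bounded_op V V (\<lambda>y. ?R' (Y (M y)))"
    by (rule bounded_op_compose[OF V V XR(1) T], rule bounded_op_compose[OF V V M XR(2)])
  have adj2: "is_adjoint V V (\<lambda>x. T (X (?R x))) (\<lambda>y. ?R' (Y (M y)))"
    by (rule is_adjoint_compose[OF XR(1) M is_adjoint_compose[OF R(1) Y R(3) XY] TM])
  show ?thesis
  proof
    assume *: "\<forall>x\<in>carr V. X (?L x) = T (X (?R x))"
    show "\<forall>y\<in>carr V. ?L' (Y y) = ?R' (Y (M y))"
      by (rule ballI, rule is_adjoint_eqI[OF V V A1(2) A2(2) adj1 adj2]) (use * in auto)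
  next
    assume *: "\<forall>y\<in>carr V. ?L' (Y y) = ?R' (Y (M y))"
    show "\<forall>x\<in>carr V. X (?L x) = T (X (?R x))"
      by (rule ballI, rule is_adjoint_eqI[OF V V A1(1) A2(1) is_adjoint_sym[OF V V A1 adj1] is_adjoint_sym[OF V V A2 adj2]])
         (use * in auto)
  qed
qed

lemma invertible_op_inj: "invertible_op V A \<Longrightarrow> inj_on A (carr V)"
  unfolding invertible_op_def by (auto intro: inj_on_inverseI)

lemma invertible_op_surj:
  assumes "invertible_op V A" "x \<in> carr V"
  obtains v where "v \<in> carr V" "x = A v"
proof -
  obtain Y where "bounded_op V V Y" "\<forall>x\<in>carr V. A (Y x) = x"
    using assms(1) by (auto simp: invertible_op_def)
  then show ?thesis using that[of "Y x"] assms(2) bounded_opD(1)[of V V Y x] by simp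
qed

locale tri_model = disc_tuple +
  fixes \<Phi> :: matfun and T :: "(nat \<Rightarrow> complex \<Rightarrow> complex) \<Rightarrow> nat \<Rightarrow> complex \<Rightarrow> complex"
  assumes Phi: "lower_tri n \<Phi>" and diag: "\<And>i z. i \<in> {1..n} \<Longrightarrow> z \<in> ball 0 1 \<Longrightarrow> \<Phi> i i z = z"
    and T: "bounded_op S S T" and adj: "is_adjoint S S (mat_op n \<Phi>) T"
begin

abbreviation M :: "(nat \<Rightarrow> complex \<Rightarrow> complex) \<Rightarrow> nat \<Rightarrow> complex \<Rightarrow> complex" where
  "M \<equiv> mat_op n \<Phi>"

lemma M: "bounded_op S S M"
  by (rule mat_op_bounded[OF Phi])

lemma mat_op_affine:
  assumes "x \<in> carr S"
  shows "mat_op n (\<lambda>i j z. c * \<Phi> i j z + d * mat_id i j z) x = c *\<^sub>C M x + d *\<^sub>C x"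
  by (simp add: mat_op_lincomb mat_op_id[OF assms])

lemma lower_tri_affine: "lower_tri n (\<lambda>i j z. c * \<Phi> i j z + d * mat_id i j z)"
  by (rule lower_tri_lincomb[OF Phi lower_tri_id])

lemma affine_inverse_bounded:
  assumes d: "\<delta> > 0" "\<And>z. z \<in> ball 0 1 \<Longrightarrow> \<delta> \<le> cmod (c * z + d)" and i: "i \<in> {1..n}"
  shows "hinf (\<lambda>z. 1 / (c * \<Phi> i i z + d * mat_id i i z))"
    and "z \<in> ball 0 1 \<Longrightarrow> c * \<Phi> i i z + d * mat_id i i z \<noteq> 0"
proof -
  have "hinf (\<lambda>z. 1 / (c * z + d))"
    using d by (intro hinf_inverse holomorphic_intros) auto
  moreover have "hinf (\<lambda>z. 1 / (c * z + d)) \<longleftrightarrow> hinf (\<lambda>z. 1 / (c * \<Phi> i i z + d * mat_id i i z))"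
    by (rule hinf_cong) (simp add: diag[OF i] mat_id_def)
  ultimately show "hinf (\<lambda>z. 1 / (c * \<Phi> i i z + d * mat_id i i z))" by simp
  show "c * \<Phi> i i z + d * mat_id i i z \<noteq> 0" if "z \<in> ball 0 1"
    using d(1) d(2)[OF that] diag[OF i that] by (auto simp: mat_id_def)
qed

lemma affine_invertible:
  assumes d: "\<delta> > 0" "\<And>z. z \<in> ball 0 1 \<Longrightarrow> \<delta> \<le> cmod (c * z + d)"
  shows "invertible_op S (mat_op n (\<lambda>i j z. c * \<Phi> i j z + d * mat_id i j z))"
  by (intro mat_op_invertible_of_diagonal lower_tri_affine affine_inverse_bounded[OF d])

lemma invertible_cong:
  assumes A: "invertible_op S A" and AB: "\<And>x. x \<in> carr S \<Longrightarrow> A x = B x"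
  shows "invertible_op S B"
proof -
  obtain A' where A': "bounded_op S S A'" "\<forall>x\<in>carr S. A' (A x) = x" "\<forall>x\<in>carr S. A (A' x) = x"
    using A by (auto simp: invertible_op_def)
  have "bounded_op S S B"
    using A bounded_op_cong[OF K.ip_sp_axioms AB] by (simp add: invertible_op_def)
  moreover have "\<forall>x\<in>carr S. A' (B x) = x" "\<forall>x\<in>carr S. B (A' x) = x"
    using A' AB bounded_opD(1)[OF A'(1)] by auto
  ultimately show ?thesis unfolding invertible_op_def using A'(1) by blast
qed

lemma spectrum_subset: "op_spectrum S T \<subseteq> cball 0 1"
proof
  fix \<mu> assume \<mu>: "\<mu> \<in> op_spectrum S T"
  show "\<mu> \<in> cball 0 1"
  proof (rule ccontr)
    assume "\<mu> \<notin> cball 0 1"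
    then have gt: "cmod \<mu> > 1" by simp
    have "invertible_op S (mat_op n (\<lambda>i j z. 1 * \<Phi> i j z + (- cnj \<mu>) * mat_id i j z))"
    proof (rule affine_invertible)
      show "cmod \<mu> - 1 > 0" using gt by simp
      show "cmod \<mu> - 1 \<le> cmod (1 * z + - cnj \<mu>)" if "z \<in> ball 0 1" for z
        using that norm_triangle_ineq2[of "cnj \<mu>" z] by (simp add: norm_minus_commute)
    qed
    then have "invertible_op S (\<lambda>x. M x - cnj \<mu> *\<^sub>C x)"
      by (rule invertible_cong) (simp only: mat_op_affine, simp add: scaleC_one scaleC_minus_left)
    then have "invertible_op S (\<lambda>x. T x - \<mu> *\<^sub>C x)"
      using invertible_op_adjoint[OF S_hilbert _ bounded_op_sub_scale[OF K.ip_sp_axioms T]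
          is_adjoint_sub_scale[OF K.ip_sp_axioms M T adj, of "cnj \<mu>"]] by simp
    then show False using \<mu> by (simp add: op_spectrum_def)
  qed
qed

lemma id_sub_scale_invertible:
  assumes a: "cmod a < 1"
  shows "invertible_op S (\<lambda>x. x - a *\<^sub>C M x)" "invertible_op S (\<lambda>x. x - cnj a *\<^sub>C T x)"
proof -
  have "invertible_op S (mat_op n (\<lambda>i j z. (- a) * \<Phi> i j z + 1 * mat_id i j z))"
  proof (rule affine_invertible)
    show "1 - cmod a > 0" using a by simp
    show "1 - cmod a \<le> cmod (- a * z + 1)" if "z \<in> ball 0 1" for z
    proof -
      have "cmod (a * z) \<le> cmod a" using that by (simp add: norm_mult mult_left_le)
      then show ?thesis using norm_triangle_ineq2[of 1 "a * z"] by (simp add: norm_minus_commute)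
    qed
  qed
  then show *: "invertible_op S (\<lambda>x. x - a *\<^sub>C M x)"
    by (rule invertible_cong) (simp only: mat_op_affine, simp add: scaleC_one scaleC_minus_left)
  show "invertible_op S (\<lambda>x. x - cnj a *\<^sub>C T x)"
    by (rule invertible_op_adjoint[OF S_hilbert * bounded_op_id_sub_scale[OF K.ip_sp_axioms T]
          is_adjoint_id_sub_scale[OF K.ip_sp_axioms M T adj]])
qed

lemma moebius_op_apply:
  assumes p: "(SOME p. moebius_params f p) = (t, a)" and a: "cmod a < 1" and v: "v \<in> carr S"
  shows "moebius_op S f T (v - cnj a *\<^sub>C T v) = exp (\<i> * of_real t) *\<^sub>C (T v - a *\<^sub>C v)"
proof -
  have "inj_on (\<lambda>v. v - cnj a *\<^sub>C T v) (carr S)"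
    by (rule invertible_op_inj[OF id_sub_scale_invertible(2)[OF a]])
  then have "inv_into (carr S) (\<lambda>v. v - cnj a *\<^sub>C T v) (v - cnj a *\<^sub>C T v) = v"
    using inv_into_f_f[of "\<lambda>v. v - cnj a *\<^sub>C T v" "carr S" v] v by simp
  then show ?thesis by (simp add: moebius_op_def p)
qed

text \<open>
  \<open>F = u(\<Phi>)\<close> for \<open>u z = e\<^sup>i\<^sup>t (z - b) / (1 - cnj b z)\<close>, described by \<open>(1 - cnj b \<Phi>) F = e\<^sup>i\<^sup>t (\<Phi> - b)\<close>.
  Below the diagonal the chain rule appears: the factor is \<open>u'\<close>.
\<close>

lemma Moebius_matrix:
  assumes b: "cmod b < 1"
  obtains F where "lower_tri n F"
    "\<And>x. x \<in> carr S \<Longrightarrow> mat_op n F x - cnj b *\<^sub>C M (mat_op n F x) = exp (\<i> * of_real t) *\<^sub>C (M x - b *\<^sub>C x)"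
    "\<And>i z. i \<in> {1..n} \<Longrightarrow> z \<in> ball 0 1 \<Longrightarrow> F i i z = Moebius_function t b z"
    "\<And>i z. i \<in> {1..n - 1} \<Longrightarrow> z \<in> ball 0 1 \<Longrightarrow>
       F (i + 1) i z = exp (\<i> * of_real t) * of_real (1 - (cmod b)\<^sup>2) / (1 - cnj b * z)\<^sup>2 * \<Phi> (i + 1) i z"
proof -
  define e where "e = exp (\<i> * of_real t)"
  define N where "N = (\<lambda>i j z. (- cnj b) * \<Phi> i j z + 1 * mat_id i j z)"
  define L where "L = (\<lambda>i j z. e * \<Phi> i j z + (- (e * b)) * mat_id i j z)"
  have N_tri: "lower_tri n N" and L_tri: "lower_tri n L"
    unfolding N_def L_def by (rule lower_tri_affine)+
  have low: "1 - cmod b > 0" "\<And>z. z \<in> ball 0 1 \<Longrightarrow> 1 - cmod b \<le> cmod (- cnj b * z + 1)"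
  proof -
    show "1 - cmod b > 0" using b by simp
    show "1 - cmod b \<le> cmod (- cnj b * z + 1)" if "z \<in> ball 0 1" for z
    proof -
      have "cmod (cnj b * z) \<le> cmod b" using that by (simp add: norm_mult mult_left_le)
      then show ?thesis using norm_triangle_ineq2[of 1 "cnj b * z"] by (simp add: norm_minus_commute)
    qed
  qed
  obtain R where R: "lower_tri n R" "mat_eq n (mat_mul n N R) mat_id"
  proof (rule lower_tri_inverse[OF N_tri])
    show "hinf (\<lambda>z. 1 / N i i z)" if "i \<in> {1..n}" for i
      unfolding N_def by (rule affine_inverse_bounded(1)[OF low that])
    show "N i i z \<noteq> 0" if "i \<in> {1..n}" "z \<in> ball 0 1" for i z
      unfolding N_def by (rule affine_inverse_bounded(2)[OF low that])
  qed
  define F where "F = mat_mul n R L"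
  have F_tri: "lower_tri n F" unfolding F_def by (rule lower_tri_mul[OF R(1) L_tri])
  have NF: "mat_eq n (mat_mul n N F) L"
    unfolding mat_eq_def
  proof (intro ballI)
    fix i j and z :: complex assume ij: "i \<in> {1..n}" "j \<in> {1..n}" and z: "z \<in> ball 0 1"
    have "mat_mul n N F i j z = mat_mul n (mat_mul n N R) L i j z" by (simp add: F_def mat_mul_assoc)
    also have "\<dots> = mat_mul n mat_id L i j z"
      using mat_mul_cong[OF R(2), of L L] ij z by (auto simp: mat_eq_def)
    finally show "mat_mul n N F i j z = L i j z" using ij by (simp add: mat_mul_id_left)
  qed
  have op: "mat_op n F x - cnj b *\<^sub>C M (mat_op n F x) = exp (\<i> * of_real t) *\<^sub>C (M x - b *\<^sub>C x)" if x: "x \<in> carr S" for x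
  proof -
    have "mat_op n N (mat_op n F x) = mat_op n L x"
      unfolding mat_op_mul by (rule mat_op_cong[OF x NF])
    then show ?thesis
      unfolding N_def L_def mat_op_affine[OF x] mat_op_affine[OF mat_op_mem[OF F_tri x]]
      by (simp add: scaleC_one scaleC_minus_left scaleC_diff_right scaleC_scaleC e_def)
  qed
  have nz: "1 - cnj b * z \<noteq> 0" if "z \<in> ball 0 1" for z
    using low(1) low(2)[OF that] by auto
  have dg: "F i i z = Moebius_function t b z" if i: "i \<in> {1..n}" and z: "z \<in> ball 0 1" for i z
  proof -
    have "N i i z * F i i z = L i i z"
      using NF[unfolded mat_eq_def, rule_format, OF i i z] mat_mul_lower[OF N_tri F_tri i i z] by simp
    then have "(1 - cnj b * z) * F i i z = e * z - e * b"
      using diag[OF i z] by (simp add: N_def L_def mat_id_def algebra_simps)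
    then show ?thesis using nz[OF z] by (simp add: Moebius_function_def e_def field_simps)
  qed
  have sub: "F (i + 1) i z = exp (\<i> * of_real t) * of_real (1 - (cmod b)\<^sup>2) / (1 - cnj b * z)\<^sup>2 * \<Phi> (i + 1) i z"
    if i: "i \<in> {1..n - 1}" and z: "z \<in> ball 0 1" for i z
  proof -
    have i1: "i \<in> {1..n}" "i + 1 \<in> {1..n}" using i by auto
    have "{i..i + 1} = {i, i + 1}" by auto
    then have "N (i + 1) i z * F i i z + N (i + 1) (i + 1) z * F (i + 1) i z = L (i + 1) i z"
      using NF[unfolded mat_eq_def, rule_format, OF i1(2) i1(1) z] mat_mul_lower[OF N_tri F_tri i1(2) i1(1) z] by simp
    then have "(1 - cnj b * z) * F (i + 1) i z = (e + cnj b * F i i z) * \<Phi> (i + 1) i z"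
      using diag[OF i1(2) z] by (simp add: N_def L_def mat_id_def algebra_simps)
    also have "e + cnj b * F i i z = e * (1 - b * cnj b) / (1 - cnj b * z)"
      unfolding dg[OF i1(1) z] Moebius_function_def e_def[symmetric] using nz[OF z] by (simp add: field_simps)
    also have "1 - b * cnj b = of_real (1 - (cmod b)\<^sup>2)" by (simp add: complex_norm_square del: of_real_power)
    finally have "(1 - cnj b * z) * F (i + 1) i z = e * of_real (1 - (cmod b)\<^sup>2) / (1 - cnj b * z) * \<Phi> (i + 1) i z" .
    moreover have "X = p / d\<^sup>2 * y" if "d \<noteq> 0" "d * X = p / d * y" for d X p y :: complex
      using that by (simp add: power2_eq_square field_simps)
    ultimately show ?thesis unfolding e_def using nz[OF z] by blast
  qed
  from that[OF F_tri op dg sub] show ?thesis by blast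
qed

text \<open>
  Taking adjoints turns a similarity between \<open>\<phi>(T)\<close> and \<open>T\<close> into an operator \<open>Y\<close> with
  \<open>u(\<Phi>) Y = Y \<Phi>\<close>, where \<open>u\<close> is the conjugate of \<open>\<phi>\<close>; composing \<open>Y\<close> with \<open>u\<^sup>-\<^sup>1\<close> makes
  both sides matrices with diagonal \<open>z\<close>.
\<close>

lemma similar_iff_intertwining:
  fixes t :: real and a :: complex
  defines "b \<equiv> cnj a"
  defines "w \<equiv> Moebius_function t (- exp (\<i> * of_real (- t)) * b)"
  assumes p: "(SOME p. moebius_params f p) = (t, a)" and a: "cmod a < 1"
    and F_tri: "lower_tri n F"
    and F: "\<And>x. x \<in> carr S \<Longrightarrow> mat_op n F x - cnj b *\<^sub>C M (mat_op n F x) = exp (\<i> * of_real (- t)) *\<^sub>C (M x - b *\<^sub>C x)"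
  shows "similar_op S (moebius_op S f T) T \<longleftrightarrow>
         (\<exists>Z. invertible_op S Z \<and> (\<forall>x\<in>carr S. Z (M x) = mat_op n (\<lambda>i j z. F i j (w z)) (Z x)))"
proof -
  define u where "u = Moebius_function (- t) b"
  have b: "cmod b < 1" using a by (simp add: b_def)
  note ch = Moebius_mutually_inverse[OF b, where t = "- t"]
  have uw: "u (w z) = z" and wu: "w (u z) = z" and u1: "cmod (u z) < 1" and w1: "cmod (w z) < 1" if "cmod z < 1" for z
    using ch(2,3)[OF that] Moebius_function_norm_lt_1[OF b that, of "- t"] Moebius_function_norm_lt_1[OF ch(1) that, of t]
    by (simp_all add: u_def w_def)
  define C D where "C = comp_all n u" and "D = comp_all n w"
  have C: "bounded_op S S C" unfolding C_def u_def by (rule comp_all_bounded[OF b])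
  have D: "bounded_op S S D" unfolding D_def w_def by (rule comp_all_bounded[OF ch(1)])
  have CD: "C (D x) = x" and DC: "D (C x) = x" if "x \<in> carr S" for x
    unfolding C_def D_def using comp_all_inverse[OF _ _ that] u1 w1 uw wu by blast+
  have C_inv: "invertible_op S C" and D_inv: "invertible_op S D"
    unfolding invertible_op_def using C D CD DC by blast+
  let ?Ft = "\<lambda>i j z. F i j (w z)"
  note Ss = K.ip_sp_axioms
  have ce: "cnj (exp (\<i> * of_real t)) = exp (\<i> * of_real (- t))" by (simp add: exp_cnj)
  have key: "(\<forall>x\<in>carr S. X (exp (\<i> * of_real t) *\<^sub>C (T x - a *\<^sub>C x)) = T (X (x - cnj a *\<^sub>C T x))) \<longleftrightarrow>
      (\<forall>y\<in>carr S. mat_op n F (Y y) = Y (M y))"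
    if X: "bounded_op S S X" and Y: "bounded_op S S Y" and XY: "is_adjoint S S X Y" for X Y
  proof -
    have "(\<forall>x\<in>carr S. X (exp (\<i> * of_real t) *\<^sub>C (T x - a *\<^sub>C x)) = T (X (x - cnj a *\<^sub>C T x))) \<longleftrightarrow>
        (\<forall>y\<in>carr S. exp (\<i> * of_real (- t)) *\<^sub>C (M (Y y) - b *\<^sub>C Y y) = Y (M y) - cnj b *\<^sub>C M (Y (M y)))"
      using adjoint_intertwining[OF Ss T M adj X Y XY, of "exp (\<i> * of_real t)" a "cnj a"] ce by (simp add: b_def)
    also have "\<dots> \<longleftrightarrow> (\<forall>y\<in>carr S. mat_op n F (Y y) - cnj b *\<^sub>C M (mat_op n F (Y y)) = Y (M y) - cnj b *\<^sub>C M (Y (M y)))"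
      using F bounded_opD(1)[OF Y] by simp
    also have "\<dots> \<longleftrightarrow> (\<forall>y\<in>carr S. mat_op n F (Y y) = Y (M y))"
    proof -
      have "inj_on (\<lambda>x. x - cnj b *\<^sub>C M x) (carr S)"
        using invertible_op_inj[OF id_sub_scale_invertible(1)[OF a]] by (simp add: b_def)
      then show ?thesis
        using mat_op_mem[OF F_tri] bounded_opD(1)[OF Y] bounded_opD(1)[OF M] by (auto simp: inj_on_def)
    qed
    finally show ?thesis .
  qed
  show ?thesis
  proof
    assume "similar_op S (moebius_op S f T) T"
    then obtain X where X: "invertible_op S X" "\<forall>x\<in>carr S. X (moebius_op S f T x) = T (X x)"
      by (auto simp: similar_op_def)
    then have Xb: "bounded_op S S X" by (simp add: invertible_op_def)
    define Y where "Y = adjoint_op S S X"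
    note Y = adjoint_op_properties[OF S_hilbert Ss Xb, folded Y_def]
    have Y_inv: "invertible_op S Y" by (rule invertible_op_adjoint[OF S_hilbert X(1) Y(2,1)])
    have "\<forall>x\<in>carr S. X (exp (\<i> * of_real t) *\<^sub>C (T x - a *\<^sub>C x)) = T (X (x - cnj a *\<^sub>C T x))"
    proof
      fix v assume v: "v \<in> carr S"
      then have "v - cnj a *\<^sub>C T v \<in> carr S"
        by (intro K.diff_mem K.scale_mem bounded_opD(1)[OF T])
      with X(2) have "X (moebius_op S f T (v - cnj a *\<^sub>C T v)) = T (X (v - cnj a *\<^sub>C T v))" by blast
      then show "X (exp (\<i> * of_real t) *\<^sub>C (T v - a *\<^sub>C v)) = T (X (v - cnj a *\<^sub>C T v))"
        by (simp only: moebius_op_apply[OF p a v])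
    qed
    then have FY: "\<forall>y\<in>carr S. mat_op n F (Y y) = Y (M y)" using key[OF Xb Y(2,1)] by blast
    have "invertible_op S (\<lambda>x. D (Y x))" by (rule invertible_op_compose[OF Ss D_inv Y_inv])
    moreover have "D (Y (M x)) = mat_op n ?Ft (D (Y x))" if x: "x \<in> carr S" for x
      using FY[rule_format, OF x, symmetric] comp_all_mat_op[of w "Y x" F] w1 bounded_opD(1)[OF Y(2) x]
      by (simp add: D_def)
    ultimately show "\<exists>Z. invertible_op S Z \<and> (\<forall>x\<in>carr S. Z (M x) = mat_op n ?Ft (Z x))" by blast
  next
    assume "\<exists>Z. invertible_op S Z \<and> (\<forall>x\<in>carr S. Z (M x) = mat_op n ?Ft (Z x))"
    then obtain Z where Z: "invertible_op S Z" "\<And>x. x \<in> carr S \<Longrightarrow> Z (M x) = mat_op n ?Ft (Z x)" by blast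
    define Y where "Y = (\<lambda>x. C (Z x))"
    have Y_inv: "invertible_op S Y" unfolding Y_def by (rule invertible_op_compose[OF Ss C_inv Z(1)])
    then have Yb: "bounded_op S S Y" by (simp add: invertible_op_def)
    define X where "X = adjoint_op S S Y"
    note X = adjoint_op_properties[OF S_hilbert Ss Yb, folded X_def]
    have X_inv: "invertible_op S X" by (rule invertible_op_adjoint[OF S_hilbert Y_inv X(2,1)])
    have XY: "is_adjoint S S X Y" by (rule is_adjoint_sym[OF Ss Ss Yb X(2,1)])
    have "mat_op n F (Y x) = Y (M x)" if x: "x \<in> carr S" for x
    proof -
      have Zx: "Z x \<in> carr S" using Z(1) x by (auto simp: invertible_op_def dest: bounded_opD(1))
      have "Y (M x) = mat_op n (\<lambda>i j z. F i j (w (u z))) (C (Z x))"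
        unfolding Y_def Z(2)[OF x] C_def using comp_all_mat_op[of u "Z x" ?Ft] u1 Zx by blast
      also have "\<dots> = mat_op n F (C (Z x))"
        using wu by (intro mat_op_cong bounded_opD(1)[OF C Zx]) (auto simp: mat_eq_def)
      finally show ?thesis by (simp add: Y_def)
    qed
    then have *: "\<forall>x\<in>carr S. X (exp (\<i> * of_real t) *\<^sub>C (T x - a *\<^sub>C x)) = T (X (x - cnj a *\<^sub>C T x))"
      using key[OF X(2) Yb XY] by blast
    have "X (moebius_op S f T x) = T (X x)" if x: "x \<in> carr S" for x
    proof -
      obtain v where v: "v \<in> carr S" "x = v - cnj a *\<^sub>C T v"
        using invertible_op_surj[OF id_sub_scale_invertible(2)[OF a] x] by blast
      show ?thesis unfolding v(2) moebius_op_apply[OF p a v(1)] using * v(1) by blast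
    qed
    then show "similar_op S (moebius_op S f T) T"
      unfolding similar_op_def using X_inv by blast
  qed
qed

end


section \<open>Intertwining operators are lower triangular\<close>

lemma holomorphic_product_eq_zero:
  assumes f: "f holomorphic_on ball 0 1" and g: "g holomorphic_on ball 0 1"
    and fg: "\<And>z. z \<in> ball 0 1 \<Longrightarrow> f z * g z = 0" and nz: "\<exists>z\<in>ball 0 1. g z \<noteq> 0" and z: "z \<in> ball 0 1"
  shows "f z = 0"
proof -
  define U where "U = ball 0 1 \<inter> g -` (- {0})"
  have U: "open U"
    unfolding U_def by (intro continuous_open_preimage holomorphic_on_imp_continuous_on g) auto
  have zero: "f z = 0" if "z \<in> U" for z
    using fg[of z] that by (auto simp: U_def)
  show ?thesis
  proof (rule analytic_continuation_open[of U "ball 0 1" f "\<lambda>_. 0"])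
    show "U \<noteq> {}" "U \<subseteq> ball 0 1" using nz by (auto simp: U_def)
  qed (use U f z zero in \<open>auto intro: convex_connected\<close>)
qed

locale intertwiner = disc_tuple +
  fixes \<Phi> \<Phi>' :: matfun and Z :: "(nat \<Rightarrow> complex \<Rightarrow> complex) \<Rightarrow> nat \<Rightarrow> complex \<Rightarrow> complex"
  assumes lam_step: "\<And>i. i \<in> {1..n - 1} \<Longrightarrow> lam (i + 1) < lam i + 2"
    and Phi: "lower_tri n \<Phi>" and diag: "\<And>i z. i \<in> {1..n} \<Longrightarrow> z \<in> ball 0 1 \<Longrightarrow> \<Phi> i i z = z"
    and Phi': "lower_tri n \<Phi>'" and diag': "\<And>i z. i \<in> {1..n} \<Longrightarrow> z \<in> ball 0 1 \<Longrightarrow> \<Phi>' i i z = z"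
    and sub: "\<And>i. i \<in> {1..n - 1} \<Longrightarrow> \<exists>z\<in>ball 0 1. \<Phi> (i + 1) i z \<noteq> 0"
    and Z: "bounded_op S S Z" and ZM: "\<And>x. x \<in> carr S \<Longrightarrow> Z (mat_op n \<Phi> x) = mat_op n \<Phi>' (Z x)"
begin

definition entry :: "nat \<Rightarrow> nat \<Rightarrow> (complex \<Rightarrow> complex) \<Rightarrow> complex \<Rightarrow> complex" where
  "entry i j f = Z (single j f) i"

definition entry_symbol :: "nat \<Rightarrow> nat \<Rightarrow> complex \<Rightarrow> complex" where
  "entry_symbol i j = entry i j (mon 0)"

definition upper_zero :: "nat \<Rightarrow> bool" where
  "upper_zero D \<longleftrightarrow> (\<forall>i\<in>{1..n}. \<forall>j\<in>{1..n}. i + D < j \<longrightarrow> (\<forall>f\<in>carr (H j). entry i j f = 0))"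

lemma entry_bounded: "i \<in> {1..n} \<Longrightarrow> j \<in> {1..n} \<Longrightarrow> bounded_op (H j) (H i) (entry i j)"
  unfolding entry_def[abs_def] by (rule block_entry_bounded[OF Z])

lemma entry_mem: "i \<in> {1..n} \<Longrightarrow> j \<in> {1..n} \<Longrightarrow> f \<in> carr (H j) \<Longrightarrow> entry i j f \<in> carr (H i)"
  using bounded_opD(1)[OF entry_bounded] .

lemma entry_zero: "i \<in> {1..n} \<Longrightarrow> j \<in> {1..n} \<Longrightarrow> entry i j 0 = 0"
  using bounded_op_zero[OF H_ip entry_bounded] .

lemma mult_zero_entry:
  assumes "lower_tri n F" "i \<in> {1..n}" "j \<in> {1..n}" "i < j" "f \<in> carr (H j)"
  shows "mult_op (F i j) f = 0"
  using lower_triD(2)[OF assms(1-4)] disc_space.vanish[OF disc[OF assms(3)] assms(5)]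
  by (force simp: mult_op_def fun_eq_iff)

lemma mult_diag_entry:
  assumes "\<And>z. z \<in> ball 0 1 \<Longrightarrow> F i i z = z" "i \<in> {1..n}" "f \<in> carr (H i)"
  shows "mult_op (F i i) f = zmul f"
  using assms(1) disc_space.vanish[OF disc[OF assms(2)] assms(3)]
  by (force simp: mult_op_def fun_eq_iff)

lemma mult_entry_mem:
  "lower_tri n F \<Longrightarrow> i \<in> {1..n} \<Longrightarrow> j \<in> {1..n} \<Longrightarrow> f \<in> carr (H j) \<Longrightarrow> mult_op (F i j) f \<in> carr (H i)"
  using bounded_opD(1)[OF mult_op_entry_bounded] .

lemma block_relation:
  assumes i: "i \<in> {1..n}" and j: "j \<in> {1..n}" and f: "f \<in> carr (H j)"
  shows "(\<Sum>k\<in>{1..n}. entry i k (mult_op (\<Phi> k j) f)) = (\<Sum>k\<in>{1..n}. mult_op (\<Phi>' i k) (entry k j f))"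
proof -
  have s: "single j f \<in> carr S" by (rule single_mem[OF j f])
  have col: "mat_op n \<Phi> (single j f) k = mult_op (\<Phi> k j) f" if "k \<in> {1..n}" for k
  proof
    fix z
    have "(\<Sum>m\<in>{1..n}. \<Phi> k m z * single j f m z) = (\<Sum>m\<in>{1..n}. if m = j then \<Phi> k j z * f z else 0)"
      by (intro sum.cong) (auto simp: single_def)
    then show "mat_op n \<Phi> (single j f) k z = mult_op (\<Phi> k j) f z"
      using that j by (simp add: mat_op_apply mult_op_def)
  qed
  have "Z (mat_op n \<Phi> (single j f)) i = (\<Sum>k\<in>{1..n}. entry i k (mat_op n \<Phi> (single j f) k))"
    using block_expansion[OF Z mat_op_mem[OF Phi s]] by (simp add: entry_def)
  also have "\<dots> = (\<Sum>k\<in>{1..n}. entry i k (mult_op (\<Phi> k j) f))" by (intro sum.cong refl) (simp add: col)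
  finally have "(\<Sum>k\<in>{1..n}. entry i k (mult_op (\<Phi> k j) f)) = mat_op n \<Phi>' (Z (single j f)) i"
    using ZM[OF s] by simp
  also have "\<dots> = (\<Sum>k\<in>{1..n}. mult_op (\<Phi>' i k) (entry k j f))"
    using i by (simp add: mat_op_def block_op_def entry_def)
  finally show ?thesis .
qed

lemma sum_window:
  assumes "J \<subseteq> {1..n}" "\<And>k. k \<in> {1..n} - J \<Longrightarrow> g k = (0 :: complex \<Rightarrow> complex)"
  shows "(\<Sum>k\<in>{1..n}. g k) = (\<Sum>k\<in>J. g k)"
  using assms by (intro sum.mono_neutral_right) auto

lemma left_term_zero:
  assumes D: "upper_zero D" and i: "i \<in> {1..n}" and j: "j \<in> {1..n}" and k: "k \<in> {1..n}" and f: "f \<in> carr (H j)"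
    and "k < j \<or> i + D < k"
  shows "entry i k (mult_op (\<Phi> k j) f) = 0"
  using assms(6)
proof
  assume "k < j"
  then show ?thesis using mult_zero_entry[OF Phi k j _ f] entry_zero[OF i k] by simp
next
  assume "i + D < k"
  then show ?thesis using D i k mult_entry_mem[OF Phi k j f] by (auto simp: upper_zero_def)
qed

lemma right_term_zero:
  assumes D: "upper_zero D" and i: "i \<in> {1..n}" and j: "j \<in> {1..n}" and k: "k \<in> {1..n}" and f: "f \<in> carr (H j)"
    and "i < k \<or> k + D < j"
  shows "mult_op (\<Phi>' i k) (entry k j f) = 0"
  using assms(6)
proof
  assume "i < k"
  then show ?thesis using mult_zero_entry[OF Phi' i k _ entry_mem[OF k j f]] by simp
next
  assume "k + D < j"
  then have "entry k j f = 0" using D j k f by (auto simp: upper_zero_def)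
  then show ?thesis by (simp add: mult_op_def fun_eq_iff)
qed

text \<open>Next to the region where \<open>Z\<close> vanishes, its entries commute with multiplication by \<open>z\<close>.\<close>

lemma boundary_diagonal:
  assumes D: "upper_zero D" and i: "i \<in> {1..n}" and j: "j \<in> {1..n}" and ij: "j = i + D" and f: "f \<in> carr (H j)"
  shows "entry i j f = mult_op (entry_symbol i j) f"
  unfolding entry_symbol_def
proof (rule commuting_eq_mult_op[OF disc[OF j] disc[OF i] entry_bounded[OF i j] _ f])
  fix g assume g: "g \<in> carr (H j)"
  have "(\<Sum>k\<in>{1..n}. entry i k (mult_op (\<Phi> k j) g)) = (\<Sum>k\<in>{j}. entry i k (mult_op (\<Phi> k j) g))"
    by (rule sum_window, use j in simp, rule left_term_zero[OF D i j _ g]) (use ij in auto)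
  moreover have "(\<Sum>k\<in>{1..n}. mult_op (\<Phi>' i k) (entry k j g)) = (\<Sum>k\<in>{i}. mult_op (\<Phi>' i k) (entry k j g))"
    by (rule sum_window, use i in simp, rule right_term_zero[OF D i j _ g]) (use ij in auto)
  ultimately show "entry i j (zmul g) = zmul (entry i j g)"
    using block_relation[OF i j g] mult_diag_entry[of \<Phi>, OF diag[OF j] j g]
      mult_diag_entry[of \<Phi>', OF diag'[OF i] i entry_mem[OF i j g]] by simp
qed

text \<open>
  One diagonal further down the commutator of an entry with \<open>z\<close> is a multiplication operator, which
  has to vanish.  In the first row and in the last column one of its two terms is absent.
\<close>

lemma next_diagonal:
  assumes D: "upper_zero D" and i: "i \<in> {1..n}" and j: "j \<in> {1..n}" and ij: "j + 1 = i + D" and z: "z \<in> ball 0 1"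
  shows "(if 1 < i then \<Phi>' i (i - 1) z * entry_symbol (i - 1) j z else 0) = (if j < n then entry_symbol i (j + 1) z * \<Phi> (j + 1) j z else 0)"
proof -
  define \<eta> where "\<eta> z = (if 1 < i then \<Phi>' i (i - 1) z * entry_symbol (i - 1) j z else 0) - (if j < n then entry_symbol i (j + 1) z * \<Phi> (j + 1) j z else 0)" for z
  have entry_symbol_hol: "entry_symbol k m holomorphic_on ball 0 1" if "k \<in> {1..n}" "m \<in> {1..n}" for k m
    unfolding entry_symbol_def
    by (rule disc_space.hol[OF disc entry_mem[OF _ _ disc_space.mon_mem[OF disc]]]) (use that in auto)
  have "(\<lambda>z. \<Phi>' i (i - 1) z * entry_symbol (i - 1) j z) holomorphic_on ball 0 1" if "1 < i"
    using that i j by (intro holomorphic_on_mult entry_symbol_hol hinf_holD lower_triD(1)[OF Phi']) auto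
  then have hol1: "(\<lambda>z. if 1 < i then \<Phi>' i (i - 1) z * entry_symbol (i - 1) j z else 0) holomorphic_on ball 0 1"
    by (cases "1 < i") simp_all
  have "(\<lambda>z. entry_symbol i (j + 1) z * \<Phi> (j + 1) j z) holomorphic_on ball 0 1" if "j < n"
    using that i j by (intro holomorphic_on_mult entry_symbol_hol hinf_holD lower_triD(1)[OF Phi]) auto
  then have hol2: "(\<lambda>z. if j < n then entry_symbol i (j + 1) z * \<Phi> (j + 1) j z else 0) holomorphic_on ball 0 1"
    by (cases "j < n") simp_all
  have hol: "\<eta> holomorphic_on ball 0 1"
    unfolding \<eta>_def by (rule holomorphic_on_diff[OF hol1 hol2])
  have comm: "entry i j (zmul f) = zmul (entry i j f) + mult_op \<eta> f" if f: "f \<in> carr (H j)" for f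
  proof -
    have L: "(\<Sum>k\<in>{1..n}. entry i k (mult_op (\<Phi> k j) f)) = entry i j (zmul f) + (if j < n then mult_op (entry_symbol i (j + 1)) (mult_op (\<Phi> (j + 1) j) f) else 0)"
    proof (cases "j < n")
      case True
      then have j1: "j + 1 \<in> {1..n}" by auto
      have "(\<Sum>k\<in>{1..n}. entry i k (mult_op (\<Phi> k j) f)) = (\<Sum>k\<in>{j, j + 1}. entry i k (mult_op (\<Phi> k j) f))"
        by (rule sum_window, use j j1 in simp, rule left_term_zero[OF D i j _ f]) (use ij j1 in auto)
      then show ?thesis
        using True mult_diag_entry[of \<Phi>, OF diag[OF j] j f]
          boundary_diagonal[OF D i j1 ij mult_entry_mem[OF Phi j1 j f]] by simp
    next
      case False
      have "(\<Sum>k\<in>{1..n}. entry i k (mult_op (\<Phi> k j) f)) = (\<Sum>k\<in>{j}. entry i k (mult_op (\<Phi> k j) f))"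
        by (rule sum_window, use j in simp, rule left_term_zero[OF D i j _ f]) (use j ij False in auto)
      then show ?thesis using False mult_diag_entry[of \<Phi>, OF diag[OF j] j f] by simp
    qed
    have R: "(\<Sum>k\<in>{1..n}. mult_op (\<Phi>' i k) (entry k j f)) = zmul (entry i j f) + (if 1 < i then mult_op (\<Phi>' i (i - 1)) (mult_op (entry_symbol (i - 1) j) f) else 0)"
    proof (cases "1 < i")
      case True
      then have i1: "i - 1 \<in> {1..n}" "j = i - 1 + D" using i ij by auto
      have "(\<Sum>k\<in>{1..n}. mult_op (\<Phi>' i k) (entry k j f)) = (\<Sum>k\<in>{i, i - 1}. mult_op (\<Phi>' i k) (entry k j f))"
        by (rule sum_window, use i i1 in simp, rule right_term_zero[OF D i j _ f]) (use ij i1 in auto)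
      then show ?thesis
        using True mult_diag_entry[of \<Phi>', OF diag'[OF i] i entry_mem[OF i j f]]
          boundary_diagonal[OF D i1(1) j i1(2) f] by simp
    next
      case False
      have "(\<Sum>k\<in>{1..n}. mult_op (\<Phi>' i k) (entry k j f)) = (\<Sum>k\<in>{i}. mult_op (\<Phi>' i k) (entry k j f))"
        by (rule sum_window, use i in simp, rule right_term_zero[OF D i j _ f]) (use i ij False in auto)
      then show ?thesis using False mult_diag_entry[of \<Phi>', OF diag'[OF i] i entry_mem[OF i j f]] by simp
    qed
    have "entry i j (zmul f) + (if j < n then mult_op (entry_symbol i (j + 1)) (mult_op (\<Phi> (j + 1) j) f) else 0)
        = zmul (entry i j f) + (if 1 < i then mult_op (\<Phi>' i (i - 1)) (mult_op (entry_symbol (i - 1) j) f) else 0)"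
      using block_relation[OF i j f] L R by simp
    then have "entry i j (zmul f) = zmul (entry i j f)
        + ((if 1 < i then mult_op (\<Phi>' i (i - 1)) (mult_op (entry_symbol (i - 1) j) f) else 0)
          - (if j < n then mult_op (entry_symbol i (j + 1)) (mult_op (\<Phi> (j + 1) j) f) else 0))"
      by (simp add: algebra_simps)
    also have "\<dots> = zmul (entry i j f) + mult_op \<eta> f"
      by (auto simp: mult_op_def \<eta>_def fun_eq_iff algebra_simps)
    finally show ?thesis .
  qed
  have lam: "lam i < lam j + 2"
  proof (cases "i \<le> j")
    case True
    then show ?thesis using lam_mono[OF i j] by simp
  next
    case False
    then have "i = j + 1" "j \<in> {1..n - 1}" using i j ij by auto
    then show ?thesis using lam_step by simp
  qed
  have "\<eta> z = 0"
    by (rule commutator_multiplication_eq_zero[OF disc[OF j] disc[OF i] lam entry_bounded[OF i j] hol comm])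
       (use z in auto)
  then show ?thesis by (simp add: \<eta>_def)
qed

text \<open>
  Descending induction over the diagonals.  On each of them the relation for \<open>i = 1\<close> has left hand
  side \<open>0\<close>; from there the symbols vanish one after the other, as no
  subdiagonal entry of \<open>\<Phi>\<close> is identically zero.
\<close>

lemma upper_zero_0: "upper_zero 0"
proof -
  have "upper_zero D" if "D \<le> n" for D
    using that
  proof (induction D rule: inc_induct)
    case base
    show ?case by (auto simp: upper_zero_def)
  next
    case (step d)
    note D = step.IH
    have hol: "entry_symbol k m holomorphic_on ball 0 1" if "k \<in> {1..n}" "m \<in> {1..n}" for k m
      unfolding entry_symbol_def
      by (rule disc_space.hol[OF disc entry_mem[OF _ _ disc_space.mon_mem[OF disc]]]) (use that in auto)
    have entry_symbol_0: "entry_symbol i (i + Suc d) z = 0" if "1 \<le> i" "i + Suc d \<le> n" "z \<in> ball 0 1" for i z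
      using that
    proof (induction i arbitrary: z rule: nat_induct_at_least)
      case base
      have r: "1 \<in> {1..n}" "Suc d \<in> {1..n}" "Suc d \<in> {1..n - 1}" "1 + Suc d \<in> {1..n}" using base by auto
      have prod: "entry_symbol 1 (1 + Suc d) w * \<Phi> (Suc d + 1) (Suc d) w = 0" if "w \<in> ball 0 1" for w
        using next_diagonal[OF D r(1,2) _ that] r by simp
      have "\<Phi> (Suc d + 1) (Suc d) holomorphic_on ball 0 1"
        by (rule hinf_holD[OF lower_triD(1)[OF Phi]]) (use r in auto)
      from holomorphic_product_eq_zero[OF hol[OF r(1,4)] this prod sub[OF r(3)] base(2)] show ?case .
    next
      case (Suc i)
      have r: "Suc i \<in> {1..n}" "i + Suc d \<in> {1..n}" "i + Suc d \<in> {1..n - 1}" "Suc i + Suc d \<in> {1..n}" using Suc by auto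
      have prod: "entry_symbol (Suc i) (Suc i + Suc d) w * \<Phi> (i + Suc d + 1) (i + Suc d) w = 0" if w: "w \<in> ball 0 1" for w
        using next_diagonal[OF D r(1,2) _ w] r Suc.IH[of w] Suc.prems w Suc.hyps by simp
      have "\<Phi> (i + Suc d + 1) (i + Suc d) holomorphic_on ball 0 1"
        by (rule hinf_holD[OF lower_triD(1)[OF Phi]]) (use r in auto)
      from holomorphic_product_eq_zero[OF hol[OF r(1,4)] this prod sub[OF r(3)] Suc.prems(2)] show ?case .
    qed
    show ?case
      unfolding upper_zero_def
    proof (intro ballI impI)
      fix i j f assume ij: "i \<in> {1..n}" "j \<in> {1..n}" "i + d < j" and f: "f \<in> carr (H j)"
      show "entry i j f = 0"
      proof (cases "j = i + Suc d")
        case True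
        have "entry_symbol i j z * f z = 0" for z
          using entry_symbol_0[of i z] disc_space.vanish[OF disc[OF ij(2)] f, of z] ij True by (cases "z \<in> ball 0 1") auto
        then show ?thesis
          using boundary_diagonal[OF D ij(1,2) True f] by (simp add: mult_op_def fun_eq_iff)
      next
        case False
        then show ?thesis using D ij f by (auto simp: upper_zero_def)
      qed
    qed
  qed
  then show ?thesis by blast
qed

lemma entry_upper: "i \<in> {1..n} \<Longrightarrow> j \<in> {1..n} \<Longrightarrow> i < j \<Longrightarrow> f \<in> carr (H j) \<Longrightarrow> entry i j f = 0"
  using upper_zero_0 by (auto simp: upper_zero_def)

lemma entry_diag: "i \<in> {1..n} \<Longrightarrow> f \<in> carr (H i) \<Longrightarrow> entry i i f = mult_op (entry_symbol i i) f"
  by (rule boundary_diagonal[OF upper_zero_0]) auto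

lemma sub_relation:
  assumes i: "i \<in> {1..n - 1}" and z: "z \<in> ball 0 1"
  shows "\<Phi>' (i + 1) i z * entry_symbol i i z = entry_symbol (i + 1) (i + 1) z * \<Phi> (i + 1) i z"
proof -
  have "i + 1 \<in> {1..n}" "i \<in> {1..n}" "i < n" using i by auto
  then show ?thesis using next_diagonal[OF upper_zero_0, of "i + 1" i z] z by simp
qed

lemma entry_symbol_bounded:
  assumes i: "i \<in> {1..n}"
  shows "\<exists>C. \<forall>z\<in>ball 0 1. cmod (entry_symbol i i z) \<le> C"
  by (rule multiplier_bounded[OF disc[OF i]])
     (use entry_bounded[OF i i] bounded_op_cong[OF H_ip[OF i] entry_diag[OF i]] in simp)

end

text \<open>Both operators are lower triangular, so only \<open>Z\<^sub>i\<^sub>i W\<^sub>i\<^sub>i\<close> contributes to the diagonal of \<open>Z W\<close>.\<close>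

lemma intertwiner_diagonal_inverse:
  assumes Z: "intertwiner n H lam \<Phi> \<Phi>' Z" and W: "intertwiner n H lam \<Phi>' \<Phi> W"
    and ZW: "\<And>x. x \<in> carr (direct_sum {1..n} H) \<Longrightarrow> Z (W x) = x"
    and i: "i \<in> {1..n}" and z: "z \<in> ball 0 1"
  shows "intertwiner.entry_symbol Z i i z * intertwiner.entry_symbol W i i z = 1"
proof -
  interpret Z: intertwiner n H lam \<Phi> \<Phi>' Z by fact
  interpret W: intertwiner n H lam \<Phi>' \<Phi> W by fact
  interpret D: disc_space "H i" "lam i" using Z.disc[OF i] .
  let ?m = "mon 0"
  have m: "?m \<in> carr (H i)" by (rule D.mon_mem)
  have s: "single i ?m \<in> carr Z.S" by (rule Z.single_mem[OF i m])
  have Ws: "W (single i ?m) \<in> carr Z.S" by (rule bounded_opD(1)[OF W.Z s])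
  have "?m = Z (W (single i ?m)) i" using ZW[OF s] by (simp add: single_def)
  also have "\<dots> = (\<Sum>k\<in>{1..n}. Z.entry i k (W.entry k i ?m))"
    using Z.block_expansion[OF Z.Z Ws] by (simp add: Z.entry_def W.entry_def)
  also have "\<dots> = (\<Sum>k\<in>{i}. Z.entry i k (W.entry k i ?m))"
  proof (rule sum.mono_neutral_right)
    show "\<forall>k\<in>{1..n} - {i}. Z.entry i k (W.entry k i ?m) = 0"
    proof
      fix k assume k: "k \<in> {1..n} - {i}"
      show "Z.entry i k (W.entry k i ?m) = 0"
      proof (cases "i < k")
        case True
        then show ?thesis using k i m by (intro Z.entry_upper W.entry_mem) auto
      next
        case False
        then have "W.entry k i ?m = 0" using k i m by (intro W.entry_upper) auto
        then show ?thesis using k i by (simp add: Z.entry_zero)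
      qed
    qed
  qed (use i in auto)
  also have "\<dots> = mult_op (Z.entry_symbol i i) (mult_op (W.entry_symbol i i) ?m)"
    using Z.entry_diag[OF i W.entry_mem[OF i i m]] W.entry_diag[OF i m] by simp
  finally have "?m z = mult_op (Z.entry_symbol i i) (mult_op (W.entry_symbol i i) ?m) z" by (rule fun_cong)
  then show ?thesis using z by (simp add: mult_op_def dfun_def)
qed


section \<open>The nilpotent part as a single Jordan block\<close>

fun cyc :: "nat \<Rightarrow> matfun \<Rightarrow> nat \<Rightarrow> nat \<Rightarrow> complex \<Rightarrow> complex" where
  "cyc n F 0 i z = (if i = 1 then 1 else 0)"
| "cyc n F (Suc k) i z = (\<Sum>j\<in>{1..n}. (F i j z - (if i = j then z else 0)) * cyc n F k j z)"

definition jordan :: matfun where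
  "jordan i j z = (if i = j then z else if i = j + 1 then 1 else 0)"

text \<open>
  With units on the subdiagonal, the nilpotent part moves \<open>e\<^sub>1\<close> through all coordinates: \<open>e\<^sub>1\<close> is a cyclic
  vector over the algebra of bounded analytic functions.
\<close>

definition cyclic_tri :: "nat \<Rightarrow> matfun \<Rightarrow> bool" where
  "cyclic_tri n F \<longleftrightarrow> lower_tri n F \<and> (\<forall>i\<in>{1..n}. \<forall>z\<in>ball 0 1. F i i z = z) \<and>
     (\<forall>i\<in>{1..n - 1}. hinf (\<lambda>z. 1 / F (i + 1) i z) \<and> (\<forall>z\<in>ball 0 1. F (i + 1) i z \<noteq> 0))"

lemma cyclic_triD:
  assumes "cyclic_tri n F"
  shows "lower_tri n F" "i \<in> {1..n} \<Longrightarrow> z \<in> ball 0 1 \<Longrightarrow> F i i z = z"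
    "i \<in> {1..n - 1} \<Longrightarrow> hinf (\<lambda>z. 1 / F (i + 1) i z)"
    "i \<in> {1..n - 1} \<Longrightarrow> z \<in> ball 0 1 \<Longrightarrow> F (i + 1) i z \<noteq> 0"
  using assms by (simp_all add: cyclic_tri_def)

lemma cyc_zero:
  assumes F: "cyclic_tri n F" and z: "z \<in> ball 0 1"
  shows "i \<in> {1..n} \<Longrightarrow> i \<le> k \<Longrightarrow> cyc n F k i z = 0"
proof (induction k arbitrary: i)
  case (Suc k)
  have "(F i j z - (if i = j then z else 0)) * cyc n F k j z = 0" if j: "j \<in> {1..n}" for j
  proof (cases "i \<le> j")
    case True
    then show ?thesis using lower_triD(2)[OF cyclic_triD(1)[OF F] Suc.prems(1) j _ z] cyclic_triD(2)[OF F j z] by (cases "i = j") auto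
  next
    case False
    then show ?thesis using Suc.IH[OF j] Suc.prems by simp
  qed
  then show ?case unfolding cyc.simps by (intro sum.neutral) blast
qed simp

lemma cyc_diag:
  assumes F: "cyclic_tri n F" and z: "z \<in> ball 0 1"
  shows "Suc k \<in> {1..n} \<Longrightarrow> cyc n F k (Suc k) z = (\<Prod>m\<in>{1..k}. F (m + 1) m z)"
proof (induction k)
  case (Suc k)
  have "(F (Suc (Suc k)) j z - (if Suc (Suc k) = j then z else 0)) * cyc n F k j z
      = (if j = Suc k then F (Suc (Suc k)) (Suc k) z * cyc n F k (Suc k) z else 0)" if j: "j \<in> {1..n}" for j
  proof -
    consider "j \<le> k" | "j = Suc k" | "j = Suc (Suc k)" | "Suc (Suc k) < j" by linarith
    then show ?thesis
    proof cases
      case 1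
      then show ?thesis using cyc_zero[OF F z j] by simp
    next
      case 3
      then show ?thesis using cyclic_triD(2)[OF F j z] by simp
    next
      case 4
      then show ?thesis using lower_triD(2)[OF cyclic_triD(1)[OF F] Suc.prems j 4 z] by simp
    qed simp
  qed
  then have "cyc n F (Suc k) (Suc (Suc k)) z
      = (\<Sum>j\<in>{1..n}. if j = Suc k then F (Suc (Suc k)) (Suc k) z * cyc n F k (Suc k) z else 0)"
    unfolding cyc.simps by (rule sum.cong[OF refl])
  then show ?case using Suc by (simp add: mult.commute)
qed simp

text \<open>
  The columns \<open>e\<^sub>1, N e\<^sub>1, N\<^sup>2 e\<^sub>1, \<dots>\<close> of \<open>P\<close>, for \<open>N = F - z\<close>, form a lower triangular matrix
  whose diagonal consists of products of subdiagonal entries of \<open>F\<close>, and \<open>N\<close> maps each column to the next.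
\<close>

definition cyc_mat :: "nat \<Rightarrow> matfun \<Rightarrow> matfun" where
  "cyc_mat n F i k = cyc n F (k - 1) i"

lemma cyclic_basis:
  assumes F: "cyclic_tri n F"
  shows "lower_tri n (cyc_mat n F)" "mat_eq n (mat_mul n F (cyc_mat n F)) (mat_mul n (cyc_mat n F) jordan)"
    and "\<And>i. i \<in> {1..n} \<Longrightarrow> hinf (\<lambda>z. 1 / cyc_mat n F i i z)"
    and "\<And>i z. i \<in> {1..n} \<Longrightarrow> z \<in> ball 0 1 \<Longrightarrow> cyc_mat n F i i z \<noteq> 0"
proof -
  define P where "P = cyc_mat n F"
  have P_def': "P i k = cyc n F (k - 1) i" for i k by (simp add: P_def cyc_mat_def)
  have hc: "hinf (cyc n F k i)" if "i \<in> {1..n}" for k i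
    using that
  proof (induction k arbitrary: i)
    case 0
    have "cyc n F 0 i = (\<lambda>z. if i = 1 then 1 else 0)" by (simp add: fun_eq_iff)
    then show ?case by auto
  next
    case (Suc k)
    have "hinf (\<lambda>z. \<Sum>j\<in>{1..n}. (F i j z + - (if i = j then z else 0)) * cyc n F k j z)"
    proof (intro hinf_sum hinf_mult hinf_add hinf_uminus)
      fix j assume j: "j \<in> {1..n}"
      show "hinf (F i j)" by (rule lower_triD(1)[OF cyclic_triD(1)[OF F] Suc.prems j])
      show "hinf (\<lambda>z. if i = j then z else 0)" by (cases "i = j") auto
      show "hinf (cyc n F k j)" by (rule Suc.IH[OF j])
    qed
    moreover have "cyc n F (Suc k) i = (\<lambda>z. \<Sum>j\<in>{1..n}. (F i j z + - (if i = j then z else 0)) * cyc n F k j z)"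
      by (simp add: fun_eq_iff)
    ultimately show ?case by simp
  qed
  show "lower_tri n (cyc_mat n F)"
    unfolding lower_tri_def cyc_mat_def using hc cyc_zero[OF F] by auto
  have Pd: "P i i z = (\<Prod>m\<in>{1..i - 1}. F (m + 1) m z)" if "i \<in> {1..n}" "z \<in> ball 0 1" for i z
    using cyc_diag[OF F that(2), of "i - 1"] that by (simp add: P_def')
  show "cyc_mat n F i i z \<noteq> 0" if "i \<in> {1..n}" "z \<in> ball 0 1" for i z
    unfolding Pd[OF that, unfolded P_def] using cyclic_triD(4)[OF F] that by (auto simp: prod_zero_iff)
  show "hinf (\<lambda>z. 1 / cyc_mat n F i i z)" if i: "i \<in> {1..n}" for i
  proof -
    have prod: "hinf (\<lambda>z. \<Prod>m\<in>A. 1 / F (m + 1) m z)" if "finite A" "A \<subseteq> {1..n - 1}" for A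
      using that
    proof (induction A)
      case (insert m A)
      then have "hinf (\<lambda>z. 1 / F (m + 1) m z * (\<Prod>m\<in>A. 1 / F (m + 1) m z))"
        by (intro hinf_mult cyclic_triD(3)[OF F]) auto
      then show ?case using insert.hyps by simp
    qed auto
    have prod_i: "hinf (\<lambda>z. \<Prod>m\<in>{1..i - 1}. 1 / F (m + 1) m z)"
      by (rule prod) (use i in auto)
    have eq: "1 / cyc_mat n F i i z = (\<Prod>m\<in>{1..i - 1}. 1 / F (m + 1) m z)" if "z \<in> ball 0 1" for z
      unfolding Pd[OF i that, unfolded P_def] by (simp add: prod_dividef)
    have "hinf (\<lambda>z. 1 / cyc_mat n F i i z) \<longleftrightarrow> hinf (\<lambda>z. \<Prod>m\<in>{1..i - 1}. 1 / F (m + 1) m z)"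
      by (rule hinf_cong) (rule eq)
    then show ?thesis using prod_i by blast
  qed
  show "mat_eq n (mat_mul n F (cyc_mat n F)) (mat_mul n (cyc_mat n F) jordan)"
    unfolding mat_eq_def P_def[symmetric]
  proof (intro ballI)
    fix i k and z :: complex assume ik: "i \<in> {1..n}" "k \<in> {1..n}" and z: "z \<in> ball 0 1"
    have "mat_mul n F P i k z = (\<Sum>j\<in>{1..n}. (F i j z - (if i = j then z else 0)) * P j k z + (if j = i then z * P i k z else 0))"
      unfolding mat_mul_def by (intro sum.cong) (auto simp: algebra_simps)
    also have "\<dots> = (\<Sum>j\<in>{1..n}. (F i j z - (if i = j then z else 0)) * P j k z) + z * P i k z"
      using ik by (simp add: sum.distrib)
    also have "(\<Sum>j\<in>{1..n}. (F i j z - (if i = j then z else 0)) * P j k z) = cyc n F k i z"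
      using ik by (cases k) (simp_all add: P_def')
    finally have 1: "mat_mul n F P i k z = cyc n F k i z + z * P i k z" .
    have "mat_mul n P jordan i k z = (\<Sum>j\<in>{1..n}. (if j = k then z * P i k z else 0) + (if j = k + 1 then P i (k + 1) z else 0))"
      unfolding mat_mul_def jordan_def by (intro sum.cong) auto
    also have "\<dots> = z * P i k z + (if k + 1 \<le> n then P i (k + 1) z else 0)"
      using ik by (simp add: sum.distrib)
    also have "(if k + 1 \<le> n then P i (k + 1) z else 0) = cyc n F k i z"
      using cyc_zero[OF F z ik(1), of k] ik by (auto simp: P_def')
    finally show "mat_mul n F P i k z = mat_mul n P jordan i k z" using 1 by simp
  qed
qed

context disc_tuple
begin

text \<open>Two such matrices are similar to the same Jordan block, hence to each other.\<close>

lemma cyclic_tri_similar: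
  assumes F: "cyclic_tri n F" and G: "cyclic_tri n G"
  shows "\<exists>Z. invertible_op S Z \<and> (\<forall>x\<in>carr S. Z (mat_op n F x) = mat_op n G (Z x))"
proof -
  define P where "P = cyc_mat n F"
  define Q where "Q = cyc_mat n G"
  note P = cyclic_basis[OF F, folded P_def]
  note Q = cyclic_basis[OF G, folded Q_def]
  have J: "lower_tri n jordan"
  proof -
    have "jordan i j = (if i = j then (\<lambda>z. z) else if i = j + 1 then (\<lambda>z. 1) else (\<lambda>z. 0))" for i j
      by (simp add: jordan_def fun_eq_iff)
    then show ?thesis by (auto simp: lower_tri_def)
  qed
  have Pinv: "invertible_op S (mat_op n P)" and Qinv: "invertible_op S (mat_op n Q)"
    using mat_op_invertible_of_diagonal[OF P(1,3,4)] mat_op_invertible_of_diagonal[OF Q(1,3,4)] by blast+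
  obtain P' where P': "bounded_op S S P'" "\<forall>x\<in>carr S. P' (mat_op n P x) = x" "\<forall>x\<in>carr S. mat_op n P (P' x) = x"
    using Pinv by (auto simp: invertible_op_def)
  have P'inv: "invertible_op S P'"
    unfolding invertible_op_def using P' mat_op_bounded[OF P(1)] by blast
  have "invertible_op S (\<lambda>x. mat_op n Q (P' x))"
    by (rule invertible_op_compose[OF K.ip_sp_axioms Qinv P'inv])
  moreover have "mat_op n Q (P' (mat_op n F x)) = mat_op n G (mat_op n Q (P' x))" if x: "x \<in> carr S" for x
  proof -
    have y: "P' x \<in> carr S" by (rule bounded_opD(1)[OF P'(1) x])
    have "mat_op n F x = mat_op n F (mat_op n P (P' x))" using P'(3) x by simp
    also have "\<dots> = mat_op n P (mat_op n jordan (P' x))"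
      unfolding mat_op_mul by (rule mat_op_cong[OF y P(2)])
    finally have "P' (mat_op n F x) = mat_op n jordan (P' x)"
      using P'(2) mat_op_mem[OF J y] by simp
    moreover have "mat_op n Q (mat_op n jordan (P' x)) = mat_op n G (mat_op n Q (P' x))"
      unfolding mat_op_mul using mat_op_cong[OF y Q(2)] by simp
    ultimately show ?thesis by simp
  qed
  ultimately show ?thesis by blast
qed

end


section \<open>Zeros of the subdiagonal functions\<close>

lemma disc_automorphism_Moebius:
  assumes a: "cmod a < 1"
  shows "disc_automorphism (Moebius_function t a)"
proof -
  define a' where "a' = - exp (\<i> * of_real t) * a"
  have a': "cmod a' < 1" using Moebius_mutually_inverse(1)[OF a, of t] by (simp add: a'_def)
  show ?thesis
    unfolding disc_automorphism_def
    using Moebius_function_holomorphic[OF a] Moebius_function_holomorphic[OF a']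
      Moebius_function_norm_lt_1[OF a] Moebius_function_norm_lt_1[OF a']
      Moebius_mutually_inverse(2,3)[OF a, where t = t, folded a'_def]
    by (auto intro!: exI[of _ "Moebius_function (- t) a'"])
qed

text \<open>
  If \<open>\<psi> \<circ> u\<close> is dominated by \<open>\<psi>\<close> for every automorphism \<open>u\<close>, then the zero set of \<open>\<psi>\<close> is invariant.
  The automorphisms act transitively on the disc, and the rotations act transitively on the circle, so
  a single zero would make \<open>\<psi>\<close> vanish on the disc or on the circle.
\<close>

lemma nonvanishing_if_quasi_invariant:
  assumes hol: "\<psi> holomorphic_on ball 0 1" and cont: "continuous_on (cball 0 1) \<psi>"
    and nz: "\<exists>z\<in>ball 0 1. \<psi> z \<noteq> 0"
    and inv: "\<And>f. disc_automorphism f \<Longrightarrow> \<exists>C. \<forall>s\<in>ball 0 1. cmod (\<psi> (cnj (f (cnj s)))) \<le> C * cmod (\<psi> s)"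
    and s0: "s0 \<in> cball 0 1"
  shows "\<psi> s0 \<noteq> 0"
proof
  assume z0: "\<psi> s0 = 0"
  have move: "\<psi> (cnj (Moebius_function t a (cnj s))) = 0" if asm: "\<psi> s = 0" "cmod s < 1" "cmod a < 1" for s t a
  proof -
    obtain C where "\<forall>s\<in>ball 0 1. cmod (\<psi> (cnj (Moebius_function t a (cnj s)))) \<le> C * cmod (\<psi> s)"
      using inv[OF disc_automorphism_Moebius[OF asm(3)]] by blast
    then have "cmod (\<psi> (cnj (Moebius_function t a (cnj s)))) \<le> C * cmod (\<psi> s)" using asm(2) by simp
    then show ?thesis using asm(1) by simp
  qed
  show False
  proof (cases "cmod s0 < 1")
    case True
    \<comment> \<open>the zero is moved to the origin first, and from there to any other point\<close>
    have "\<psi> 0 = 0" using move[OF z0 True, of "cnj s0" 0] True by (simp add: Moebius_function_eq_zero)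
    then have "\<psi> w = 0" if "cmod w < 1" for w
      using move[of 0 "- cnj w" 0] that by (simp add: Moebius_function_of_zero)
    then show False using nz by auto
  next
    case False
    then have s1: "cmod s0 = 1" using s0 by simp
    have circle: "\<psi> w = 0" if w: "cmod w = 1" for w
    proof -
      define c where "c = w / s0"
      have "cmod c = 1" using w s1 by (simp add: c_def norm_divide)
      then have ce: "exp (\<i> * of_real (Arg c)) = c" using Arg_eq[of c] by (cases "c = 0") auto
      \<comment> \<open>conjugation reverses the angle of a rotation\<close>
      obtain C where C: "\<forall>s\<in>ball 0 1. cmod (\<psi> (cnj (Moebius_function (- Arg c) 0 (cnj s)))) \<le> C * cmod (\<psi> s)"
        using inv[OF disc_automorphism_Moebius[of 0 "- Arg c"]] by auto
      have rot: "cnj (Moebius_function (- Arg c) 0 (cnj s)) = c * s" for s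
        using ce by (simp add: Moebius_function_def exp_cnj)
      have lim: "((\<lambda>r::real. \<psi> (of_real r * y)) \<longlongrightarrow> \<psi> y) (at_left 1)" if "cmod y = 1" for y
      proof -
        have "continuous_on {0..1} (\<lambda>r::real. \<psi> (of_real r * y))"
          by (rule continuous_on_compose2[OF cont]) (use that in \<open>auto intro!: continuous_intros simp: norm_mult\<close>)
        then have "((\<lambda>r::real. \<psi> (of_real r * y)) \<longlongrightarrow> \<psi> (of_real 1 * y)) (at 1 within {0..1})"
          unfolding continuous_on_def by (rule bspec) simp
        then show ?thesis by (simp add: at_within_Icc_at_left)
      qed
      have "cmod (\<psi> w) \<le> C * cmod (\<psi> s0)"
      proof (rule tendsto_le)
        show "((\<lambda>r::real. C * cmod (\<psi> (of_real r * s0))) \<longlongrightarrow> C * cmod (\<psi> s0)) (at_left 1)"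
          by (intro tendsto_intros lim s1)
        show "((\<lambda>r::real. cmod (\<psi> (of_real r * w))) \<longlongrightarrow> cmod (\<psi> w)) (at_left 1)"
          by (intro tendsto_intros lim w)
        have "cmod (\<psi> (of_real r * w)) \<le> C * cmod (\<psi> (of_real r * s0))" if "0 < r" "r < 1" for r
        proof -
          have "of_real r * w = c * (of_real r * s0)" using s1 by (auto simp: c_def)
          then show ?thesis
            using C[rule_format, of "of_real r * s0"] that s1
            unfolding rot by (simp add: norm_mult mult.left_commute)
        qed
        then show "\<forall>\<^sub>F r in at_left 1. cmod (\<psi> (of_real r * w)) \<le> C * cmod (\<psi> (of_real r * s0))"
          by (auto simp: eventually_at_left_field intro!: exI[of _ 0])
      qed simp
      then show ?thesis using z0 by simp
    qed
    have "\<psi> z = 0" if "z \<in> ball 0 1" for z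
    proof -
      have fr: "cmod (\<psi> y) \<le> 0" if "y \<in> frontier (ball 0 1)" for y
        using circle[of y] that by simp
      have "cmod (\<psi> z) \<le> 0"
        by (rule maximum_modulus_frontier[of \<psi> "ball 0 1"])
           (use hol cont fr that in \<open>auto simp: interior_open\<close>)
      then show ?thesis by simp
    qed
    then show False using nz by blast
  qed
qed

text \<open>The hypothesis on \<open>\<psi>\<close> allows the non-zero value to be taken on the boundary only; continuity moves it inside.\<close>

lemma nonzero_in_open_disc:
  assumes cont: "continuous_on (cball 0 1) (\<psi> :: complex \<Rightarrow> complex)" and nz: "\<exists>z\<in>cball 0 1. \<psi> z \<noteq> 0"
  shows "\<exists>z\<in>ball 0 1. \<psi> z \<noteq> 0"
proof (rule ccontr)
  assume *: "\<not> (\<exists>z\<in>ball 0 1. \<psi> z \<noteq> 0)"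
  have "\<psi> z = 0" if "z \<in> cball 0 1" for z
    by (rule continuous_constant_on_closure[of "ball 0 1"]) (use cont * that in auto)
  then show False using nz by blast
qed


section \<open>Weak homogeneity in the matrix model\<close>

lemma cnj_Moebius: "cnj (Moebius_function t a (cnj s)) = Moebius_function (- t) (cnj a) s"
  by (simp add: Moebius_function_def exp_cnj)

context tri_model
begin

lemma automorphism_params:
  assumes "disc_automorphism f"
  obtains t a where "(SOME p. moebius_params f p) = (t, a)" "cmod a < 1"
    "\<And>z. z \<in> ball 0 1 \<Longrightarrow> f z = Moebius_function t a z"
proof -
  obtain t a where ta: "(SOME p. moebius_params f p) = (t, a)" by force
  have "moebius_params f (t, a)"
    using someI_ex[OF disc_automorphism_moebius_params[OF assms]] ta by simp
  then show ?thesis using that[OF ta] by (simp add: moebius_params_def)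
qed

text \<open>
  The matrix \<open>G = u(\<Phi>) \<circ> u\<^sup>-\<^sup>1\<close>, with \<open>q = u'\<close>.  The derivative of an automorphism is bounded and
  bounded away from zero, so zeros and units on the subdiagonal are preserved.
\<close>

lemma similar_model:
  assumes f: "disc_automorphism f"
  obtains G q u where
    "\<And>s. s \<in> ball 0 1 \<Longrightarrow> u s = cnj (f (cnj s))" "\<And>s. s \<in> ball 0 1 \<Longrightarrow> u s \<in> ball 0 1"
    "lower_tri n G" "\<And>i z. i \<in> {1..n} \<Longrightarrow> z \<in> ball 0 1 \<Longrightarrow> G i i z = z"
    "hinf q" "hinf (\<lambda>z. 1 / q z)" "\<And>s. s \<in> ball 0 1 \<Longrightarrow> q s \<noteq> 0"
    "\<And>i s. i \<in> {1..n - 1} \<Longrightarrow> s \<in> ball 0 1 \<Longrightarrow> G (i + 1) i (u s) = q s * \<Phi> (i + 1) i s"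
    "\<And>i. i \<in> {1..n - 1} \<Longrightarrow> hinf (\<lambda>z. 1 / \<Phi> (i + 1) i z) \<Longrightarrow> hinf (\<lambda>z. 1 / G (i + 1) i z)"
    "\<And>z. z \<in> ball 0 1 \<Longrightarrow> \<exists>s\<in>ball 0 1. z = u s"
    "similar_op S (moebius_op S f T) T \<longleftrightarrow>
      (\<exists>Z. invertible_op S Z \<and> (\<forall>x\<in>carr S. Z (M x) = mat_op n G (Z x)))"
proof -
  obtain t a where p: "(SOME p. moebius_params f p) = (t, a)" and a: "cmod a < 1"
    and f_eq: "\<And>z. z \<in> ball 0 1 \<Longrightarrow> f z = Moebius_function t a z"
    using automorphism_params[OF f] by metis
  define b where "b = cnj a"
  have b: "cmod b < 1" using a by (simp add: b_def)
  obtain F where F: "lower_tri n F"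
    "\<And>x. x \<in> carr S \<Longrightarrow> mat_op n F x - cnj b *\<^sub>C M (mat_op n F x) = exp (\<i> * of_real (- t)) *\<^sub>C (M x - b *\<^sub>C x)"
    "\<And>i z. i \<in> {1..n} \<Longrightarrow> z \<in> ball 0 1 \<Longrightarrow> F i i z = Moebius_function (- t) b z"
    "\<And>i z. i \<in> {1..n - 1} \<Longrightarrow> z \<in> ball 0 1 \<Longrightarrow>
       F (i + 1) i z = exp (\<i> * of_real (- t)) * of_real (1 - (cmod b)\<^sup>2) / (1 - cnj b * z)\<^sup>2 * \<Phi> (i + 1) i z"
    using Moebius_matrix[OF b, of "- t"] by metis
  define u where "u = Moebius_function (- t) b"
  define b' where "b' = - exp (\<i> * of_real (- t)) * b"
  define w where "w = Moebius_function t b'"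
  note ch = Moebius_mutually_inverse[OF b, where t = "- t", folded b'_def, unfolded minus_minus]
  have u1: "cmod (u s) < 1" and w1: "cmod (w s) < 1" and uw: "u (w s) = s" and wu: "w (u s) = s" if "cmod s < 1" for s
    using Moebius_function_norm_lt_1[OF b that, of "- t"] Moebius_function_norm_lt_1[OF ch(1) that, of t] ch(2,3)[OF that]
    by (simp_all add: u_def w_def)
  have w_hol: "w holomorphic_on ball 0 1" unfolding w_def by (rule Moebius_function_holomorphic[OF ch(1)])
  define k where "k = exp (\<i> * of_real (- t)) * of_real (1 - (cmod b)\<^sup>2)"
  have k0: "k \<noteq> 0"
  proof -
    have "(cmod b)\<^sup>2 < 1" using b by (simp add: abs_square_less_1)
    then have "complex_of_real (1 - (cmod b)\<^sup>2) \<noteq> 0" by (simp del: of_real_diff)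
    then show ?thesis by (simp add: k_def)
  qed
  define q where "q z = k / (1 - cnj b * z)\<^sup>2" for z
  have nz: "1 - cnj b * z \<noteq> 0" if "z \<in> cball 0 1" for z
    using norm_cnj_mult_less[OF b, of z] that by (intro one_minus_nonzero) auto
  have q0: "q z \<noteq> 0" if "z \<in> cball 0 1" for z using k0 nz[OF that] by (simp add: q_def)
  have q: "q holomorphic_on ball 0 1" "continuous_on (cball 0 1) q"
    unfolding q_def using nz by (intro holomorphic_intros continuous_intros; force)+
  define G where "G = (\<lambda>i j z. F i j (w z))"
  show ?thesis
  proof (rule that)
    show "u s = cnj (f (cnj s))" if "s \<in> ball 0 1" for s
      using f_eq[of "cnj s"] that by (simp add: cnj_Moebius u_def b_def)
    show "u s \<in> ball 0 1" if "s \<in> ball 0 1" for s using u1 that by simp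
    have hw: "hinf (\<lambda>z. g (w z))" if "hinf g" for g
      by (rule hinf_compose[OF that w_hol]) (use w1 in auto)
    show "lower_tri n G"
      unfolding lower_tri_def G_def using lower_triD[OF F(1)] hw w1 by simp
    show "G i i z = z" if "i \<in> {1..n}" "z \<in> ball 0 1" for i z
      using F(3)[of i "w z"] uw w1 that by (simp add: G_def u_def)
    show "hinf q" by (rule hinf_of_continuous[OF q])
    show hq: "hinf (\<lambda>z. 1 / q z)" by (rule hinf_inverse_of_continuous[OF q q0])
    show "q s \<noteq> 0" if "s \<in> ball 0 1" for s using q0 that by simp
    show "G (i + 1) i (u s) = q s * \<Phi> (i + 1) i s" if "i \<in> {1..n - 1}" "s \<in> ball 0 1" for i s
      using F(4)[OF that] wu[of s] that by (simp add: G_def q_def k_def)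
    show "hinf (\<lambda>z. 1 / G (i + 1) i z)" if i: "i \<in> {1..n - 1}" and h: "hinf (\<lambda>z. 1 / \<Phi> (i + 1) i z)" for i
    proof -
      have "hinf (\<lambda>z. 1 / q z * (1 / \<Phi> (i + 1) i z))" by (rule hinf_mult[OF hq h])
      from hw[OF this] have 1: "hinf (\<lambda>z. 1 / q (w z) * (1 / \<Phi> (i + 1) i (w z)))" .
      have eq: "1 / G (i + 1) i z = 1 / q (w z) * (1 / \<Phi> (i + 1) i (w z))" if "z \<in> ball 0 1" for z
        using F(4)[OF i, of "w z"] w1[of z] that by (simp add: G_def q_def k_def)
      have "hinf (\<lambda>z. 1 / G (i + 1) i z) \<longleftrightarrow> hinf (\<lambda>z. 1 / q (w z) * (1 / \<Phi> (i + 1) i (w z)))"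
        by (rule hinf_cong) (rule eq)
      with 1 show ?thesis by blast
    qed
    show "\<exists>s\<in>ball 0 1. z = u s" if "z \<in> ball 0 1" for z
      using uw[of z] w1[of z] that by (intro bexI[of _ "w z"]) auto
    show "similar_op S (moebius_op S f T) T \<longleftrightarrow>
      (\<exists>Z. invertible_op S Z \<and> (\<forall>x\<in>carr S. Z (M x) = mat_op n G (Z x)))"
      unfolding G_def w_def b'_def b_def
      by (rule similar_iff_intertwining[OF p a F(1)]) (use F(2) in \<open>simp add: b_def\<close>)
  qed
qed

lemma similar_if_cyclic:
  assumes C: "cyclic_tri n \<Phi>" and f: "disc_automorphism f"
  shows "similar_op S (moebius_op S f T) T"
proof (rule similar_model[OF f])
  fix G q u
  assume G: "\<And>s. s \<in> ball 0 1 \<Longrightarrow> u s \<in> ball 0 1"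
    "lower_tri n G" "\<And>i z. i \<in> {1..n} \<Longrightarrow> z \<in> ball 0 1 \<Longrightarrow> G i i z = z"
    and q: "\<And>s. s \<in> ball 0 1 \<Longrightarrow> q s \<noteq> (0::complex)"
    and sub: "\<And>i s. i \<in> {1..n - 1} \<Longrightarrow> s \<in> ball 0 1 \<Longrightarrow> G (i + 1) i (u s) = q s * \<Phi> (i + 1) i s"
    and inv: "\<And>i. i \<in> {1..n - 1} \<Longrightarrow> hinf (\<lambda>z. 1 / \<Phi> (i + 1) i z) \<Longrightarrow> hinf (\<lambda>z. 1 / G (i + 1) i z)"
    and surj: "\<And>z. z \<in> ball 0 1 \<Longrightarrow> \<exists>s\<in>ball 0 1. z = u s"
    and sim: "similar_op S (moebius_op S f T) T \<longleftrightarrow>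
      (\<exists>Z. invertible_op S Z \<and> (\<forall>x\<in>carr S. Z (M x) = mat_op n G (Z x)))"
  have "G (i + 1) i z \<noteq> 0" if i: "i \<in> {1..n - 1}" and z: "z \<in> ball 0 1" for i z
  proof -
    obtain s where "s \<in> ball 0 1" "z = u s" using surj[OF z] by blast
    then show ?thesis using sub[OF i, of s] q[of s] cyclic_triD(4)[OF C i, of s] by simp
  qed
  then have "cyclic_tri n G"
    unfolding cyclic_tri_def using G inv cyclic_triD(3)[OF C] by auto
  then show ?thesis unfolding sim by (rule cyclic_tri_similar[OF C])
qed

text \<open>
  An invertible intertwiner and its inverse are lower triangular with diagonal entries \<open>x\<^sub>i\<close> and
  \<open>1 / x\<^sub>i\<close> that are bounded functions.  Substituting
  \<open>z = u s\<close> in the relation on the subdiagonal gives \<open>q \<psi>\<^sub>i (x\<^sub>i \<circ> u) = (x\<^sub>i\<^sub>+\<^sub>1 \<circ> u) (\<psi>\<^sub>i \<circ> u)\<close>, which can be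
  solved for \<open>\<psi>\<^sub>i \<circ> u\<close>.
\<close>

lemma quasi_invariant_if_similar:
  assumes lam_step: "\<And>i. i \<in> {1..n - 1} \<Longrightarrow> lam (i + 1) < lam i + 2"
    and nz: "\<And>i. i \<in> {1..n - 1} \<Longrightarrow> \<exists>z\<in>ball 0 1. \<Phi> (i + 1) i z \<noteq> 0"
    and f: "disc_automorphism f" and s: "similar_op S (moebius_op S f T) T" and i: "i \<in> {1..n - 1}"
  shows "\<exists>C. \<forall>s\<in>ball 0 1. cmod (\<Phi> (i + 1) i (cnj (f (cnj s)))) \<le> C * cmod (\<Phi> (i + 1) i s)"
proof (rule similar_model[OF f])
  fix G q u
  assume u: "\<And>s. s \<in> ball 0 1 \<Longrightarrow> u s = cnj (f (cnj s))" "\<And>s. s \<in> ball 0 1 \<Longrightarrow> u s \<in> ball 0 1"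
    and G: "lower_tri n G" "\<And>i z. i \<in> {1..n} \<Longrightarrow> z \<in> ball 0 1 \<Longrightarrow> G i i z = z"
    and q: "hinf q" "\<And>s. s \<in> ball 0 1 \<Longrightarrow> q s \<noteq> (0::complex)"
    and sub: "\<And>i s. i \<in> {1..n - 1} \<Longrightarrow> s \<in> ball 0 1 \<Longrightarrow> G (i + 1) i (u s) = q s * \<Phi> (i + 1) i s"
    and sim: "similar_op S (moebius_op S f T) T \<longleftrightarrow>
      (\<exists>Z. invertible_op S Z \<and> (\<forall>x\<in>carr S. Z (M x) = mat_op n G (Z x)))"
  obtain Z where "invertible_op S Z" and ZM: "\<forall>x\<in>carr S. Z (M x) = mat_op n G (Z x)"
    using s sim by blast
  then obtain W where Z: "bounded_op S S Z" and W: "bounded_op S S W"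
    and WZ: "\<forall>x\<in>carr S. W (Z x) = x" and ZW: "\<forall>x\<in>carr S. Z (W x) = x"
    by (auto simp: invertible_op_def)
  have WM: "W (mat_op n G x) = M (W x)" if x: "x \<in> carr S" for x
  proof -
    have Wx: "W x \<in> carr S" by (rule bounded_opD(1)[OF W x])
    have "W (mat_op n G x) = W (mat_op n G (Z (W x)))" using ZW x by simp
    also have "\<dots> = W (Z (M (W x)))" using ZM Wx by simp
    also have "\<dots> = M (W x)" using WZ bounded_opD(1)[OF M Wx] by blast
    finally show ?thesis .
  qed
  have nzG: "\<exists>z\<in>ball 0 1. G (i + 1) i z \<noteq> 0" if i: "i \<in> {1..n - 1}" for i
  proof -
    obtain s where s: "s \<in> ball 0 1" "\<Phi> (i + 1) i s \<noteq> 0" using nz[OF i] by blast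
    then show ?thesis using sub[OF i s(1)] q(2)[OF s(1)] u(2)[OF s(1)] by (intro bexI[of _ "u s"]) auto
  qed
  have iZ: "intertwiner n H lam \<Phi> G Z"
    unfolding intertwiner_def intertwiner_axioms_def
    using disc_tuple_axioms lam_step Phi diag G nz Z ZM by blast
  have iW: "intertwiner n H lam G \<Phi> W"
    unfolding intertwiner_def intertwiner_axioms_def
    using disc_tuple_axioms lam_step Phi diag G nzG W WM by blast
  interpret Z: intertwiner n H lam \<Phi> G Z by (rule iZ)
  interpret W: intertwiner n H lam G \<Phi> W by (rule iW)
  have i': "i \<in> {1..n}" "i + 1 \<in> {1..n}" using i by auto
  obtain A where A: "\<forall>z\<in>ball 0 1. cmod (Z.entry_symbol i i z) \<le> A" using Z.entry_symbol_bounded[OF i'(1)] by blast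
  obtain B where B: "\<forall>z\<in>ball 0 1. cmod (W.entry_symbol (i + 1) (i + 1) z) \<le> B" using W.entry_symbol_bounded[OF i'(2)] by blast
  obtain Q where Q: "\<forall>z\<in>ball 0 1. cmod (q z) \<le> Q" using q(1) by (auto simp: hinf_def)
  have "cmod (\<Phi> (i + 1) i (cnj (f (cnj s)))) \<le> (B * Q * A) * cmod (\<Phi> (i + 1) i s)" if s: "s \<in> ball 0 1" for s
  proof -
    let ?x = "Z.entry_symbol i i (u s)" and ?y = "Z.entry_symbol (i + 1) (i + 1) (u s)" and ?y' = "W.entry_symbol (i + 1) (i + 1) (u s)"
    have us: "u s \<in> ball 0 1" by (rule u(2)[OF s])
    have "q s * \<Phi> (i + 1) i s * ?x = ?y * \<Phi> (i + 1) i (u s)"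
      using Z.sub_relation[OF i us] sub[OF i s] by simp
    moreover have "?y * ?y' = 1"
      by (rule intertwiner_diagonal_inverse[OF iZ iW _ i'(2) us]) (use ZW in blast)
    ultimately have "\<Phi> (i + 1) i (u s) = ?y' * q s * ?x * \<Phi> (i + 1) i s"
      by (metis (no_types, opaque_lifting) mult.assoc mult.commute mult_1)
    then have "cmod (\<Phi> (i + 1) i (u s)) = (cmod ?y' * cmod (q s) * cmod ?x) * cmod (\<Phi> (i + 1) i s)"
      by (simp add: norm_mult)
    also have "\<dots> \<le> (B * Q * A) * cmod (\<Phi> (i + 1) i s)"
    proof (intro mult_right_mono mult_mono)
      show y: "cmod ?y' \<le> B" and qs: "cmod (q s) \<le> Q" and "cmod ?x \<le> A" using A B Q us s by blast+
      show "0 \<le> B" using y norm_ge_zero order_trans by blast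
      then show "0 \<le> B * Q" using qs norm_ge_zero order_trans by (metis mult_nonneg_nonneg)
    qed auto
    finally show ?thesis using u(1)[OF s] by simp
  qed
  then show ?thesis by blast
qed

end


section \<open>The triangular operator as an adjoint\<close>

text \<open>
  The matrix whose adjoint is the triangular operator: its entry \<open>(i, j)\<close> comes from the entry \<open>(j, i)\<close> of
  the operator, hence the swapped indices of \<open>\<phi>\<close>.
\<close>

definition symbol :: "(nat \<Rightarrow> complex \<Rightarrow> complex) \<Rightarrow> (nat \<Rightarrow> nat \<Rightarrow> complex \<Rightarrow> complex) \<Rightarrow> matfun" where
  "symbol \<psi> \<phi> i j = (if i < j then (\<lambda>z. 0) else if i = j then (\<lambda>z. z) else if i = j + 1 then \<psi> j else \<phi> j i)"

lemma (in disc_tuple) triangular_op_adjoint: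
  assumes F: "lower_tri n (symbol \<psi> \<phi>)"
  shows "bounded_op S S (triangular_op n H \<psi> \<phi>)"
    and "is_adjoint S S (mat_op n (symbol \<psi> \<phi>)) (triangular_op n H \<psi> \<phi>)"
proof -
  define B where "B i j = (if i \<le> j then adjoint_op (H i) (H j) (mult_op (symbol \<psi> \<phi> j i)) else (\<lambda>_. 0))" for i j
  have T_eq: "triangular_op n H \<psi> \<phi> = block_op {1..n} B"
  proof (intro ext)
    fix x i z
    have "(\<Sum>j\<in>{1..n}. B i j (x j)) = (\<Sum>j=i..n. B i j (x j))" if "i \<in> {1..n}"
      by (rule sum.mono_neutral_right) (use that in \<open>auto simp: B_def\<close>)
    moreover have "(\<Sum>j=i..n. B i j (x j)) =
        (\<Sum>j=i..n. adjoint_op (H i) (H j) (mult_op (if j = i then (\<lambda>z. z) else if j = i + 1 then \<psi> i else \<phi> i j)) (x j))"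
      by (intro sum.cong refl) (auto simp: B_def symbol_def)
    ultimately show "triangular_op n H \<psi> \<phi> x i z = block_op {1..n} B x i z"
      by (simp add: triangular_op_def block_op_def)
  qed
  have A: "bounded_op (H j) (H i) (mult_op (symbol \<psi> \<phi> i j))" if "i \<in> {1..n}" "j \<in> {1..n}" for i j
    by (rule mult_op_entry_bounded[OF F that])
  have Bb: "bounded_op (H j) (H i) (B i j)" if "i \<in> {1..n}" "j \<in> {1..n}" for i j
    using adjoint_op_properties(2)[OF H_hilbert[OF that(1)] H_ip[OF that(2)] A[OF that(2,1)]]
      bounded_op_zero_op[OF H_ip[OF that(2)] H_ip[OF that(1)]]
    by (cases "i \<le> j") (simp_all add: B_def)
  show "bounded_op S S (triangular_op n H \<psi> \<phi>)"
    unfolding T_eq by (rule block_op_bounded[OF Bb])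
  show "is_adjoint S S (mat_op n (symbol \<psi> \<phi>)) (triangular_op n H \<psi> \<phi>)"
    unfolding T_eq mat_op_def
  proof (rule block_op_is_adjoint[OF A Bb])
    fix i j assume ij: "i \<in> {1..n}" "j \<in> {1..n}"
    show "is_adjoint (H j) (H i) (mult_op (symbol \<psi> \<phi> i j)) (B j i)"
    proof (cases "j \<le> i")
      case True
      then show ?thesis
        using adjoint_op_properties(1)[OF H_hilbert[OF ij(2)] H_ip[OF ij(1)] A[OF ij]] by (simp add: B_def)
    next
      case False
      then have "mult_op (symbol \<psi> \<phi> i j) f = 0" for f by (simp add: symbol_def mult_op_def fun_eq_iff)
      then show ?thesis
        using False by (simp add: is_adjoint_def B_def ip_sp.ip_zero_left[OF H_ip[OF ij(1)]] ip_sp.ip_zero_right[OF H_ip[OF ij(2)]])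
    qed
  qed
qed

theorem proposition5p4:
  fixes n :: nat
    and lam :: "nat \<Rightarrow> real"
    and H :: "nat \<Rightarrow> (complex \<Rightarrow> complex) ip_space"
    and \<psi> :: "nat \<Rightarrow> complex \<Rightarrow> complex"
    and \<phi> :: "nat \<Rightarrow> nat \<Rightarrow> complex \<Rightarrow> complex"
  assumes n: "1 \<le> n"
    and lam_ge: "\<forall>i\<in>{1..n}. 1 \<le> lam i"
    and lam_step: "\<forall>i\<in>{1..n-1}. lam i \<le> lam (i + 1) \<and> lam (i + 1) < lam i + 2"
    and H_rkhs: "\<forall>i\<in>{1..n}. rkhs (ball 0 1) (disc_kernel (lam i)) (H i)"
    and H_hol: "\<forall>i\<in>{1..n}. \<forall>f\<in>carr (H i). f holomorphic_on ball 0 1"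
    and psi: "\<forall>i\<in>{1..n-1}. continuous_on (cball 0 1) (\<psi> i) \<and> \<psi> i holomorphic_on ball 0 1
                          \<and> (\<exists>z\<in>cball 0 1. \<psi> i z \<noteq> 0)"
    and phi: "\<forall>i\<in>{1..n}. \<forall>j\<in>{1..n}. i + 2 \<le> j \<longrightarrow>
                \<phi> i j holomorphic_on ball 0 1 \<and> bounded (\<phi> i j ` ball 0 1)"
  shows "weakly_homogeneous (direct_sum {1..n} H) (triangular_op n H \<psi> \<phi>) \<longleftrightarrow>
           (\<forall>i\<in>{1..n-1}. \<forall>z\<in>cball 0 1. \<psi> i z \<noteq> 0)"
proof -
  have mono: "lam i \<le> lam j" if "i \<in> {1..n}" "j \<in> {1..n}" "i \<le> j" for i j
    using that(3,1,2)
  proof (induction j rule: dec_induct)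
    case (step m)
    then have "lam i \<le> lam m" by simp
    also have "\<dots> \<le> lam (m + 1)" using lam_step step by auto
    finally show ?case by simp
  qed simp
  interpret disc_tuple n H lam
  proof (rule disc_tuple.intro)
    show "disc_space (H i) (lam i)" if "i \<in> {1..n}" for i
      unfolding disc_space_iff using that lam_ge H_rkhs H_hol by blast
  qed (rule mono)
  define \<Phi> where "\<Phi> = symbol \<psi> \<phi>"
  have Phi: "lower_tri n \<Phi>"
    unfolding lower_tri_def
  proof (intro ballI conjI impI)
    fix i j assume ij: "i \<in> {1..n}" "j \<in> {1..n}"
    have "hinf (\<psi> j)" if "i = j + 1"
      using psi ij that by (intro hinf_of_continuous) auto
    moreover have "hinf (\<phi> j i)" if "j + 2 \<le> i"
      using phi ij that unfolding hinf_def bounded_iff by (metis image_eqI)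
    ultimately show "hinf (\<Phi> i j)"
      by (cases "i < j"; cases "i = j"; cases "i = j + 1") (auto simp: \<Phi>_def symbol_def)
  qed (simp add: \<Phi>_def symbol_def)
  note T = triangular_op_adjoint[OF Phi[unfolded \<Phi>_def], folded \<Phi>_def]
  have "\<Phi> i i z = z" for i z by (simp add: \<Phi>_def symbol_def)
  with Phi T interpret tri_model n H lam \<Phi> "triangular_op n H \<psi> \<phi>"
    by (intro tri_model.intro tri_model_axioms.intro disc_tuple_axioms) auto
  have sub: "\<Phi> (i + 1) i = \<psi> i" for i by (simp add: \<Phi>_def symbol_def)
  show ?thesis
  proof
    assume wh: "weakly_homogeneous S (triangular_op n H \<psi> \<phi>)"
    have nz: "\<exists>z\<in>ball 0 1. \<psi> i z \<noteq> 0" if "i \<in> {1..n - 1}" for i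
      using psi that by (intro nonzero_in_open_disc) auto
    show "\<forall>i\<in>{1..n-1}. \<forall>z\<in>cball 0 1. \<psi> i z \<noteq> 0"
    proof (intro ballI)
      fix i z assume i: "i \<in> {1..n - 1}" and z: "z \<in> cball (0::complex) 1"
      show "\<psi> i z \<noteq> 0"
      proof (rule nonvanishing_if_quasi_invariant[OF _ _ nz[OF i] _ z])
        fix f assume f: "disc_automorphism f"
        show "\<exists>C. \<forall>s\<in>ball 0 1. cmod (\<psi> i (cnj (f (cnj s)))) \<le> C * cmod (\<psi> i s)"
          using quasi_invariant_if_similar[OF _ _ f _ i, unfolded sub] lam_step nz wh f
          by (auto simp: weakly_homogeneous_def)
      qed (use psi i in auto)
    qed
  next
    assume nv: "\<forall>i\<in>{1..n-1}. \<forall>z\<in>cball 0 1. \<psi> i z \<noteq> 0"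
    have "cyclic_tri n \<Phi>"
      unfolding cyclic_tri_def sub
    proof (intro conjI ballI)
      show "hinf (\<lambda>z. 1 / \<psi> i z)" if "i \<in> {1..n - 1}" for i
        using psi nv that by (intro hinf_inverse_of_continuous) auto
    qed (use Phi diag nv in auto)
    then show "weakly_homogeneous S (triangular_op n H \<psi> \<phi>)"
      unfolding weakly_homogeneous_def using T(1) spectrum_subset similar_if_cyclic by blast
  qed
qed

end
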